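(* Let $\Delta=(w,\lambda)$ be a complete simplicial multi-fan in $V$ on $[m]$ with $|\lambda(i)|=1$ for every $i\in[m]$. Let $\overline V=(V_1,\dots,V_m)\in\mathrm{Mink}$. Let $P$ be a multi-polytope based on $\Delta$ with support parameters $c_1,\dots,c_m$, and let $\partial_P=c_1\partial_1+\dots+c_m\partial_m\in\mathcal A^2(\Delta)$. Then $\mathrm{vol}(F_i)=V_i$ for all $i\in[m]$ if and only if $\eta(\partial_P^{n-1})=(n-1)!\,\overline V$.
   Context: Let $V$ be an oriented real vector space of dimension $n\ge1$ with an inner product; identify $V^*=V$. A complete simplicial multi-fan $\Delta=(w,\lambda)$ on $[m]$: $w\colon\binom{[m]}n\to\mathbb R$, $\lambda\colon[m]\to V$, with $\{\lambda(i)\}_{i\in I}$ a basis whenever $w(I)\ne0$, and (orienting each such $I$ via $\lambda$ and the orientation of $V$) $\sum_Iw(I)I$ a cycle in the real chain complex of the $(n-1)$-skeleton of the simplex on $[m]$ (augmentation if $n=1$). $K$ is the simplicial complex of all subsets of the $I$ with $w(I)\ne0$. Volume polynomial and algebra: with $\deg x_i=2$, for $w(I)\ne0$ let $\{u^I_i\}$ be the basis of $V^*$ dual to $\{\lambda(i)\}_{i\in I}$, $\iota_I(x_i)=u^I_i$ ($i\in I$), $0$ otherwise, $|\det\lambda_I|$ the volume of the parallelepiped on $\{\lambda(i)\}_{i\in I}$; for $x$ of degree $2n$, $\int_\Delta x=\sum_I\frac{w(I)\iota_I(x)}{|\det\lambda_I|\prod_{i\in I}\iota_I(x_i)}$ is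 a constant; $V_\Delta(c)=\frac1{n!}\int_\Delta(\sum c_ix_i)^n$; $\mathcal A^*(\Delta)=\mathbb R[\partial_1,\dots,\partial_m]/\mathrm{Ann}(V_\Delta)$, $\partial_i=\partial/\partial c_i$ of degree $2$. Each $a\in\mathcal A^{2j}(\Delta)$ gives a well-defined polynomial $aV_\Delta$ of degree $n-j$. $\mathrm{Mink}=\{(V_1,\dots,V_m)\in\mathbb R^m:\sum_iV_i\lambda(i)=0\}$, and $\eta\colon\mathcal A^{2n-2}(\Delta)\to\mathrm{Mink}$ sends $a$ to $(V_1,\dots,V_m)$ where $aV_\Delta=V_1c_1+\dots+V_mc_m$. Multi-polytopes: support parameters $c\in\mathbb R^m$ give hyperplanes $H_i=\{u:\langle u,\lambda(i)\rangle=c_i\}$. For $w(I)\ne0$, $p_I=\bigcap_{i\in I}H_i$; fix $v$ with all $\langle u^I_i,v\rangle\ne0$, $(-1)^I=(-1)^{\#\{i:\langle u^I_i,v\rangle>0\}}$, $(u^I_i)^+=\pm u^I_i$ with positive pairing with $v$, $\phi_I$ the indicator of $p_I+\mathrm{cone}\{(u^I_i)^+\}$; $DH=\sum_I(-1)^Iw(I)\phi_I$ (independent of $v$, compact support), and the volume is $\int DH$ w.r.t. Lebesgue measure. For a vertex $i$ of $K$, the facet $F_i$ is the multi-polytope in the hyperplane $H_i$ (Euclidean of dimension $n-1$) based on the projected multi-fan with vertices $\{j:\{i,j\}\in K\}$, characteristic vectors the orthogonal projections of $\lambda(j)$ to $\lambda(i)^\perp$, weights $J'\mapsto w(J'\cup\{i\})$,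 and hyperplanes $H_i\cap H_j$; $\mathrm{vol}(F_i)$ is its $(n-1)$-volume defined the same way (if $n=1$, $F_i$ is a point and $\mathrm{vol}(F_i)=w(\{i\})$). If $\{i\}\notin K$, $\mathrm{vol}(F_i):=0$. *)

theory Defs
  imports
    "HOL-Analysis.Analysis"
    "HOL-Library.Poly_Mapping"
    "HOL-Algebra.Algebraic_Closure_Type"
    "HOL-Algebra.QuotRing"
    "Jordan_Normal_Form.Determinant"
begin

text \<open>
  The oriented inner product space \<open>V\<close> is a type \<open>'a::euclidean_space\<close> of dimension
  \<open>n = DIM('a)\<close>, with its dual identified with itself via the inner product.
  The vertex set \<open>[m]\<close> is a finite linearly ordered type \<open>'m\<close>, so \<open>\<real>\<^sup>m\<close> is \<open>real ^ 'm\<close>.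
  A multi-fan is a pair of a weight function \<open>w\<close>, of which only the values on sets of the right
  cardinality are ever used, and a characteristic function \<open>lam\<close>.
\<close>

section \<open>Multi-fans\<close>

text \<open>
  The definitions that are needed both for the multi-fan itself and for its projections are
  relative to a linear subspace \<open>S\<close> (the space that the fan lives in) and a set \<open>N\<close> of vertices.
\<close>

definition mf_tops :: "'a::euclidean_space set \<Rightarrow> 'm set \<Rightarrow> ('m set \<Rightarrow> real) \<Rightarrow> 'm set set" where
  "mf_tops S N w = {I. I \<subseteq> N \<and> card I = dim S \<and> w I \<noteq> 0}"

definition dual_vec :: "'a::euclidean_space set \<Rightarrow> ('m \<Rightarrow> 'a) \<Rightarrow> 'm set \<Rightarrow> 'm \<Rightarrow> 'a" where
  "dual_vec S lam I i = (THE u. u \<in> S \<and> (\<forall>j\<in>I. u \<bullet> lam j = (if j = i then 1 else 0)))"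

definition mf_generic ::
  "'a::euclidean_space set \<Rightarrow> 'm set \<Rightarrow> ('m set \<Rightarrow> real) \<Rightarrow> ('m \<Rightarrow> 'a) \<Rightarrow> 'a \<Rightarrow> bool" where
  "mf_generic S N w lam v \<longleftrightarrow>
     v \<in> S \<and> (\<forall>I\<in>mf_tops S N w. \<forall>i\<in>I. dual_vec S lam I i \<bullet> v \<noteq> 0)"

definition mf_complex :: "'a::euclidean_space itself \<Rightarrow> ('m set \<Rightarrow> real) \<Rightarrow> 'm set set" where
  "mf_complex _ w = {J. \<exists>I\<in>mf_tops (UNIV :: 'a set) UNIV w. J \<subseteq> I}"

subsection \<open>Completeness\<close>

text \<open>An orientation of the space is given by an ordered basis, taken to be positive.\<close>

definition ordered_basis :: "'a::euclidean_space list \<Rightarrow> bool" where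
  "ordered_basis bs \<longleftrightarrow> distinct bs \<and> independent (set bs) \<and> span (set bs) = UNIV"

text \<open>
  The sign of the tuple \<open>vs\<close> relative to the orientation: the sign of the determinant of the
  matrix of its coordinates in the basis \<open>bs\<close>.
\<close>

definition orientation_sign :: "'a::euclidean_space list \<Rightarrow> 'a list \<Rightarrow> real" where
  "orientation_sign bs vs =
     sgn (Determinant.det (Matrix.mat (length bs) (length bs)
            (\<lambda>(i, j). representation (set bs) (vs ! i) (bs ! j))))"

text \<open>
  Simplicial chains of the simplex on \<open>'m\<close> are given by their coefficients with respect to the
  simplices oriented by the order of \<open>'m\<close>. The boundary of a chain of \<open>n\<close>-element simplices is a
  chain of \<open>n - 1\<close>-element simplices; for \<open>n = 1\<close> this is the augmentation, as the coefficient
  of the empty simplex.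
\<close>

definition chain_boundary :: "('m::{finite,linorder} set \<Rightarrow> real) \<Rightarrow> 'm set \<Rightarrow> real" where
  "chain_boundary z J = (\<Sum>i\<in>-J. (-1) ^ card {j\<in>J. j < i} * z (insert i J))"

text \<open>
  The chain \<open>\<Sum>\<^sub>I w(I) I\<close>, where \<open>I\<close> is oriented so that \<open>lam\<close> maps it to a positive basis.
\<close>

definition mf_chain ::
  "'a::euclidean_space list \<Rightarrow> ('m::{finite,linorder} set \<Rightarrow> real) \<Rightarrow> ('m \<Rightarrow> 'a) \<Rightarrow> 'm set \<Rightarrow> real" where
  "mf_chain bs w lam I =
     (if I \<in> mf_tops (UNIV :: 'a set) UNIV w
      then w I * orientation_sign bs (map lam (sorted_list_of_set I)) else 0)"

definition complete_multi_fan ::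
  "'a::euclidean_space list \<Rightarrow> ('m::{finite,linorder} set \<Rightarrow> real) \<Rightarrow> ('m \<Rightarrow> 'a) \<Rightarrow> bool" where
  "complete_multi_fan bs w lam \<longleftrightarrow>
     (\<forall>I\<in>mf_tops (UNIV :: 'a set) UNIV w. inj_on lam I \<and> independent (lam ` I) \<and> span (lam ` I) = UNIV) \<and>
     (\<forall>J. card J = DIM('a) - 1 \<longrightarrow> chain_boundary (mf_chain bs w lam) J = 0)"

section \<open>Polynomials in variables indexed by \<open>[m]\<close>\<close>

type_synonym 'm mvpoly = "('m \<Rightarrow>\<^sub>0 nat) \<Rightarrow>\<^sub>0 real"

definition linear_form :: "real ^ 'm \<Rightarrow> 'm::finite mvpoly" where
  "linear_form c = (\<Sum>i\<in>UNIV. Poly_Mapping.single (Poly_Mapping.single i 1) (vec_nth c i))"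

definition mv_eval :: "('m \<Rightarrow> real) \<Rightarrow> 'm mvpoly \<Rightarrow> real" where
  "mv_eval x p =
     (\<Sum>\<alpha>\<in>Poly_Mapping.keys p. Poly_Mapping.lookup p \<alpha> *
        (\<Prod>i\<in>Poly_Mapping.keys \<alpha>. x i ^ Poly_Mapping.lookup \<alpha> i))"

definition partial :: "'m \<Rightarrow> 'm mvpoly \<Rightarrow> 'm mvpoly" where
  "partial i p =
     (\<Sum>\<alpha>\<in>Poly_Mapping.keys p. Poly_Mapping.single (\<alpha> - Poly_Mapping.single i 1)
        (Poly_Mapping.lookup p \<alpha> * real (Poly_Mapping.lookup \<alpha> i)))"

text \<open>
  The polynomial \<open>D\<close>, with its variables read as the operators \<open>\<partial>\<^sub>i\<close>, applied to \<open>p\<close>. The partial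
  derivatives commute, so the order of composition in \<open>partial_power\<close> is immaterial.
\<close>

definition partial_power :: "('m::linorder \<Rightarrow>\<^sub>0 nat) \<Rightarrow> 'm mvpoly \<Rightarrow> 'm mvpoly" where
  "partial_power \<alpha> p =
     fold (\<lambda>i. partial i ^^ Poly_Mapping.lookup \<alpha> i) (sorted_list_of_set (Poly_Mapping.keys \<alpha>)) p"

definition diff_op :: "'m::linorder mvpoly \<Rightarrow> 'm mvpoly \<Rightarrow> 'm mvpoly" where
  "diff_op D p =
     (\<Sum>\<alpha>\<in>Poly_Mapping.keys D.
        Poly_Mapping.single 0 (Poly_Mapping.lookup D \<alpha>) * partial_power \<alpha> p)"

section \<open>The volume polynomial and the algebra of a multi-fan\<close>

definition abs_det :: "('m \<Rightarrow> 'a::euclidean_space) \<Rightarrow> 'm set \<Rightarrow> real" where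
  "abs_det lam I = measure lborel {\<Sum>i\<in>I. t i *\<^sub>R lam i | t. \<forall>i\<in>I. 0 \<le> t i \<and> t i \<le> 1}"

text \<open>
  Elements of the symmetric algebra of the dual of \<open>V\<close> are treated as polynomial functions on \<open>V\<close>:
  this is the value of \<open>\<iota>\<^sub>I x\<close> at \<open>v\<close>.
\<close>

definition mf_iota ::
  "('m \<Rightarrow> 'a::euclidean_space) \<Rightarrow> 'm set \<Rightarrow> 'm mvpoly \<Rightarrow> 'a \<Rightarrow> real" where
  "mf_iota lam I x v = mv_eval (\<lambda>i. if i \<in> I then dual_vec UNIV lam I i \<bullet> v else 0) x"

text \<open>
  The integral over the multi-fan is a rational function on \<open>V\<close>, and for \<open>x\<close> of top degree it is
  constant; its value is read off at the points where no denominator vanishes.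
\<close>

definition mf_integral ::
  "('m::finite set \<Rightarrow> real) \<Rightarrow> ('m \<Rightarrow> 'a::euclidean_space) \<Rightarrow> 'm mvpoly \<Rightarrow> real" where
  "mf_integral w lam x =
     (THE r. \<forall>v. mf_generic UNIV UNIV w lam v \<longrightarrow>
        (\<Sum>I\<in>mf_tops (UNIV :: 'a set) UNIV w.
           w I * mf_iota lam I x v / (abs_det lam I * (\<Prod>i\<in>I. dual_vec UNIV lam I i \<bullet> v))) = r)"

definition volume_poly ::
  "('m::finite set \<Rightarrow> real) \<Rightarrow> ('m \<Rightarrow> 'a::euclidean_space) \<Rightarrow> 'm mvpoly" where
  "volume_poly w lam =
     (THE p. \<forall>c :: real ^ 'm. mv_eval (vec_nth c) p =
        1 / fact (DIM('a)) * mf_integral w lam (linear_form c ^ DIM('a)))"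

definition mf_ann ::
  "('m::{finite,linorder} set \<Rightarrow> real) \<Rightarrow> ('m \<Rightarrow> 'a::euclidean_space) \<Rightarrow> 'm mvpoly set" where
  "mf_ann w lam = {D. diff_op D (volume_poly w lam) = 0}"

definition mf_algebra ::
  "('m::{finite,linorder} set \<Rightarrow> real) \<Rightarrow> ('m \<Rightarrow> 'a::euclidean_space) \<Rightarrow> 'm mvpoly set ring" where
  "mf_algebra w lam = ring_of_type_algebra Quot mf_ann w lam"

definition mf_class ::
  "('m::{finite,linorder} set \<Rightarrow> real) \<Rightarrow> ('m \<Rightarrow> 'a::euclidean_space) \<Rightarrow> 'm mvpoly \<Rightarrow> 'm mvpoly set" where
  "mf_class w lam D = mf_ann w lam +>\<^bsub>ring_of_type_algebra\<^esub> D"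

definition partial_P ::
  "('m::{finite,linorder} set \<Rightarrow> real) \<Rightarrow> ('m \<Rightarrow> 'a::euclidean_space) \<Rightarrow> real ^ 'm::{finite,linorder} \<Rightarrow> 'm mvpoly set" where
  "partial_P w lam c = mf_class w lam (linear_form c)"

definition mf_act ::
  "('m::{finite,linorder} set \<Rightarrow> real) \<Rightarrow> ('m \<Rightarrow> 'a::euclidean_space) \<Rightarrow> 'm mvpoly set \<Rightarrow> 'm mvpoly" where
  "mf_act w lam a = (THE q. \<forall>D\<in>a. diff_op D (volume_poly w lam) = q)"

definition mink :: "('m::finite \<Rightarrow> 'a::euclidean_space) \<Rightarrow> (real ^ 'm) set" where
  "mink lam = {U. (\<Sum>i\<in>UNIV. vec_nth U i *\<^sub>R lam i) = 0}"

text \<open>Meaningful for \<open>a\<close> in the component of degree \<open>2n - 2\<close>.\<close>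

definition eta ::
  "('m::{finite,linorder} set \<Rightarrow> real) \<Rightarrow> ('m \<Rightarrow> 'a::euclidean_space) \<Rightarrow> 'm mvpoly set \<Rightarrow> real ^ 'm::{finite,linorder}" where
  "eta w lam a = (THE U. mf_act w lam a = linear_form U)"

section \<open>Multi-polytopes\<close>

text \<open>
  A multi-polytope lives in an affine subspace \<open>A\<close> with direction space \<open>direction A\<close>; it is based on
  a multi-fan in the direction space and is given by hyperplanes \<open>H i\<close> of \<open>A\<close>.
\<close>

definition direction :: "'a::euclidean_space set \<Rightarrow> 'a set" where
  "direction A = {x - y | x y. x \<in> A \<and> y \<in> A}"

definition mp_vertex :: "'a::euclidean_space set \<Rightarrow> ('m \<Rightarrow> 'a set) \<Rightarrow> 'm set \<Rightarrow> 'a" where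
  "mp_vertex A H I = (THE p. p \<in> A \<and> (\<forall>i\<in>I. p \<in> H i))"

definition mp_cone ::
  "'a::euclidean_space set \<Rightarrow> ('m \<Rightarrow> 'a) \<Rightarrow> ('m \<Rightarrow> 'a set) \<Rightarrow> 'a \<Rightarrow> 'm set \<Rightarrow> 'a set" where
  "mp_cone A lam H v I =
     (\<lambda>y. mp_vertex A H I + y) ` (convex_cone hull
        ((\<lambda>i. sgn (dual_vec (direction A) lam I i \<bullet> v) *\<^sub>R dual_vec (direction A) lam I i) ` I))"

definition DH ::
  "'a::euclidean_space set \<Rightarrow> 'm set \<Rightarrow> ('m set \<Rightarrow> real) \<Rightarrow> ('m \<Rightarrow> 'a) \<Rightarrow> ('m \<Rightarrow> 'a set) \<Rightarrow> 'a \<Rightarrow> 'a \<Rightarrow> real" where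
  "DH A N w lam H v u =
     (\<Sum>I\<in>mf_tops (direction A) N w.
        (-1) ^ card {i\<in>I. dual_vec (direction A) lam I i \<bullet> v > 0} * w I *
        indicator (mp_cone A lam H v I) u)"

text \<open>
  Lebesgue measure on an affine subspace: the image of the product measure under Cartesian
  coordinates; the choice of the coordinates is immaterial. For \<open>A = UNIV\<close> this is \<open>lborel\<close>.
\<close>

definition affine_lborel :: "'a::euclidean_space set \<Rightarrow> 'a measure" where
  "affine_lborel A =
     (let (a, B) = (SOME (a, B). pairwise Linear_Algebra.orthogonal B \<and> (\<forall>b\<in>B. norm b = 1) \<and>
                                 A = (\<lambda>x. a + x) ` span B)
      in distr (\<Pi>\<^sub>M b\<in>B. lborel) borel (\<lambda>t. a + (\<Sum>b\<in>B. t b *\<^sub>R b)))"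

text \<open>
  The cones in \<open>DH\<close> are closed, so that \<open>DH\<close> depends on \<open>v\<close>, but only on a null set; its integral
  does not depend on \<open>v\<close>.
\<close>

definition mp_volume ::
  "'a::euclidean_space set \<Rightarrow> 'm set \<Rightarrow> ('m set \<Rightarrow> real) \<Rightarrow> ('m \<Rightarrow> 'a) \<Rightarrow> ('m \<Rightarrow> 'a set) \<Rightarrow> real" where
  "mp_volume A N w lam H =
     (let v = (SOME v. mf_generic (direction A) N w lam v)
      in \<integral>u. DH A N w lam H v u \<partial>affine_lborel A)"

definition support_hyperplane :: "('m::finite \<Rightarrow> 'a::euclidean_space) \<Rightarrow> real ^ 'm \<Rightarrow> 'm \<Rightarrow> 'a set" where
  "support_hyperplane lam c i = {u. u \<bullet> lam i = vec_nth c i}"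

definition orth_proj :: "'a::euclidean_space \<Rightarrow> 'a \<Rightarrow> 'a" where
  "orth_proj l x = x - ((x \<bullet> l) / (l \<bullet> l)) *\<^sub>R l"

definition facet_volume ::
  "('m::finite set \<Rightarrow> real) \<Rightarrow> ('m \<Rightarrow> 'a::euclidean_space) \<Rightarrow> real ^ 'm \<Rightarrow> 'm \<Rightarrow> real" where
  "facet_volume w lam c i =
     (if {i} \<notin> mf_complex TYPE('a) w then 0
      else if DIM('a) = 1 then w {i}
      else mp_volume (support_hyperplane lam c i)
             {j. j \<noteq> i \<and> {i, j} \<in> mf_complex TYPE('a) w}
             (\<lambda>J. w (insert i J))
             (\<lambda>j. orth_proj (lam i) (lam j))
             (\<lambda>j. support_hyperplane lam c i \<inter> support_hyperplane lam c j))"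

end

theory Submission
  imports Defs "HOL-Real_Asymp.Real_Asymp"
begin

text \<open>
  Write \<open>p\<^sub>I\<close> for the vertex and \<open>u\<^sup>I\<^sub>j\<close> for the dual basis of a maximal simplex \<open>I\<close>. Both sides are computed as
  rational expressions in a generic vector \<open>v\<close>. On the algebraic side,
  \<open>V\<^sub>\<Delta>(c) = \<Sum>\<^sub>I w(I) \<langle>p\<^sub>I, v\<rangle>\<^sup>n / (n! \<bar>det \<lambda>\<^sub>I\<bar> \<Prod>\<^sub>j \<langle>u\<^sup>I\<^sub>j, v\<rangle>)\<close>, so that the coefficient of \<open>c\<^sub>i\<close> in \<open>\<partial>\<^sub>P\<^sup>n\<^sup>-\<^sup>1 V\<^sub>\<Delta>\<close> is
  the sum over \<open>I \<ni> i\<close> of \<open>w(I) \<langle>p\<^sub>I, v\<rangle>\<^sup>n\<^sup>-\<^sup>1 / (\<bar>det \<lambda>\<^sub>I\<bar> \<Prod>\<^sub>j\<^sub>\<noteq>\<^sub>i \<langle>u\<^sup>I\<^sub>j, v\<rangle>)\<close>. On the geometric side, \<open>u\<^sup>I\<^sub>j\<close> with \<open>j \<noteq> i\<close>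
  are the dual vectors of the facet \<open>F\<^sub>i\<close>; integrating \<open>exp (- \<tau> \<langle>u, v\<rangle>)\<close> over the cones in its \<open>DH\<close> and
  letting \<open>\<tau>\<close> tend to \<open>0\<close> identifies \<open>(n - 1)! vol(F\<^sub>i)\<close> with the same sum, for \<open>v\<close> in \<open>\<lambda>(i)\<^sup>\<bottom>\<close>.

  The cycle condition enters twice, through the same identity \<open>cycle_sum_eq_0\<close>: it makes the first sum
  independent of \<open>v\<close>, and it makes \<open>DH\<close> vanish far away, which justifies the limit.
\<close>

section \<open>Polynomials and differential operators\<close>

\<comment> \<open>The cycle identity applies only to sums whose terms depend on a wall
  \<open>I - {k}\<close> and not on the simplex \<open>I\<close>. Both uses are prepared by a
  one-variable argument along a line \<open>v - t x\<close>: if \<open>a\<close>, \<open>e\<close>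
  are the coordinates of \<open>v\<close>, \<open>x\<close> with respect to \<open>I\<close>, the
  k-th one vanishes at \<open>t = a\<^sub>k / e\<^sub>k\<close>, and the others are then the
  coordinates of \<open>v\<close> in the basis with \<open>x\<close> in place of
  \<open>\<lambda>(k)\<close>, hence a function of the wall. Partial fractions in \<open>t\<close>
  serve the first use, counting the ends of a segment in \<open>t\<close> the second.

  Two obstacles shape the rest. A single cone has infinite volume in general, so only the damped
  integrals can be computed cone by cone; they have a pole of order up to \<open>n - 1\<close> in
  \<open>\<tau>\<close>, and the finite part can be read off only because the vanishing of
  \<open>DH\<close> far away shows that the limit exists. Moreover, vectors orthogonal to
  \<open>\<lambda>(i)\<close> need not be generic for the whole multi-fan, so the two sums are
  compared by a further limit. The unit length of \<open>\<lambda>(i)\<close> makes the factor of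
  the facet cone exactly \<open>1 / \<bar>det \<lambda>\<^sub>I\<bar>\<close>.\<close>
alias lookup = Poly_Mapping.lookup
alias single = Poly_Mapping.single
alias keys = Poly_Mapping.keys

lemmas vec_eq_iff = Finite_Cartesian_Product.vec_eq_iff

no_notation scalar_prod (infix "\<bullet>" 70)

lemma lookup_partial:
  "lookup (partial i p) \<beta> =
     real (lookup \<beta> i + 1) * lookup p (\<beta> + single i 1)"
proof -
  let ?s = "single i (1::nat)" and ?l = lookup
  \<comment> \<open>Subtraction of exponents is truncated, so an exponent without \<open>i\<close>
    is mapped to itself and could be a second preimage of \<open>\<beta>\<close>; its factor
    \<open>lookup \<alpha> i\<close> is 0, which leaves only
    \<open>\<beta> + single i 1\<close>.\<close>
  have eq: "(?l p \<alpha> * real (?l \<alpha> i) when \<alpha> - ?s = \<beta>) =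
      (if \<alpha> = \<beta> + ?s then ?l p \<alpha> * real (?l \<alpha> i) else 0)" for \<alpha>
  proof (cases "?l \<alpha> i = 0")
    case True
    then show ?thesis by (auto simp: lookup_add)
  next
    case False
    then have "\<alpha> - ?s + ?s = \<alpha>"
      by (intro poly_mapping_eqI) (auto simp: lookup_add lookup_minus lookup_single when_def)
    then have "\<alpha> - ?s = \<beta> \<longleftrightarrow> \<alpha> = \<beta> + ?s"
      by auto
    then show ?thesis by (simp add: when_def)
  qed
  have "?l (partial i p) \<beta> = (\<Sum>\<alpha>\<in>keys p. if \<alpha> = \<beta> + ?s then ?l p \<alpha> * real (?l \<alpha> i) else 0)"
    unfolding partial_def lookup_sum lookup_single eq ..
  also have "\<dots> = ?l p (\<beta> + ?s) * real (?l (\<beta> + ?s) i)"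
    by (subst sum.delta) (auto simp: in_keys_iff)
  also have "\<dots> = real (?l \<beta> i + 1) * ?l p (\<beta> + ?s)"
    by (simp add: lookup_add)
  finally show ?thesis .
qed

lemma lookup_partial_iterate:
  "lookup ((partial i ^^ k) p) \<beta> =
     fact (lookup \<beta> i + k) / fact (lookup \<beta> i) *
     lookup p (\<beta> + single i k)"
proof (induction k arbitrary: \<beta>)
  case (Suc k)
  have "\<beta> + single i 1 + single i k = \<beta> + single i (Suc k)"
    by (simp add: add.assoc flip: single_add)
  then show ?case
    by (simp add: lookup_partial Suc.IH lookup_add field_simps del: of_nat_Suc)
qed simp

text \<open>The multi-index factorial. A higher partial derivative multiplies coefficients by
  quotients of such factorials, and these telescope under composition.\<close>

definition mfact :: "('m::finite \<Rightarrow>\<^sub>0 nat) \<Rightarrow> real" where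
  "mfact \<alpha> = (\<Prod>i\<in>UNIV. fact (lookup \<alpha> i))"

lemma mfact_pos: "mfact \<alpha> > 0"
  by (simp add: mfact_def prod_pos)

lemma lookup_fold_partial:
  assumes "distinct is"
  shows "lookup (fold (\<lambda>i. partial i ^^ f i) is p) \<beta> =
    (\<Prod>i\<in>set is. fact (lookup \<beta> i + f i) / fact (lookup \<beta> i)) *
    lookup p (\<beta> + (\<Sum>i\<in>set is. single i (f i)))"
  using assms
proof (induction "is" arbitrary: p)
  case (Cons i js)
  have "lookup (\<beta> + (\<Sum>j\<in>set js. single j (f j))) i = lookup \<beta> i"
    using Cons.prems by (simp add: lookup_add lookup_sum lookup_single when_def)
  with Cons show ?case
    by (simp add: lookup_partial_iterate ac_simps)
qed simp

lemma poly_mapping_eq_sum_single: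
  assumes "finite A" "keys f \<subseteq> A"
  shows "(\<Sum>i\<in>A. single i (lookup f i)) = f"
  by (rule poly_mapping_eqI)
     (use assms in \<open>auto simp: lookup_sum lookup_single when_def in_keys_iff\<close>)

lemma lookup_partial_power:
  "lookup (partial_power \<alpha> p) \<beta> = mfact (\<alpha> + \<beta>) / mfact \<beta> * lookup p (\<alpha> + \<beta>)"
proof -
  have "(\<Prod>i\<in>keys \<alpha>. fact (lookup \<beta> i + lookup \<alpha> i) / fact (lookup \<beta> i) :: real)
      = (\<Prod>i\<in>UNIV. fact (lookup \<beta> i + lookup \<alpha> i) / fact (lookup \<beta> i))"
    by (rule prod.mono_neutral_left) (auto simp: in_keys_iff)
  also have "\<dots> = mfact (\<alpha> + \<beta>) / mfact \<beta>"
    by (simp add: mfact_def lookup_add prod_dividef add.commute)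
  finally show ?thesis
    by (simp add: partial_power_def lookup_fold_partial poly_mapping_eq_sum_single add.commute)
qed

lemma lookup_const_mult:
  fixes p :: "'m mvpoly"
  shows "lookup (single 0 r * p) \<beta> = r * lookup p \<beta>"
  by (simp flip: mult_map_scale_conv_mult add: Poly_Mapping.map.rep_eq when_def)

text \<open>Any finite superset \<open>A\<close> of the exponents is allowed, so that two operators
  can be expanded over a common set.\<close>

lemma lookup_diff_op:
  assumes "finite A" "keys D \<subseteq> A"
  shows "lookup (diff_op D p) \<beta> =
    (\<Sum>\<alpha>\<in>A. lookup D \<alpha> * (mfact (\<alpha> + \<beta>) / mfact \<beta> * lookup p (\<alpha> + \<beta>)))"
  unfolding diff_op_def lookup_sum lookup_const_mult lookup_partial_power
  by (rule sum.mono_neutral_left) (use assms in \<open>auto simp: in_keys_iff\<close>)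

lemma diff_op_add_left:
  fixes p :: "'m::{finite,linorder} mvpoly"
  shows "diff_op (D + E) p = diff_op D p + diff_op E p"
proof (rule poly_mapping_eqI)
  fix \<beta>
  let ?A = "keys D \<union> keys E"
  have "keys (D + E) \<subseteq> ?A" by (rule keys_add)
  then show "lookup (diff_op (D + E) p) \<beta> = lookup (diff_op D p + diff_op E p) \<beta>"
    by (simp add: lookup_diff_op[where A = ?A] lookup_add sum.distrib distrib_right add_divide_distrib)
qed

lemma diff_op_add_right:
  fixes p :: "'m::{finite,linorder} mvpoly"
  shows "diff_op D (p + q) = diff_op D p + diff_op D q"
  by (rule poly_mapping_eqI)
     (simp add: lookup_diff_op[OF _ order_refl] lookup_add sum.distrib distrib_left)

lemma diff_op_zero_left [simp]: "diff_op 0 p = 0"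
  by (simp add: diff_op_def)

lemma diff_op_zero_right [simp]: "diff_op D (0 :: 'm::{finite,linorder} mvpoly) = 0"
  by (rule poly_mapping_eqI) (simp add: lookup_diff_op[OF _ order_refl])

lemma diff_op_sum_left:
  "diff_op (\<Sum>x\<in>A. D x) (p :: 'm::{finite,linorder} mvpoly) = (\<Sum>x\<in>A. diff_op (D x) p)"
  by (induction A rule: infinite_finite_induct) (simp_all add: diff_op_add_left)

lemma diff_op_sum_right:
  "diff_op D (\<Sum>x\<in>A. p x :: 'm::{finite,linorder} mvpoly) = (\<Sum>x\<in>A. diff_op D (p x))"
  by (induction A rule: infinite_finite_induct) (simp_all add: diff_op_add_right)

lemma diff_op_uminus_left:
  "diff_op (- D) (p :: 'm::{finite,linorder} mvpoly) = - diff_op D p"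
  using diff_op_add_left[of "- D" D p] by (simp add: eq_neg_iff_add_eq_0)

lemma diff_op_single:
  fixes p :: "'m::{finite,linorder} mvpoly"
  shows "diff_op (single \<alpha> r) p = single 0 r * partial_power \<alpha> p"
  by (simp add: diff_op_def)

lemma diff_op_const_right:
  fixes p :: "'m::{finite,linorder} mvpoly"
  shows "diff_op D (single 0 r * p) = single 0 r * diff_op D p"
  by (rule poly_mapping_eqI)
     (simp add: lookup_diff_op[OF _ order_refl] lookup_const_mult sum_distrib_left mult.left_commute)

lemma mvpoly_additive_induct:
  fixes p :: "'m mvpoly"
  assumes "\<And>\<alpha> r. P (single \<alpha> r)" "\<And>p q. P p \<Longrightarrow> P q \<Longrightarrow> P (p + q)"
  shows "P p"
proof -
  have z: "P 0" using assms(1)[of 0 0] by simp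
  have "P (\<Sum>i\<in>A. single i (lookup p i))" if "finite A" for A
    using that by induction (auto intro: assms z)
  from this[of "keys p"] show ?thesis
    by (simp add: poly_mapping_eq_sum_single)
qed

text \<open>Additivity reduces this to monomials, where the quotients of \<open>mfact\<close>
  telescope. It makes the annihilator an ideal and lets powers act by repeated
  differentiation.\<close>

lemma diff_op_mult:
  fixes p :: "'m::{finite,linorder} mvpoly"
  shows "diff_op (D * E) p = diff_op D (diff_op E p)"
proof (induction D rule: mvpoly_additive_induct)
  case (1 \<alpha> r)
  show ?case
  proof (induction E rule: mvpoly_additive_induct)
    case (1 \<beta> s)
    have nz: "mfact \<gamma> \<noteq> 0" for \<gamma> :: "'m \<Rightarrow>\<^sub>0 nat"
      using mfact_pos[of \<gamma>] by simp
    show ?case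
      by (rule poly_mapping_eqI)
        (simp add: mult_single diff_op_single lookup_const_mult lookup_partial_power nz add_ac)
  qed (simp add: distrib_left diff_op_add_left diff_op_add_right)
qed (simp add: distrib_right diff_op_add_left)

lemma partial_add: "partial i (p + q) = partial i p + partial i q"
  by (rule poly_mapping_eqI) (simp add: lookup_partial lookup_add distrib_left)

lemma partial_single:
  "partial i (single \<alpha> r) =
     single (\<alpha> - single i 1) (r * real (lookup \<alpha> i))"
  by (simp add: partial_def)

lemma partial_mult: "partial i (p * q) = partial i p * q + p * partial i q"
proof (induction p rule: mvpoly_additive_induct)
  case (1 \<alpha> r)
  show ?case
  proof (induction q rule: mvpoly_additive_induct)
    case (1 \<beta> s)
    let ?e = "single i (1::nat)"
    \<comment> \<open>Truncated subtraction moves through a sum only if the exponent contains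
      \<open>i\<close>; otherwise the coefficient produced by differentiation is 0.\<close>
    have sub: "\<gamma> - ?e + \<delta> = \<gamma> + \<delta> - ?e" if "lookup \<gamma> i \<noteq> 0" for \<gamma> \<delta>
      using that by (intro poly_mapping_eqI) (auto simp: lookup_add lookup_minus lookup_single when_def)
    have l: "single (\<alpha> - ?e + \<beta>) (r * real (lookup \<alpha> i) * s) =
        single (\<alpha> + \<beta> - ?e) (r * real (lookup \<alpha> i) * s)"
      using sub[of \<alpha> \<beta>] by (cases "lookup \<alpha> i = 0") auto
    have r: "single (\<alpha> + (\<beta> - ?e)) (r * (s * real (lookup \<beta> i))) =
        single (\<alpha> + \<beta> - ?e) (r * (s * real (lookup \<beta> i)))"
      using sub[of \<beta> \<alpha>] by (cases "lookup \<beta> i = 0") (auto simp: add.commute)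
    show ?case
      unfolding mult_single partial_single l r single_add[symmetric]
      by (simp add: lookup_add algebra_simps)
  qed (simp add: distrib_left partial_add)
qed (simp add: distrib_right partial_add)

lemma partial_power_single:
  "partial_power (single i 1) p = partial i p"
  by (simp add: partial_power_def)

lemma diff_op_linear_form:
  "diff_op (linear_form c) p = (\<Sum>i\<in>UNIV. single 0 (vec_nth c i) * partial i p)"
  by (simp add: linear_form_def diff_op_sum_left diff_op_single partial_power_single del: One_nat_def)

lemma diff_op_linear_form_mult:
  "diff_op (linear_form c) (p * q) = diff_op (linear_form c) p * q + p * diff_op (linear_form c) q"
  by (simp add: diff_op_linear_form partial_mult sum.distrib sum_distrib_left sum_distrib_right algebra_simps)

lemma diff_op_one: "diff_op 1 p = (p :: 'm::{finite,linorder} mvpoly)"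
  by (simp add: diff_op_single partial_power_def flip: single_one)

lemma partial_linear_form:
  "partial i (linear_form a) = single 0 (vec_nth a i)"
proof -
  have 0: "partial i 0 = 0" by (simp add: partial_def)
  have s: "partial i (\<Sum>x\<in>A. f x) = (\<Sum>x\<in>A. partial i (f x))" for f :: "'b \<Rightarrow> 'a mvpoly" and A
    by (induction A rule: infinite_finite_induct) (simp_all add: partial_add 0)
  have "partial i (linear_form a) = (\<Sum>j\<in>UNIV. if j = i then single 0 (vec_nth a i) else 0)"
    unfolding linear_form_def s
    by (rule sum.cong) (auto simp: partial_single lookup_single when_def)
  then show ?thesis by simp
qed

lemma diff_op_linear_form_linear_form:
  "diff_op (linear_form c) (linear_form a) = single 0 (a \<bullet> c)"
  for c :: "real ^ 'm::{finite,linorder}"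
proof -
  have s: "(\<Sum>i\<in>A. single 0 (f i)) = single 0 (\<Sum>i\<in>A. f i)"
    for f :: "'m \<Rightarrow> real" and A
    by (induction A rule: infinite_finite_induct) (simp_all add: single_add)
  show ?thesis
    by (simp add: diff_op_linear_form partial_linear_form mult_single s inner_vec_def mult.commute)
qed

lemma diff_op_linear_form_power:
  "diff_op (linear_form c) (linear_form a ^ Suc n) =
     single 0 (real (Suc n) * (a \<bullet> c)) * linear_form a ^ n"
proof (induction n)
  case 0
  then show ?case by (simp add: diff_op_linear_form_linear_form)
next
  case (Suc n)
  have "diff_op (linear_form c) (linear_form a ^ Suc (Suc n)) =
      single 0 (a \<bullet> c) * linear_form a ^ Suc n +
      linear_form a * (single 0 (real (Suc n) * (a \<bullet> c)) * linear_form a ^ n)"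
    by (subst power_Suc) (simp only: diff_op_linear_form_mult diff_op_linear_form_linear_form Suc.IH)
  also have "\<dots> = (single 0 (a \<bullet> c) + single 0 (real (Suc n) * (a \<bullet> c)))
      * linear_form a ^ Suc n"
    by (simp add: algebra_simps)
  also have "single 0 (a \<bullet> c) + single 0 (real (Suc n) * (a \<bullet> c)) =
      single 0 (real (Suc (Suc n)) * (a \<bullet> c))"
    by (simp add: algebra_simps flip: single_add)
  finally show ?case .
qed

lemma diff_op_power_linear_form_power:
  "diff_op (linear_form c ^ k) (linear_form a ^ (k + n)) =
     single 0 (fact (k + n) / fact n * (a \<bullet> c) ^ k) * linear_form a ^ n"
proof (induction k arbitrary: n)
  case 0
  then show ?case by (simp add: diff_op_one)
next
  case (Suc k)
  \<comment> \<open>The inner \<open>k\<close> derivatives are taken with \<open>Suc n\<close> in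
    the role of \<open>n\<close>, hence the induction over arbitrary \<open>n\<close>; the outer
    derivative then lowers \<open>Suc n\<close> to \<open>n\<close>.\<close>
  have "diff_op (linear_form c ^ Suc k) (linear_form a ^ (Suc k + n)) =
      diff_op (linear_form c) (diff_op (linear_form c ^ k) (linear_form a ^ (k + Suc n)))"
    by (simp add: diff_op_mult)
  also have "\<dots> = single 0 (fact (k + Suc n) / fact (Suc n) * (a \<bullet> c) ^ k) *
      (single 0 (real (Suc n) * (a \<bullet> c)) * linear_form a ^ n)"
    by (simp only: Suc.IH diff_op_const_right diff_op_linear_form_power)
  also have "\<dots> = single 0 (fact (k + Suc n) / fact (Suc n) * (a \<bullet> c) ^ k * (real (Suc n) * (a \<bullet> c)))
     * linear_form a ^ n"
    by (simp only: mult.assoc[symmetric] mult_single) simp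
  also have "fact (k + Suc n) / fact (Suc n) * (a \<bullet> c) ^ k * (real (Suc n) * (a \<bullet> c)) =
      fact (Suc k + n) / fact n * (a \<bullet> c) ^ Suc k"
    by (simp add: fact_Suc[of n] del: of_nat_Suc)
  finally show ?case .
qed

section \<open>Evaluation of polynomials\<close>

definition mv_monom :: "('m \<Rightarrow> real) \<Rightarrow> ('m::finite \<Rightarrow>\<^sub>0 nat) \<Rightarrow> real" where
  "mv_monom x \<alpha> = (\<Prod>i\<in>UNIV. x i ^ lookup \<alpha> i)"

lemma mv_monom_add: "mv_monom x (\<alpha> + \<beta>) = mv_monom x \<alpha> * mv_monom x \<beta>"
  by (simp add: mv_monom_def lookup_add power_add prod.distrib)

lemma mv_monom_0 [simp]: "mv_monom x 0 = 1"
  by (simp add: mv_monom_def)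

lemma mv_eval_eq:
  fixes p :: "'m::finite mvpoly"
  assumes "finite A" "keys p \<subseteq> A"
  shows "mv_eval x p = (\<Sum>\<alpha>\<in>A. lookup p \<alpha> * mv_monom x \<alpha>)"
proof -
  have "(\<Prod>i\<in>keys \<alpha>. x i ^ lookup \<alpha> i) = mv_monom x \<alpha>" for \<alpha>
    unfolding mv_monom_def by (rule prod.mono_neutral_left) (auto simp: in_keys_iff)
  then show ?thesis
    unfolding mv_eval_def using assms by (auto simp: in_keys_iff intro!: sum.mono_neutral_left)
qed

lemma mv_eval_add:
  fixes p :: "'m::finite mvpoly"
  shows "mv_eval x (p + q) = mv_eval x p + mv_eval x q"
proof -
  let ?A = "keys p \<union> keys q"
  have "keys (p + q) \<subseteq> ?A" by (rule keys_add)
  then show ?thesis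
    by (simp add: mv_eval_eq[where A = ?A] lookup_add sum.distrib distrib_right)
qed

lemma mv_eval_single: "mv_eval x (single \<alpha> r) = r * mv_monom x \<alpha>"
  for \<alpha> :: "'m::finite \<Rightarrow>\<^sub>0 nat"
  by (subst mv_eval_eq[of "{\<alpha>}"]) auto

lemma mv_eval_0 [simp]: "mv_eval x 0 = 0"
  by (simp add: mv_eval_def)

lemma mv_eval_1 [simp]: "mv_eval x (1 :: 'm::finite mvpoly) = 1"
  by (simp add: mv_eval_single flip: single_one)

lemma mv_eval_sum:
  "mv_eval x (\<Sum>a\<in>A. p a :: 'm::finite mvpoly) = (\<Sum>a\<in>A. mv_eval x (p a))"
  by (induction A rule: infinite_finite_induct) (simp_all add: mv_eval_add)

lemma mv_eval_mult:
  fixes p :: "'m::finite mvpoly"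
  shows "mv_eval x (p * q) = mv_eval x p * mv_eval x q"
proof (induction p rule: mvpoly_additive_induct)
  case (1 \<alpha> r)
  show ?case
    by (induction q rule: mvpoly_additive_induct)
      (simp_all add: mult_single mv_eval_single mv_monom_add distrib_left mv_eval_add)
qed (simp add: distrib_right mv_eval_add)

lemma mv_eval_power:
  fixes p :: "'m::finite mvpoly"
  shows "mv_eval x (p ^ k) = mv_eval x p ^ k"
  by (induction k) (simp_all add: mv_eval_mult)

lemma mv_eval_linear_form: "mv_eval x (linear_form a) = (\<Sum>i\<in>UNIV. vec_nth a i * x i)"
proof -
  have "mv_monom x (single i 1) = x i" for i
  proof -
    have "mv_monom x (single i 1) = (\<Prod>j\<in>UNIV. if j = i then x i else 1)"
      unfolding mv_monom_def by (rule prod.cong) (auto simp: lookup_single when_def)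
    then show ?thesis by simp
  qed
  then show ?thesis
    by (simp add: linear_form_def mv_eval_sum mv_eval_single)
qed

lemma linear_form_eq_iff: "linear_form a = linear_form b \<longleftrightarrow> a = b"
proof
  assume "linear_form a = linear_form b"
  then have "mv_eval (\<lambda>j. if j = i then 1 else 0) (linear_form a) =
      mv_eval (\<lambda>j. if j = i then 1 else 0) (linear_form b)" for i
    by simp
  then show "a = b"
    by (simp add: mv_eval_linear_form vec_eq_iff if_distrib[of "(*) _"] cong: if_cong)
qed simp

lemma linear_form_add: "linear_form (a + b) = linear_form a + linear_form b"
  by (simp add: linear_form_def single_add sum.distrib)

lemma linear_form_zero [simp]: "linear_form 0 = 0"
  by (simp add: linear_form_def)

lemma linear_form_scaleR: "linear_form (r *\<^sub>R a) = single 0 r * linear_form a"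
  by (simp add: linear_form_def sum_distrib_left mult_single)

lemma linear_form_sum: "linear_form (\<Sum>x\<in>A. a x) = (\<Sum>x\<in>A. linear_form (a x))"
  by (induction A rule: infinite_finite_induct) (simp_all add: linear_form_add)

text \<open>Along the line \<open>v + e *\<^sub>R s\<close> the pairing with each vector of the
  finite set vanishes for at most one \<open>e\<close>, so finitely many hyperplanes cannot cover
  \<open>S\<close>. All generic vectors of the proof come from here.\<close>

lemma exists_nonorthogonal:
  fixes Q :: "'a::euclidean_space set"
  assumes "finite Q" "subspace S" "\<And>q. q \<in> Q \<Longrightarrow> \<exists>s\<in>S. q \<bullet> s \<noteq> 0"
  shows "\<exists>v\<in>S. \<forall>q\<in>Q. q \<bullet> v \<noteq> 0"
  using assms(1,3)
proof (induction Q)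
  case empty
  then show ?case using subspace_0[OF assms(2)] by auto
next
  case (insert q Q)
  from insert.IH insert.prems obtain v where v: "v \<in> S" "\<forall>q\<in>Q. q \<bullet> v \<noteq> 0" by auto
  obtain s where s: "s \<in> S" "q \<bullet> s \<noteq> 0" using insert.prems by auto
  let ?bad = "insert (- (q \<bullet> v) / (q \<bullet> s)) ((\<lambda>r. - (r \<bullet> v) / (r \<bullet> s)) ` Q)"
  have "finite ?bad" using insert.hyps by simp
  then obtain e :: real where e: "e \<notin> ?bad"
    using ex_new_if_finite[OF infinite_UNIV_char_0] by blast
  have "r \<bullet> (v + e *\<^sub>R s) \<noteq> 0" if "r \<in> insert q Q" for r
  proof (cases "r \<bullet> s = 0")
    case True
    then show ?thesis using that v s by (auto simp: inner_add_right)
  next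
    case False
    then have "e \<noteq> - (r \<bullet> v) / (r \<bullet> s)" using e that by auto
    show ?thesis
    proof
      assume "r \<bullet> (v + e *\<^sub>R s) = 0"
      then have "e * (r \<bullet> s) = - (r \<bullet> v)" by (simp add: inner_add_right)
      then have "e = - (r \<bullet> v) / (r \<bullet> s)" using False by (metis nonzero_mult_div_cancel_right)
      with \<open>e \<noteq> - (r \<bullet> v) / (r \<bullet> s)\<close> show False by contradiction
    qed
  qed
  moreover have "v + e *\<^sub>R s \<in> S"
    using v s assms(2) by (simp add: subspace_add subspace_mul)
  ultimately show ?case by blast
qed

text \<open>Substituting \<open>x\<^sub>i = exp (s \<theta>\<^sub>i)\<close> with a generic \<open>\<theta>\<close> turns distinct monomials into
  exponentials with distinct rates; the fastest growing one isolates its coefficient.\<close>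

lemma mv_eval_eq_0_imp:
  fixes p :: "'m::finite mvpoly"
  assumes "\<And>c :: real ^ 'm. mv_eval (vec_nth c) p = 0"
  shows "p = 0"
proof (rule ccontr)
  assume "p \<noteq> 0"
  let ?K = "keys p"
  define e where "e \<alpha> = (\<chi> i. real (lookup \<alpha> i))" for \<alpha> :: "'m \<Rightarrow>\<^sub>0 nat"
  have inj_e: "\<alpha> = \<beta>" if "e \<alpha> = e \<beta>" for \<alpha> \<beta>
    using that by (intro poly_mapping_eqI) (simp add: e_def vec_eq_iff fun_eq_iff)
  let ?Q = "(\<lambda>(\<alpha>, \<beta>). e \<alpha> - e \<beta>) ` {(\<alpha>, \<beta>). \<alpha> \<in> ?K \<and> \<beta> \<in> ?K \<and> \<alpha> \<noteq> \<beta>}"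
  have "finite ?Q"
    by (rule finite_imageI) (rule finite_subset[of _ "?K \<times> ?K"], auto)
  moreover have "\<exists>s\<in>UNIV. q \<bullet> s \<noteq> 0" if "q \<in> ?Q" for q
  proof -
    have "q \<noteq> 0" using that inj_e by auto
    then show ?thesis by (auto intro!: exI[of _ q])
  qed
  ultimately obtain \<theta> where \<theta>: "\<forall>q\<in>?Q. q \<bullet> \<theta> \<noteq> 0"
    using exists_nonorthogonal[of ?Q UNIV] by auto
  define r where "r \<alpha> = e \<alpha> \<bullet> \<theta>" for \<alpha>
  have r_inj: "r \<alpha> \<noteq> r \<beta>" if "\<alpha> \<in> ?K" "\<beta> \<in> ?K" "\<alpha> \<noteq> \<beta>" for \<alpha> \<beta>
    using \<theta> that by (force simp: r_def inner_diff_left)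
  have "finite ?K" "?K \<noteq> {}" using \<open>p \<noteq> 0\<close> by auto
  then have "Max (r ` ?K) \<in> r ` ?K" by (intro Max_in) auto
  then obtain \<alpha> where \<alpha>: "\<alpha> \<in> ?K" "r \<alpha> = Max (r ` ?K)" by auto
  have less: "r \<beta> < r \<alpha>" if "\<beta> \<in> ?K" "\<beta> \<noteq> \<alpha>" for \<beta>
  proof -
    have "r \<beta> \<le> r \<alpha>" using that(1) unfolding \<alpha>(2) by (intro Max_ge) auto
    then show ?thesis using r_inj[OF that(1) \<alpha>(1) that(2)] by simp
  qed
  define f where "f s = (\<Sum>\<beta>\<in>?K. lookup p \<beta> * exp (s * (r \<beta> - r \<alpha>)))" for s :: real
  have f0: "f s = 0" for s
  proof -
    have "mv_monom (\<lambda>i. exp (s * vec_nth \<theta> i)) \<beta> = exp (s * r \<beta>)" for \<beta>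
      by (simp add: mv_monom_def r_def e_def inner_vec_def sum_distrib_left exp_sum mult.left_commute
          flip: exp_of_nat_mult)
    then have "mv_eval (vec_nth (\<chi> i. exp (s * vec_nth \<theta> i))) p = (\<Sum>\<beta>\<in>?K. lookup p \<beta> * exp (s * r \<beta>))"
      by (simp add: mv_eval_eq[OF finite_keys order_refl] vec_lambda_inverse)
    then have "(\<Sum>\<beta>\<in>?K. lookup p \<beta> * exp (s * r \<beta>)) = 0"
      using assms by simp
    moreover have "f s = (\<Sum>\<beta>\<in>?K. lookup p \<beta> * exp (s * r \<beta>)) * exp (- s * r \<alpha>)"
      by (simp add: f_def sum_distrib_right right_diff_distrib exp_diff exp_minus divide_inverse mult.assoc)
    ultimately show ?thesis by simp
  qed
  have "(f \<longlongrightarrow> (\<Sum>\<beta>\<in>?K. if \<beta> = \<alpha> then lookup p \<alpha> else 0)) at_top"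
    unfolding f_def
  proof (rule tendsto_sum)
    fix \<beta> assume \<beta>: "\<beta> \<in> ?K"
    show "((\<lambda>s. lookup p \<beta> * exp (s * (r \<beta> - r \<alpha>))) \<longlongrightarrow>
        (if \<beta> = \<alpha> then lookup p \<alpha> else 0)) at_top"
    proof (cases "\<beta> = \<alpha>")
      case False
      have "filterlim (\<lambda>s. s * (r \<beta> - r \<alpha>)) at_bot at_top"
        using less[OF \<beta> False] by real_asymp
      then have "((\<lambda>s. lookup p \<beta> * exp (s * (r \<beta> - r \<alpha>))) \<longlongrightarrow> lookup p \<beta> * 0) at_top"
        by (intro tendsto_mult_left filterlim_compose[OF exp_at_bot])
      then show ?thesis using False by simp
    qed simp
  qed
  then have "(f \<longlongrightarrow> lookup p \<alpha>) at_top"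
    using \<alpha>(1) by simp
  moreover have "(f \<longlongrightarrow> 0) at_top"
    using f0 by (intro tendsto_eventually) simp
  ultimately have "lookup p \<alpha> = 0"
    by (intro tendsto_unique[OF trivial_limit_at_top_linorder])
  with \<alpha>(1) show False by (simp add: in_keys_iff)
qed

lemma mv_eval_inject:
  fixes p :: "'m::finite mvpoly"
  assumes "\<And>c :: real ^ 'm. mv_eval (vec_nth c) p = mv_eval (vec_nth c) q"
  shows "p = q"
proof -
  have neg: "mv_eval x (- q) = - mv_eval x q" for x
    using mv_eval_add[of x q "- q"] by simp
  have "p + - q = 0"
  proof (rule mv_eval_eq_0_imp)
    show "mv_eval (vec_nth c) (p + - q) = 0" for c :: "real ^ 'm"
      unfolding mv_eval_add neg assms by simp
  qed
  then show ?thesis by simp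
qed

section \<open>The quotient algebra and its action\<close>

lemma ideal_mf_ann:
  fixes lam :: "'m::{finite,linorder} \<Rightarrow> 'a::euclidean_space"
  shows "ideal (mf_ann w lam) ring_of_type_algebra"
proof (rule idealI)
  show "ring (ring_of_type_algebra :: 'm mvpoly ring)"
    by (rule ring_from_type_algebra)
next
  show "subgroup (mf_ann w lam) (add_monoid (ring_of_type_algebra :: 'm mvpoly ring))"
  proof -
    interpret ring "ring_of_type_algebra :: 'm mvpoly ring" by (rule ring_from_type_algebra)
    show ?thesis
    proof (rule add.subgroupI)
      have "0 \<in> mf_ann w lam" by (simp add: mf_ann_def)
      then show "mf_ann w lam \<noteq> {}" by auto
    next
      fix D assume "D \<in> mf_ann w lam"
      moreover have "\<ominus>\<^bsub>ring_of_type_algebra\<^esub> D = - D"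
        by (rule minus_equality) (auto simp: ring_of_type_algebra_def)
      ultimately show "\<ominus>\<^bsub>ring_of_type_algebra\<^esub> D \<in> mf_ann w lam"
        by (simp add: mf_ann_def diff_op_uminus_left)
    qed (auto simp: ring_of_type_algebra_def mf_ann_def diff_op_add_left)
  qed
next
  fix D E :: "'m mvpoly"
  assume "D \<in> mf_ann w lam"
  then show "E \<otimes>\<^bsub>ring_of_type_algebra\<^esub> D \<in> mf_ann w lam"
    by (simp add: mf_ann_def ring_of_type_algebra_def diff_op_mult)
  then show "D \<otimes>\<^bsub>ring_of_type_algebra\<^esub> E \<in> mf_ann w lam"
    by (simp add: ring_of_type_algebra_def mult.commute)
qed

lemma mf_class_power:
  "mf_class w lam D [^]\<^bsub>mf_algebra w lam\<^esub> k = mf_class w lam (D ^ k)"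
proof -
  note I = ideal_mf_ann[of w lam]
  have Q: "ring (mf_algebra w lam)"
    unfolding mf_algebra_def by (rule ideal.quotient_is_ring[OF I])
  show ?thesis
  proof (induction k)
    case 0
    show ?case
      by (simp add: monoid.nat_pow_0[OF ring.is_monoid[OF Q]] mf_class_def mf_algebra_def FactRing_def)
        (simp add: ring_of_type_algebra_def)
  next
    case (Suc k)
    have "mf_class w lam (D ^ k) \<otimes>\<^bsub>mf_algebra w lam\<^esub> mf_class w lam D = mf_class w lam (D ^ k * D)"
      using ideal.rcoset_mult_add[OF I, of "D ^ k" D]
      by (simp add: mf_class_def mf_algebra_def FactRing_def ring_of_type_algebra_def)
    then show ?case
      by (simp add: monoid.nat_pow_Suc[OF ring.is_monoid[OF Q]] Suc.IH mult.commute)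
  qed
qed

lemma mf_act_mf_class:
  "mf_act w lam (mf_class w lam D) = diff_op D (volume_poly w lam)"
proof -
  have mem: "D' \<in> mf_class w lam D \<longleftrightarrow> (\<exists>h\<in>mf_ann w lam. D' = h + D)" for D'
    by (simp add: mf_class_def a_r_coset_def' ring_of_type_algebra_def)
  have "0 \<in> mf_ann w lam"
    by (simp add: mf_ann_def)
  then have D: "D \<in> mf_class w lam D"
    unfolding mem by (intro bexI[of _ 0]) simp_all
  have eq: "diff_op D' (volume_poly w lam) = diff_op D (volume_poly w lam)" if "D' \<in> mf_class w lam D" for D'
    using that unfolding mem by (auto simp: mf_ann_def diff_op_add_left)
  show ?thesis
    unfolding mf_act_def
  proof (rule the_equality)
    fix q assume "\<forall>D\<in>mf_class w lam D. diff_op D (volume_poly w lam) = q"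
    with D show "q = diff_op D (volume_poly w lam)" by metis
  qed (use eq in blast)
qed

text \<open>This leaves the quotient ring: powers of classes are classes of powers, a class acts
  through any representative, and a linear form determines its coefficients.\<close>

lemma eta_partial_P_power:
  assumes "diff_op (linear_form c ^ k) (volume_poly w lam) = linear_form U"
  shows "eta w lam (partial_P w lam c [^]\<^bsub>mf_algebra w lam\<^esub> k) = U"
  unfolding eta_def partial_P_def mf_class_power mf_act_mf_class assms
  by (simp add: linear_form_eq_iff)

section \<open>Dual bases\<close>

text \<open>Also used with \<open>id\<close> in place of \<open>lam\<close>, for a set of vectors as
  a basis indexed by itself.\<close>

definition basis_on :: "('m \<Rightarrow> 'a::euclidean_space) \<Rightarrow> 'm set \<Rightarrow> bool" where
  "basis_on lam I \<longleftrightarrow> finite I \<and> inj_on lam I \<and> independent (lam ` I) \<and> span (lam ` I) = UNIV"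

lemma basis_on_card: "card I = DIM('a)" if "basis_on lam I" for lam :: "'m \<Rightarrow> 'a::euclidean_space"
proof -
  have "dim (lam ` I) = card (lam ` I)" "dim (lam ` I) = dim (UNIV :: 'a set)"
    using that dim_span[of "lam ` I"] by (simp_all add: basis_on_def dim_eq_card_independent)
  then show ?thesis
    using that by (simp add: basis_on_def card_image dim_UNIV)
qed

lemma eq_if_inner_basis_on:
  assumes "basis_on lam I" "\<And>j. j \<in> I \<Longrightarrow> u \<bullet> lam j = v \<bullet> lam j"
  shows "u = v"
proof -
  have "(u - v) \<bullet> x = 0" if "x \<in> span (lam ` I)" for x
    using that
    by (induction rule: span_induct_alt) (use assms(2) in \<open>auto simp: inner_diff_left inner_add_right\<close>)
  then have "(u - v) \<bullet> (u - v) = 0" using assms(1) by (simp add: basis_on_def)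
  then show ?thesis by simp
qed

abbreviation dvec :: "('m \<Rightarrow> 'a::euclidean_space) \<Rightarrow> 'm set \<Rightarrow> 'm \<Rightarrow> 'a" where
  "dvec lam I \<equiv> dual_vec UNIV lam I"

text \<open>The vector represents, through the inner product, the linear functional that is 1 at
  \<open>lam i\<close> and 0 at the other basis vectors; its coordinates are the values of the
  functional on \<open>Basis\<close>.\<close>

lemma exists_dual_vec:
  fixes lam :: "'m \<Rightarrow> 'a::euclidean_space"
  assumes "basis_on lam I" "i \<in> I"
  shows "\<exists>u. \<forall>j\<in>I. u \<bullet> lam j = (if j = i then 1 else 0)"
proof -
  have "independent (lam ` I)" using assms by (simp add: basis_on_def)
  then obtain f :: "'a \<Rightarrow> real" where f: "linear f" "\<forall>x\<in>lam ` I. f x = (if x = lam i then 1 else 0)"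
    using linear_independent_extend[of "lam ` I" "\<lambda>x. if x = lam i then 1 else 0"] by auto
  have "(\<Sum>b\<in>Basis. f b *\<^sub>R b) \<bullet> x = f x" for x
  proof -
    have "(\<Sum>b\<in>Basis. f b *\<^sub>R b) \<bullet> x = (\<Sum>b\<in>Basis. (x \<bullet> b) * f b)"
      by (simp add: inner_sum_left mult.commute inner_commute[of x])
    also have "\<dots> = f (\<Sum>b\<in>Basis. (x \<bullet> b) *\<^sub>R b)"
      using f(1) by (simp add: linear_sum linear_cmul)
    finally show ?thesis by (simp add: euclidean_representation)
  qed
  moreover have "f (lam j) = (if j = i then 1 else 0)" if "j \<in> I" for j
    using f(2) that assms by (auto simp: basis_on_def inj_on_def)
  ultimately show ?thesis by metis
qed

lemma inner_dual_vec:
  assumes "basis_on lam I" "i \<in> I" "j \<in> I"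
  shows "dvec lam I i \<bullet> lam j = (if j = i then 1 else 0)"
proof -
  have "\<exists>!u. u \<in> UNIV \<and> (\<forall>j\<in>I. u \<bullet> lam j = (if j = i then 1 else 0))"
  proof (rule ex_ex1I)
    show "\<exists>u. u \<in> UNIV \<and> (\<forall>j\<in>I. u \<bullet> lam j = (if j = i then 1 else 0))"
      using exists_dual_vec[OF assms(1,2)] by simp
  qed (rule eq_if_inner_basis_on[OF assms(1)], simp)
  from theI'[OF this] show ?thesis
    using assms(3) by (auto simp: dual_vec_def)
qed

lemma sum_inner_dual_vec:
  fixes x :: "'a::euclidean_space"
  assumes "basis_on lam I"
  shows "(\<Sum>i\<in>I. (dvec lam I i \<bullet> x) *\<^sub>R lam i) = x"
proof -
  have "finite (lam ` I)" "x \<in> span (lam ` I)" using assms by (auto simp: basis_on_def)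
  then obtain r where "x = (\<Sum>v\<in>lam ` I. r v *\<^sub>R v)"
    by (auto simp: span_finite)
  then have x: "x = (\<Sum>i\<in>I. r (lam i) *\<^sub>R lam i)"
    using assms by (simp add: sum.reindex basis_on_def)
  have "dvec lam I i \<bullet> x = r (lam i)" if "i \<in> I" for i
  proof -
    have "dvec lam I i \<bullet> x = (\<Sum>j\<in>I. if j = i then r (lam i) else 0)"
      unfolding x inner_sum_right
      by (rule sum.cong) (simp_all add: inner_dual_vec[OF assms that])
    then show ?thesis using that assms by (simp add: basis_on_def)
  qed
  then show ?thesis by (subst x) (rule sum.cong, simp_all)
qed

lemma sum_inner_scaleR_dual_vec:
  assumes "basis_on lam I"
  shows "(\<Sum>i\<in>I. (lam i \<bullet> x) *\<^sub>R dvec lam I i) = x"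
proof (rule eq_if_inner_basis_on[OF assms])
  fix j assume "j \<in> I"
  have "(\<Sum>i\<in>I. (lam i \<bullet> x) *\<^sub>R dvec lam I i) \<bullet> lam j = (\<Sum>i\<in>I. if i = j then lam j \<bullet> x else 0)"
    unfolding inner_sum_left by (rule sum.cong) (use \<open>j \<in> I\<close> in \<open>auto simp: inner_dual_vec[OF assms]\<close>)
  then show "(\<Sum>i\<in>I. (lam i \<bullet> x) *\<^sub>R dvec lam I i) \<bullet> lam j = x \<bullet> lam j"
    using \<open>j \<in> I\<close> assms by (simp add: basis_on_def inner_commute)
qed

lemma dual_vec_nonzero:
  assumes "basis_on lam I" "i \<in> I"
  shows "dvec lam I i \<noteq> 0"
  using inner_dual_vec[OF assms assms(2)] by auto

section \<open>Orientations and the cycle condition\<close>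

definition coord_mat :: "'a::euclidean_space list \<Rightarrow> 'a list \<Rightarrow> real mat" where
  "coord_mat bs vs = Matrix.mat (length bs) (length bs) (\<lambda>(i, j). representation (set bs) (vs ! i) (bs ! j))"

lemma orientation_sign_eq: "orientation_sign bs vs = sgn (Determinant.det (coord_mat bs vs))"
  by (simp add: orientation_sign_def coord_mat_def)

lemma representation_sum_scaleR:
  fixes v :: "'i \<Rightarrow> 'a::euclidean_space"
  assumes "independent B" "span B = UNIV"
  shows "representation B (\<Sum>l\<in>A. e l *\<^sub>R v l) b = (\<Sum>l\<in>A. e l * representation B (v l) b)"
  using assms by (simp add: representation_sum representation_scale)

lemma coord_mat_combination:
  fixes bs :: "'a::euclidean_space list"
  assumes bs: "ordered_basis bs"
    and us: "\<And>i. i < length bs \<Longrightarrow> us ! i = (\<Sum>l<length bs. C $$ (i, l) *\<^sub>R vs ! l)"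
    and C: "C \<in> carrier_mat (length bs) (length bs)"
  shows "coord_mat bs us = C * coord_mat bs vs"
proof (rule eq_matI)
  have B: "independent (set bs)" "span (set bs) = UNIV" using bs by (auto simp: ordered_basis_def)
  fix i j assume "i < dim_row (C * coord_mat bs vs)" "j < dim_col (C * coord_mat bs vs)"
  then have ij: "i < length bs" "j < length bs" using C by (auto simp: coord_mat_def)
  show "coord_mat bs us $$ (i, j) = (C * coord_mat bs vs) $$ (i, j)"
    using ij C by (simp add: coord_mat_def us representation_sum_scaleR[OF B] scalar_prod_def
      atLeast0LessThan)
qed (use C in \<open>auto simp: coord_mat_def\<close>)

text \<open>This is the change of basis when a vector with coordinates \<open>e\<close> is put in
  front of a list whose entry at position \<open>p\<close> has been removed. Column \<open>p\<close>
  meets only the first row, and deleting both leaves the identity matrix.\<close>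

lemma det_row_then_unit_rows:
  fixes e :: "nat \<Rightarrow> real"
  assumes "p < n"
  shows "Determinant.det (Matrix.mat n n (\<lambda>(i, j). if i = 0 then e j
           else if j = (if i \<le> p then i - 1 else i) then 1 else 0)) = (-1) ^ p * e p"
    (is "Determinant.det ?C = _")
proof -
  have C: "?C \<in> carrier_mat n n" by simp
  have "mat_delete ?C 0 p = 1\<^sub>m (n - 1)"
    using assms by (intro eq_matI) (auto simp: mat_delete_def)
  then have cof: "cofactor ?C 0 p = (-1) ^ p"
    by (simp add: cofactor_def)
  have "Determinant.det ?C = (\<Sum>i<n. ?C $$ (i, p) * cofactor ?C i p)"
    by (rule laplace_expansion_column[OF C assms])
  also have "\<dots> = (\<Sum>i<n. if i = 0 then e p * (-1) ^ p else 0)"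
    using assms by (intro sum.cong refl) (auto simp: cof)
  also have "\<dots> = (-1) ^ p * e p" using assms by simp
  finally show ?thesis .
qed

text \<open>The coordinate matrix of the new list is the matrix of
  \<open>det_row_then_unit_rows\<close> times the old one. The power of -1 is the cost of moving the
  new vector from its slot to the front.\<close>

lemma orientation_sign_replace:
  fixes bs :: "'a::euclidean_space list"
  assumes bs: "ordered_basis bs"
    and len: "length us + Suc (length ws) = length bs"
    and x: "x = (\<Sum>l<length bs. e l *\<^sub>R (us @ y # ws) ! l)"
  shows "orientation_sign bs (x # us @ ws) =
    (-1) ^ length us * sgn (e (length us)) * orientation_sign bs (us @ y # ws)"
proof -
  let ?n = "length bs" and ?p = "length us"
  let ?C = "Matrix.mat ?n ?n (\<lambda>(i, j). if i = 0 then e j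
           else if j = (if i \<le> ?p then i - 1 else i) then 1 else 0 :: real)"
  have "coord_mat bs (x # us @ ws) = ?C * coord_mat bs (us @ y # ws)"
  proof (rule coord_mat_combination[OF bs])
    fix i assume i: "i < ?n"
    show "(x # us @ ws) ! i = (\<Sum>l<?n. ?C $$ (i, l) *\<^sub>R (us @ y # ws) ! l)"
    proof (cases "i = 0")
      case True
      then show ?thesis using i by (auto simp: x intro!: sum.cong)
    next
      case False
      let ?q = "if i \<le> ?p then i - 1 else i"
      have "(\<Sum>l<?n. ?C $$ (i, l) *\<^sub>R (us @ y # ws) ! l) = (\<Sum>l<?n. if l = ?q then (us @ y # ws) ! ?q else 0)"
        using i False by (intro sum.cong) auto
      also have "\<dots> = (us @ y # ws) ! ?q"
        using i len by (subst sum.delta) auto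
      also have "\<dots> = (x # us @ ws) ! i"
        using False by (cases i) (auto simp: nth_append nth_Cons Suc_diff_le split: nat.splits)
      finally show ?thesis by simp
    qed
  qed simp
  then have "Determinant.det (coord_mat bs (x # us @ ws)) =
      (-1) ^ ?p * e ?p * Determinant.det (coord_mat bs (us @ y # ws))"
    using len by (simp add: det_mult[of _ ?n] coord_mat_def det_row_then_unit_rows)
  then show ?thesis
    by (simp add: orientation_sign_eq sgn_mult)
qed

text \<open>A basis expresses the vectors of \<open>bs\<close>, so its coordinate matrix is
  invertible. In the form of a square the statement cancels two copies of the sign in a
  product.\<close>

lemma orientation_sign_basis:
  fixes bs :: "'a::euclidean_space list"
  assumes bs: "ordered_basis bs" and len: "length vs = length bs" and sp: "span (set vs) = UNIV" and d: "distinct vs"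
  shows "orientation_sign bs vs * orientation_sign bs vs = 1"
proof -
  let ?n = "length bs"
  have ind: "independent (set bs)" using bs by (simp add: ordered_basis_def)
  have "\<exists>r. b = (\<Sum>l<?n. r l *\<^sub>R vs ! l)" for b
  proof -
    have "b \<in> span (set vs)" using sp by simp
    then obtain r where "b = (\<Sum>v\<in>set vs. r v *\<^sub>R v)" by (auto simp: span_finite)
    also have "\<dots> = (\<Sum>l<?n. r (vs ! l) *\<^sub>R vs ! l)"
      using bij_betw_nth[OF d refl refl] len by (intro sum.reindex_bij_betw[symmetric]) simp
    finally show ?thesis by (rule exI[of _ "\<lambda>l. r (vs ! l)"])
  qed
  then obtain r where r: "b = (\<Sum>l<?n. r b l *\<^sub>R vs ! l)" for b by metis
  define C where "C = Matrix.mat ?n ?n (\<lambda>(i, l). r (bs ! i) l)"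
  have C: "C \<in> carrier_mat ?n ?n" by (simp add: C_def)
  have "bs ! i = (\<Sum>l<?n. C $$ (i, l) *\<^sub>R vs ! l)" if "i < ?n" for i
    using that by (subst r) (simp add: C_def)
  then have "coord_mat bs bs = C * coord_mat bs vs"
    using coord_mat_combination[OF bs _ C] by blast
  moreover have "coord_mat bs bs = 1\<^sub>m ?n"
    using bs by (intro eq_matI)
      (auto simp: coord_mat_def ordered_basis_def representation_basis nth_eq_iff_index_eq)
  ultimately have "Determinant.det C * Determinant.det (coord_mat bs vs) = 1"
    using det_mult[OF C, of "coord_mat bs vs"] by (simp add: coord_mat_def)
  then have "Determinant.det (coord_mat bs vs) \<noteq> 0" by auto
  then show ?thesis by (simp add: orientation_sign_eq flip: sgn_mult)
qed

section \<open>Maximal simplices and the cycle identity\<close>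

abbreviation tops :: "('m set \<Rightarrow> real) \<Rightarrow> ('m \<Rightarrow> 'a::euclidean_space) \<Rightarrow> 'm set set" where
  "tops w lam \<equiv> mf_tops (UNIV :: 'a set) UNIV w"

abbreviation star :: "('m set \<Rightarrow> real) \<Rightarrow> ('m \<Rightarrow> 'a::euclidean_space) \<Rightarrow> 'm \<Rightarrow> 'm set set" where
  "star w lam i \<equiv> {I \<in> tops w lam. i \<in> I}"

abbreviation generic :: "('m set \<Rightarrow> real) \<Rightarrow> ('m \<Rightarrow> 'a::euclidean_space) \<Rightarrow> 'a \<Rightarrow> bool" where
  "generic w lam \<equiv> mf_generic UNIV UNIV w lam"

lemma top_basis_on:
  assumes "complete_multi_fan bs w lam" "I \<in> tops w lam"
  shows "basis_on lam I"
  using assms by (auto simp: complete_multi_fan_def basis_on_def)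

lemma length_ordered_basis:
  fixes bs :: "'a::euclidean_space list"
  assumes "ordered_basis bs"
  shows "length bs = DIM('a)"
proof -
  have "basis_on id (set bs)" using assms by (simp add: basis_on_def ordered_basis_def)
  from basis_on_card[OF this] show ?thesis
    using assms by (simp add: ordered_basis_def distinct_card)
qed

text \<open>The exponent is the position of \<open>k\<close> in the sorted list, so the power of -1
  is the one with which \<open>I\<close> enters \<open>chain_boundary\<close> at the wall
  \<open>I - {k}\<close>.\<close>

lemma orientation_sign_replace_vertex:
  fixes lam :: "'m::{finite,linorder} \<Rightarrow> 'a::euclidean_space"
  assumes bs: "ordered_basis bs" and I: "basis_on lam I" and k: "k \<in> I"
  shows "orientation_sign bs (x # map lam (sorted_list_of_set (I - {k}))) =
     (-1) ^ card {j \<in> I - {k}. j < k} * sgn (dvec lam I k \<bullet> x) *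
     orientation_sign bs (map lam (sorted_list_of_set I))"
proof -
  let ?xs = "sorted_list_of_set I"
  have xs: "set ?xs = I" "distinct ?xs" "sorted ?xs" "length ?xs = DIM('a)"
    using I basis_on_card[OF I] by simp_all
  obtain us ws where eq: "?xs = us @ k # ws" using k xs(1) by (metis split_list)
  have d: "distinct (us @ k # ws)" "sorted (us @ k # ws)" using xs eq by simp_all
  have rem: "sorted_list_of_set (I - {k}) = us @ ws"
    using d(1) by (simp add: sorted_list_of_set_remove eq remove1_append)
  have "set us = {j \<in> I - {k}. j < k}"
  proof -
    have "I = set us \<union> {k} \<union> set ws" using xs(1) unfolding eq by auto
    then show ?thesis using d by (auto simp: sorted_append less_le)
  qed
  then have card: "card {j \<in> I - {k}. j < k} = length us"
    using d(1) by (metis distinct_append distinct_card)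
  have "x = (\<Sum>i\<in>I. (dvec lam I i \<bullet> x) *\<^sub>R lam i)"
    by (rule sum_inner_dual_vec[OF I, symmetric])
  also have "\<dots> = (\<Sum>l<DIM('a). (dvec lam I (?xs ! l) \<bullet> x) *\<^sub>R lam (?xs ! l))"
    using bij_betw_nth[OF xs(2) refl refl] unfolding xs(1,4)
    by (intro sum.reindex_bij_betw[symmetric])
  also have "\<dots> = (\<Sum>l<length bs. (dvec lam I (?xs ! l) \<bullet> x) *\<^sub>R (map lam us @ lam k # map lam ws) ! l)"
  proof (rule sum.cong)
    fix l assume "l \<in> {..<length bs}"
    then have "l < length ?xs" using xs(4) length_ordered_basis[OF bs] by simp
    then have "lam (?xs ! l) = map lam ?xs ! l" by simp
    then show "(dvec lam I (?xs ! l) \<bullet> x) *\<^sub>R lam (?xs ! l) =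
        (dvec lam I (?xs ! l) \<bullet> x) *\<^sub>R (map lam us @ lam k # map lam ws) ! l"
      by (simp add: eq)
  qed (simp add: length_ordered_basis[OF bs])
  finally have x: "x = (\<Sum>l<length bs. (dvec lam I (?xs ! l) \<bullet> x) *\<^sub>R (map lam us @ lam k # map lam ws) ! l)" .
  have len: "length (map lam us) + Suc (length (map lam ws)) = length bs"
    using xs(4) by (simp add: eq length_ordered_basis[OF bs])
  show ?thesis
    using orientation_sign_replace[OF bs len x] unfolding rem card by (simp add: eq)
qed

text \<open>For every \<open>x\<close>, the signs \<open>sgn \<langle>u\<^sup>I\<^sub>k, x\<rangle>\<close> are the coefficients, with respect to the orientations of
  \<open>(x, I - k)\<close>, of the boundary of the cone from \<open>x\<close>; hence the following sums vanish on a cycle.\<close>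

theorem cycle_sum_eq_0:
  fixes lam :: "'m::{finite,linorder} \<Rightarrow> 'a::euclidean_space" and G :: "'m set \<Rightarrow> real"
  assumes bs: "ordered_basis bs" and fan: "complete_multi_fan bs w lam"
  shows "(\<Sum>I\<in>tops w lam. w I * (\<Sum>k\<in>I. sgn (dvec lam I k \<bullet> x) * G (I - {k}))) = 0"
proof -
  define z where "z = mf_chain bs w lam"
  \<comment> \<open>The orientation of the cone from \<open>x\<close> over a wall. It depends on the
    wall alone and therefore leaves the inner sum once the pairs \<open>(I, k)\<close> are regrouped
    by \<open>M = I - {k}\<close>; what remains inside is the boundary of the chain.\<close>
  define \<tau> where "\<tau> M = orientation_sign bs (x # map lam (sorted_list_of_set M))" for M
  define \<epsilon> where "\<epsilon> M k = (-1 :: real) ^ card {j \<in> M. j < k}" for M and k :: 'm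
  have z0: "z I = 0" if "I \<notin> tops w lam" for I
    using that by (simp add: z_def mf_chain_def)
  have summand: "w I * (sgn (dvec lam I k \<bullet> x) * G (I - {k})) =
      z I * \<epsilon> (I - {k}) k * \<tau> (I - {k}) * G (I - {k})" if I: "I \<in> tops w lam" and k: "k \<in> I" for I k
  proof -
    let ?o = "orientation_sign bs (map lam (sorted_list_of_set I))"
    note b = top_basis_on[OF fan I]
    have o: "?o * ?o = 1"
      using b basis_on_card[OF b]
      by (intro orientation_sign_basis[OF bs])
        (simp_all add: length_ordered_basis[OF bs] basis_on_def distinct_map)
    have e: "\<epsilon> (I - {k}) k * \<epsilon> (I - {k}) k = 1"
      by (simp add: \<epsilon>_def flip: power_mult_distrib)
    have z: "z I = w I * ?o"
      using I by (simp add: z_def mf_chain_def)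
    have \<tau>: "\<tau> (I - {k}) = \<epsilon> (I - {k}) k * sgn (dvec lam I k \<bullet> x) * ?o"
      unfolding \<tau>_def \<epsilon>_def by (rule orientation_sign_replace_vertex[OF bs b k])
    have "z I * \<epsilon> (I - {k}) k * \<tau> (I - {k}) * G (I - {k}) =
        w I * (sgn (dvec lam I k \<bullet> x) * G (I - {k})) * (\<epsilon> (I - {k}) k * \<epsilon> (I - {k}) k) * (?o * ?o)"
      unfolding z \<tau> by (simp only: mult_ac)
    also have "\<dots> = w I * (sgn (dvec lam I k \<bullet> x) * G (I - {k}))"
      unfolding e o by simp
    finally show ?thesis by (rule sym)
  qed
  have "(\<Sum>I\<in>tops w lam. w I * (\<Sum>k\<in>I. sgn (dvec lam I k \<bullet> x) * G (I - {k}))) =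
      (\<Sum>I\<in>tops w lam. \<Sum>k\<in>I. z I * \<epsilon> (I - {k}) k * \<tau> (I - {k}) * G (I - {k}))"
    by (simp add: sum_distrib_left summand)
  also have "\<dots> = (\<Sum>I\<in>UNIV. \<Sum>k\<in>I. z I * \<epsilon> (I - {k}) k * \<tau> (I - {k}) * G (I - {k}))"
    by (rule sum.mono_neutral_left) (auto simp: z0)
  also have "\<dots> = (\<Sum>(I, k)\<in>Sigma UNIV (\<lambda>I. I). z I * \<epsilon> (I - {k}) k * \<tau> (I - {k}) * G (I - {k}))"
    by (rule sum.Sigma) auto
  also have "\<dots> = (\<Sum>(M, k)\<in>Sigma UNIV (\<lambda>M. - M). z (insert k M) * \<epsilon> M k * \<tau> M * G M)"
    by (rule sum.reindex_bij_witness[of _ "\<lambda>(M, k). (insert k M, k)" "\<lambda>(I, k). (I - {k}, k)"])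
      (auto simp: insert_absorb)
  also have "\<dots> = (\<Sum>M\<in>UNIV. \<Sum>k\<in>- M. z (insert k M) * \<epsilon> M k * \<tau> M * G M)"
    by (rule sum.Sigma[symmetric]) auto
  also have "\<dots> = (\<Sum>M\<in>UNIV. \<tau> M * G M * chain_boundary z M)"
    by (simp add: chain_boundary_def \<epsilon>_def sum_distrib_left mult_ac)
  also have "\<dots> = 0"
  proof (rule sum.neutral, rule ballI)
    fix M :: "'m set"
    have "chain_boundary z M = 0"
    proof (cases "card M = DIM('a) - 1")
      case True
      then show ?thesis using fan by (simp add: complete_multi_fan_def z_def)
    next
      case False
      have "z (insert k M) = 0" if "k \<in> - M" for k
      proof (rule z0)
        have "card (insert k M) = Suc (card M)" using that by simp
        then show "insert k M \<notin> tops w lam" using False by (auto simp: mf_tops_def)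
      qed
      then show ?thesis by (simp add: chain_boundary_def)
    qed
    then show "\<tau> M * G M * chain_boundary z M = 0" by simp
  qed
  finally show ?thesis .
qed

section \<open>Volumes and determinants\<close>

text \<open>A finite index type for the standard basis, to transfer the change of variables formula for
  linear maps of \<open>real ^ 'n\<close>, which requires a well-ordered index type, to an arbitrary Euclidean space.\<close>

typedef (overloaded) 'a basis_index = "Basis :: 'a::euclidean_space set"
  morphisms basis_vec Abs_basis_index
  using nonempty_Basis unfolding ex_in_conv .

instance basis_index :: (euclidean_space) finite
proof
  have eq: "(UNIV :: 'a basis_index set) = Abs_basis_index ` Basis"
    by (rule type_definition.univ[OF type_definition_basis_index])
  show "finite (UNIV :: 'a basis_index set)"
    unfolding eq by (intro finite_imageI finite_Basis)
qed

instantiation basis_index :: (euclidean_space) wellorder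
begin

definition basis_index_rank :: "'a basis_index \<Rightarrow> nat" where
  "basis_index_rank = (SOME f. inj f)"

definition less_eq_basis_index :: "'a basis_index \<Rightarrow> 'a basis_index \<Rightarrow> bool" where
  "less_eq_basis_index i j \<longleftrightarrow> basis_index_rank i \<le> basis_index_rank j"

definition less_basis_index :: "'a basis_index \<Rightarrow> 'a basis_index \<Rightarrow> bool" where
  "less_basis_index i j \<longleftrightarrow> basis_index_rank i < basis_index_rank j"

instance
proof
  have "\<exists>f :: 'a basis_index \<Rightarrow> nat. inj f"
    using finite_imp_inj_to_nat_seg[OF finite_class.finite_UNIV[where 'a = "'a basis_index"]] by metis
  then have inj: "inj (basis_index_rank :: 'a basis_index \<Rightarrow> nat)"
    unfolding basis_index_rank_def by (rule someI_ex)
  fix i j k :: "'a basis_index" and P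
  show "i < j \<longleftrightarrow> i \<le> j \<and> \<not> j \<le> i" "i \<le> i" "i \<le> j \<or> j \<le> i"
    "i \<le> j \<Longrightarrow> j \<le> k \<Longrightarrow> i \<le> k"
    unfolding less_eq_basis_index_def less_basis_index_def by linarith+
  show "i \<le> j \<Longrightarrow> j \<le> i \<Longrightarrow> i = j"
    unfolding less_eq_basis_index_def by (rule injD[OF inj]) (rule order_antisym)
  show "P k" if step: "\<And>i. (\<And>j. j < i \<Longrightarrow> P j) \<Longrightarrow> P i"
  proof (rule measure_induct_rule[of basis_index_rank])
    show "P i" if "\<And>j. basis_index_rank j < basis_index_rank i \<Longrightarrow> P j" for i
      by (rule step, rule that) (simp only: less_basis_index_def)
  qed
qed

end

section \<open>Coordinates, frames and changes of variables\<close>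

lemma bij_basis_vec: "bij_betw basis_vec UNIV (Basis :: 'a::euclidean_space set)"
  by (simp add: bij_betw_def inj_on_def basis_vec_inject type_definition.Rep_range[OF type_definition_basis_index])

lemma sum_Basis_basis_index: "(\<Sum>b\<in>Basis. f b) = (\<Sum>i\<in>UNIV. f (basis_vec i))"
  by (rule sum.reindex_bij_betw[OF bij_basis_vec, symmetric])

lemma prod_Basis_basis_index: "(\<Prod>b\<in>Basis. f b) = (\<Prod>i\<in>UNIV. f (basis_vec i))"
  by (rule prod.reindex_bij_betw[OF bij_basis_vec, symmetric])

lemma inner_basis_vec:
  "basis_vec i \<bullet> basis_vec j = (if i = j then 1 else 0)"
  using basis_vec[of i] basis_vec[of j] by (auto simp: inner_Basis basis_vec_inject)

definition to_vec :: "'a::euclidean_space \<Rightarrow> real ^ 'a basis_index" where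
  "to_vec x = (\<chi> i. x \<bullet> basis_vec i)"

definition of_vec :: "real ^ 'a basis_index \<Rightarrow> 'a::euclidean_space" where
  "of_vec v = (\<Sum>i\<in>UNIV. vec_nth v i *\<^sub>R basis_vec i)"

lemma vec_nth_to_vec [simp]: "vec_nth (to_vec x) i = x \<bullet> basis_vec i"
  by (simp add: to_vec_def)

lemma of_vec_inner [simp]: "of_vec v \<bullet> basis_vec i = vec_nth v i"
  by (simp add: of_vec_def inner_sum_left inner_basis_vec if_distrib[of "(*) _"] cong: if_cong)

lemma of_vec_to_vec [simp]: "of_vec (to_vec x) = x"
  using sum_Basis_basis_index[of "\<lambda>b. (x \<bullet> b) *\<^sub>R b"] by (simp add: of_vec_def euclidean_representation)

lemma to_vec_of_vec [simp]: "to_vec (of_vec v) = v"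
  by (simp add: vec_eq_iff)

lemma linear_to_vec: "linear to_vec"
  by (rule linearI) (simp_all add: vec_eq_iff inner_add_left)

lemma linear_of_vec: "linear of_vec"
  by (rule linearI) (simp_all add: of_vec_def scaleR_left_distrib sum.distrib scaleR_right.sum)

lemma borel_measurable_linear:
  fixes f :: "'a::euclidean_space \<Rightarrow> 'b::euclidean_space"
  assumes "linear f"
  shows "f \<in> borel_measurable borel"
  using assms by (intro borel_measurable_continuous_onI linear_continuous_on) (simp add: linear_conv_bounded_linear)

lemma lborel_eq_distr_of_vec: "(lborel :: 'a::euclidean_space measure) = distr lborel borel of_vec"
proof (rule lborel_eqI)
  fix l u :: 'a
  assume le: "\<And>b. b \<in> Basis \<Longrightarrow> l \<bullet> b \<le> u \<bullet> b"
  have ax: "(Basis :: (real ^ 'a basis_index) set) = range (\<lambda>i. axis i 1)"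
    by (auto simp: Basis_vec_def)
  have inj: "inj (\<lambda>i :: 'a basis_index. axis i (1 :: real))"
    by (auto intro!: injI simp: axis_eq_axis)
  have "basis_vec i \<in> Basis" for i :: "'a basis_index"
    by (rule basis_vec)
  then have "of_vec -` box l u = box (to_vec l) (to_vec u)"
    by (auto simp: mem_box sum_Basis_basis_index ax inner_axis)
      (metis of_vec_inner basis_vec_cases)+
  then have "emeasure (distr lborel borel of_vec) (box l u) = emeasure lborel (box (to_vec l) (to_vec u))"
    by (simp add: emeasure_distr borel_measurable_linear[OF linear_of_vec])
  also have "\<dots> = ennreal (\<Prod>b\<in>Basis. (to_vec u - to_vec l) \<bullet> b)"
    using le[OF basis_vec] by (intro emeasure_lborel_box) (auto simp: ax inner_axis)
  also have "(\<Prod>b\<in>Basis. (to_vec u - to_vec l) \<bullet> b) = (\<Prod>b\<in>Basis. (u - l) \<bullet> b)"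
    by (simp add: ax prod.reindex[OF inj] inner_axis prod_Basis_basis_index inner_diff_left)
  finally show "emeasure (distr lborel borel of_vec) (box l u) = ennreal (\<Prod>b\<in>Basis. (u - l) \<bullet> b)" .
qed simp

text \<open>Families of vectors are indexed by \<open>Basis\<close> itself, so no order has to be
  chosen; a simplex enters through any bijection from \<open>Basis\<close>, which affects the
  determinant only by a sign.\<close>

definition frame_map :: "('a \<Rightarrow> 'a) \<Rightarrow> 'a::euclidean_space \<Rightarrow> 'a" where
  "frame_map g y = (\<Sum>b\<in>Basis. (y \<bullet> b) *\<^sub>R g b)"

definition frame_mat :: "('a::euclidean_space \<Rightarrow> 'a) \<Rightarrow> real ^ 'a basis_index ^ 'a basis_index" where
  "frame_mat g = (\<chi> i j. g (basis_vec j) \<bullet> basis_vec i)"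

definition frame_det :: "('a::euclidean_space \<Rightarrow> 'a) \<Rightarrow> real" where
  "frame_det g = Determinants.det (frame_mat g)"

lemma linear_frame_map: "linear (frame_map g)"
  by (rule linearI) (simp_all add: frame_map_def inner_add_left scaleR_left_distrib sum.distrib scaleR_right.sum)

lemma frame_det_cong:
  assumes "\<And>b. b \<in> Basis \<Longrightarrow> g b = h b"
  shows "frame_det g = frame_det h"
  by (simp add: frame_det_def frame_mat_def assms basis_vec)

lemma matrix_frame_map: "matrix (to_vec \<circ> frame_map g \<circ> of_vec) = frame_mat g"
proof -
  have "of_vec (axis j 1) = basis_vec j" for j :: "'a basis_index"
    by (simp add: of_vec_def axis_def if_distrib[of "\<lambda>r. r *\<^sub>R _"] cong: if_cong)
  then show ?thesis
    by (simp add: vec_eq_iff matrix_def frame_mat_def frame_map_def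
        sum_Basis_basis_index inner_sum_left inner_basis_vec if_distrib[of "\<lambda>r. r * _"] cong: if_cong)
qed

lemma vimage_of_vec: "of_vec -` Z = to_vec ` Z"
proof
  show "of_vec -` Z \<subseteq> to_vec ` Z" by (metis image_eqI subsetI to_vec_of_vec vimageE)
qed auto

lemma measure_frame_map_image:
  fixes g :: "'a::euclidean_space \<Rightarrow> 'a"
  assumes "bounded S" "S \<in> sets borel" "frame_map g ` S \<in> sets borel"
  shows "measure lborel (frame_map g ` S) = \<bar>frame_det g\<bar> * measure lborel S"
proof -
  let ?T = "to_vec \<circ> frame_map g \<circ> of_vec"
  have lin: "linear ?T"
    by (intro linear_compose linear_frame_map linear_to_vec linear_of_vec)
  have m: "measure lborel Z = measure lebesgue (to_vec ` Z)" "to_vec ` Z \<in> sets borel" if "Z \<in> sets borel" for Z :: "'a set"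
  proof -
    have "of_vec -` Z \<in> sets borel"
      using measurable_sets[OF borel_measurable_linear[OF linear_of_vec] that] by simp
    then show "to_vec ` Z \<in> sets borel"
      by (simp add: vimage_of_vec)
    then show "measure lborel Z = measure lebesgue (to_vec ` Z)"
      using that by (subst lborel_eq_distr_of_vec)
        (simp add: measure_distr borel_measurable_linear[OF linear_of_vec] vimage_of_vec)
  qed
  have "bounded (to_vec ` S)"
    using assms(1) linear_to_vec by (intro bounded_linear_image) (auto simp: linear_conv_bounded_linear)
  then have "to_vec ` S \<in> lmeasurable"
    using m(2)[OF assms(2)] by (intro bounded_set_imp_lmeasurable) (auto intro: sets_completionI_sets)
  then have "measure lebesgue (?T ` to_vec ` S) = \<bar>Determinants.det (matrix ?T)\<bar> * measure lebesgue (to_vec ` S)"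
    by (rule measure_linear_image[OF lin])
  moreover have "?T ` to_vec ` S = to_vec ` frame_map g ` S"
    by (simp add: image_image)
  ultimately show ?thesis
    by (simp add: m(1) assms matrix_frame_map frame_det_def)
qed

text \<open>Cramer's rule for \<open>frame_mat g\<close> and the coordinate vector
  \<open>e\<close>.\<close>

lemma frame_det_replace:
  fixes g :: "'a::euclidean_space \<Rightarrow> 'a"
  assumes "b \<in> Basis"
  shows "frame_det (g(b := \<Sum>c\<in>Basis. e c *\<^sub>R g c)) = e b * frame_det g"
proof -
  obtain k where k: "b = basis_vec k" using assms by (metis basis_vec_cases)
  have "frame_mat (g(b := \<Sum>c\<in>Basis. e c *\<^sub>R g c)) =
      (\<chi> i j. if j = k then vec_nth (frame_mat g *v (\<chi> i. e (basis_vec i))) i else vec_nth (vec_nth (frame_mat g) i) j)"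
    by (simp add: vec_eq_iff frame_mat_def k basis_vec_inject
        matrix_vector_mult_def sum_Basis_basis_index inner_sum_left mult.commute)
  then show ?thesis
    by (simp add: frame_det_def cramer_lemma k)
qed

text \<open>The matrix of the pairings, which is the transpose of one frame matrix times the other,
  is the identity.\<close>

lemma frame_det_dual:
  fixes g h :: "'a::euclidean_space \<Rightarrow> 'a"
  assumes "\<And>b c. b \<in> Basis \<Longrightarrow> c \<in> Basis \<Longrightarrow> g b \<bullet> h c = (if b = c then 1 else 0)"
  shows "frame_det g * frame_det h = 1"
proof -
  have "(\<Sum>k\<in>UNIV. (x \<bullet> basis_vec k) * (y \<bullet> basis_vec k)) = x \<bullet> y" for x y :: 'a
    by (simp add: euclidean_inner[of x y] sum_Basis_basis_index)
  then have "Finite_Cartesian_Product.transpose (frame_mat g) ** frame_mat h = Finite_Cartesian_Product.mat 1"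
    by (simp add: vec_eq_iff matrix_matrix_mult_def
        Finite_Cartesian_Product.transpose_def frame_mat_def Finite_Cartesian_Product.mat_def assms basis_vec basis_vec_inject)
  then have "Determinants.det (Finite_Cartesian_Product.transpose (frame_mat g) ** frame_mat h) = 1"
    by (simp add: det_I)
  then show ?thesis
    by (simp add: det_mul Determinants.det_transpose frame_det_def)
qed

text \<open>The dual family \<open>h\<close> yields the inverse of the frame map, so preimages of
  boxes are bounded and the volume formula for linear images applies to them; agreement on boxes
  identifies the two measures.\<close>

lemma nn_integral_frame_map:
  fixes g h :: "'a::euclidean_space \<Rightarrow> 'a"
  assumes dual: "\<And>b c. b \<in> Basis \<Longrightarrow> c \<in> Basis \<Longrightarrow> g b \<bullet> h c = (if b = c then 1 else 0)"
    and f: "f \<in> borel_measurable borel"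
  shows "(\<integral>\<^sup>+x. f x \<partial>lborel) = ennreal \<bar>frame_det g\<bar> * (\<integral>\<^sup>+y. f (frame_map g y) \<partial>lborel)"
proof -
  let ?T = "frame_map g"
  define T' where "T' x = (\<Sum>c\<in>Basis. (x \<bullet> h c) *\<^sub>R c)" for x
  have T'T: "T' (?T y) = y" for y
  proof -
    have "?T y \<bullet> h c = y \<bullet> c" if "c \<in> Basis" for c
      using that by (simp add: frame_map_def inner_sum_left dual if_distrib[of "(*) _"] cong: if_cong)
    then show ?thesis by (simp add: T'_def euclidean_representation)
  qed
  have "inj ?T" by (metis T'T injI)
  then have "surj ?T"
    by (rule linear_injective_imp_surjective[OF linear_frame_map _ refl])
  then have TT': "?T (T' x) = x" for x
    by (metis T'T surjD)
  have lin': "linear T'"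
    by (rule linearI) (simp_all add: T'_def inner_add_left scaleR_left_distrib sum.distrib scaleR_right.sum)
  have m[measurable]: "?T \<in> borel_measurable borel"
    by (rule borel_measurable_linear[OF linear_frame_map])
  let ?D = "density (distr lborel borel ?T) (\<lambda>_. ennreal \<bar>frame_det g\<bar>)"
  have "lborel = ?D"
  proof (rule lborel_eqI)
    fix l u :: 'a
    assume le: "\<And>b. b \<in> Basis \<Longrightarrow> l \<bullet> b \<le> u \<bullet> b"
    let ?S = "?T -` box l u"
    have S: "?S = T' ` box l u"
    proof
      show "?S \<subseteq> T' ` box l u" by (metis T'T image_eqI subsetI vimageE)
      show "T' ` box l u \<subseteq> ?S" by (auto simp: TT')
    qed
    have bS: "bounded ?S" unfolding S
      using lin' by (intro bounded_linear_image) (auto simp: linear_conv_bounded_linear)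
    have mS: "?S \<in> sets borel" using measurable_sets[OF m, of "box l u"] by simp
    have img: "?T ` ?S = box l u" using \<open>surj ?T\<close> by (simp add: surj_image_vimage_eq)
    have "emeasure ?D (box l u) =
        ennreal \<bar>frame_det g\<bar> * emeasure lborel ?S"
      by (simp add: emeasure_density nn_integral_cmult_indicator emeasure_distr)
    also have "emeasure lborel ?S = ennreal (measure lborel ?S)"
      using emeasure_bounded_finite[OF bS] by (intro emeasure_eq_ennreal_measure) auto
    also have "ennreal \<bar>frame_det g\<bar> * ennreal (measure lborel ?S) = ennreal (measure lborel (?T ` ?S))"
      by (subst measure_frame_map_image[OF bS mS]) (simp_all only: img ennreal_mult abs_ge_zero measure_nonneg sets.sets_into_space borel_open open_box)
    also have "\<dots> = ennreal (\<Prod>b\<in>Basis. (u - l) \<bullet> b)"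
      unfolding img using le by (simp add: measure_lborel_box_eq)
    finally show "emeasure ?D (box l u) =
      ennreal (\<Prod>b\<in>Basis. (u - l) \<bullet> b)" .
  qed simp
  then have "(\<integral>\<^sup>+x. f x \<partial>lborel) = (\<integral>\<^sup>+x. f x \<partial>?D)"
    by simp
  also have "\<dots> = ennreal \<bar>frame_det g\<bar> * (\<integral>\<^sup>+y. f (?T y) \<partial>lborel)"
    using f by (simp add: nn_integral_density nn_integral_cmult nn_integral_distr)
  finally show ?thesis .
qed

section \<open>Exponential integrals over cones\<close>

lemma nn_integral_exp_half_line:
  fixes a :: real
  assumes "a \<noteq> 0"
  shows "(\<integral>\<^sup>+y. indicator {r. 0 \<le> a * r} y * ennreal (exp (- (a * y))) \<partial>lborel) = ennreal (1 / \<bar>a\<bar>)"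
proof -
  have [measurable]: "{r. 0 \<le> a * r} \<in> sets borel" by measurable
  have "(\<integral>\<^sup>+x. ennreal (exp (- x :: real)) * indicator {0..} x \<partial>lborel) = ennreal (0 - (- exp (- 0)))"
  proof (rule nn_integral_FTC_atLeast)
    show "((\<lambda>x :: real. - exp (- x)) \<longlongrightarrow> 0) at_top" by real_asymp
  qed (auto intro!: derivative_eq_intros)
  then have 1: "(\<integral>\<^sup>+x. indicator {r. 0 \<le> r} x * ennreal (exp (- x :: real)) \<partial>lborel) = 1"
    by (simp add: mult.commute atLeast_def)
  have "(\<integral>\<^sup>+y. indicator {r. 0 \<le> a * r} y * ennreal (exp (- (a * y))) \<partial>lborel) =
      ennreal \<bar>1 / a\<bar> * (\<integral>\<^sup>+x. indicator {r. 0 \<le> a * r} (0 + 1 / a * x) * ennreal (exp (- (a * (0 + 1 / a * x)))) \<partial>lborel)"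
    using assms by (intro nn_integral_real_affine) auto
  also have "\<dots> = ennreal \<bar>1 / a\<bar> * (\<integral>\<^sup>+x. indicator {r. 0 \<le> r} x * ennreal (exp (- x)) \<partial>lborel)"
    using assms by (intro arg_cong[where f = "\<lambda>x. _ * x"] nn_integral_cong) (simp add: indicator_def)
  finally show ?thesis by (simp add: 1)
qed

text \<open>The domain is the cone with apex \<open>p\<close> on the generators \<open>g b\<close>,
  each flipped to pair positively with \<open>\<phi>\<close>. In frame coordinates cone and
  exponential split into one half-line integral per generator; the condition
  \<open>0 \<le> a * r\<close> selects the right half-line for either sign of
  \<open>a\<close>.\<close>

lemma nn_integral_exp_cone:
  fixes g h :: "'a::euclidean_space \<Rightarrow> 'a"
  assumes dual: "\<And>b c. b \<in> Basis \<Longrightarrow> c \<in> Basis \<Longrightarrow> g b \<bullet> h c = (if b = c then 1 else 0)"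
    and a: "\<And>b. b \<in> Basis \<Longrightarrow> g b \<bullet> \<phi> \<noteq> 0"
  shows "(\<integral>\<^sup>+x. (\<Prod>b\<in>Basis. indicator {r. 0 \<le> (g b \<bullet> \<phi>) * r} ((x - p) \<bullet> h b)) *
            ennreal (exp (- ((x - p) \<bullet> \<phi>))) \<partial>lborel) =
     ennreal (\<bar>frame_det g\<bar> / (\<Prod>b\<in>Basis. \<bar>g b \<bullet> \<phi>\<bar>))"
proof -
  define f where "f x = (\<Prod>b\<in>Basis. indicator {r. 0 \<le> (g b \<bullet> \<phi>) * r} (x \<bullet> h b)) * ennreal (exp (- (x \<bullet> \<phi>)))" for x
  have [measurable]: "{r. 0 \<le> (g b \<bullet> \<phi>) * r} \<in> sets borel" for b by measurable
  have f[measurable]: "f \<in> borel_measurable borel"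
    unfolding f_def by measurable
  have fT: "f (frame_map g y) =
      (\<Prod>b\<in>Basis. indicator {r. 0 \<le> (g b \<bullet> \<phi>) * r} (y \<bullet> b) * ennreal (exp (- ((g b \<bullet> \<phi>) * (y \<bullet> b)))))" for y
  proof -
    have "frame_map g y \<bullet> h c = y \<bullet> c" if "c \<in> Basis" for c
      using that by (simp add: frame_map_def inner_sum_left dual if_distrib[of "(*) _"] cong: if_cong)
    moreover have "exp (- (frame_map g y \<bullet> \<phi>)) = (\<Prod>b\<in>Basis. exp (- ((g b \<bullet> \<phi>) * (y \<bullet> b))))"
      by (simp add: frame_map_def inner_sum_left mult.commute flip: exp_sum sum_negf)
    ultimately show ?thesis
      by (simp add: f_def prod.distrib prod_ennreal)
  qed
  have "(\<integral>\<^sup>+x. f x \<partial>lborel) = (\<integral>\<^sup>+x. f x \<partial>distr lborel borel ((+) (- p)))"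
    by (simp add: lborel_distr_plus)
  also have "\<dots> = (\<integral>\<^sup>+x. f (x - p) \<partial>lborel)"
    by (subst nn_integral_distr) simp_all
  finally have "(\<integral>\<^sup>+x. f (x - p) \<partial>lborel) = (\<integral>\<^sup>+x. f x \<partial>lborel)"
    by (rule sym)
  also have "\<dots> = ennreal \<bar>frame_det g\<bar> * (\<integral>\<^sup>+y. f (frame_map g y) \<partial>lborel)"
    by (rule nn_integral_frame_map[OF dual f])
  also have "(\<integral>\<^sup>+y. f (frame_map g y) \<partial>lborel) =
      (\<integral>\<^sup>+y. (\<Prod>b\<in>Basis. indicator {r. 0 \<le> (g b \<bullet> \<phi>) * r} (y \<bullet> b) * ennreal (exp (- ((g b \<bullet> \<phi>) * (y \<bullet> b))))) \<partial>lborel)"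
    by (simp only: fT)
  also have "\<dots> = (\<Prod>b\<in>Basis. \<integral>\<^sup>+r. indicator {r. 0 \<le> (g b \<bullet> \<phi>) * r} r * ennreal (exp (- ((g b \<bullet> \<phi>) * r))) \<partial>lborel)"
    by (rule nn_integral_lborel_prod) auto
  also have "\<dots> = (\<Prod>b\<in>Basis. ennreal (1 / \<bar>g b \<bullet> \<phi>\<bar>))"
    by (intro prod.cong refl nn_integral_exp_half_line a)
  also have "\<dots> = ennreal (1 / (\<Prod>b\<in>Basis. \<bar>g b \<bullet> \<phi>\<bar>))"
    by (simp add: prod_ennreal prod_dividef)
  finally show ?thesis
    by (simp add: f_def prod_nonneg flip: ennreal_mult)
qed

section \<open>Parallelepipeds and determinants\<close>

lemma abs_det_eq_frame_det:
  assumes f: "bij_betw f Basis I"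
  shows "abs_det lam I = \<bar>frame_det (lam \<circ> f)\<bar>"
proof -
  have "{\<Sum>i\<in>I. t i *\<^sub>R lam i | t. \<forall>i\<in>I. 0 \<le> t i \<and> t i \<le> 1} = frame_map (lam \<circ> f) ` cbox 0 One" (is "?L = ?R")
  proof (intro equalityI subsetI)
    fix x assume "x \<in> ?L"
    then obtain t where t: "x = (\<Sum>i\<in>I. t i *\<^sub>R lam i)" "\<forall>i\<in>I. 0 \<le> t i \<and> t i \<le> 1" by auto
    let ?y = "\<Sum>b\<in>Basis. t (f b) *\<^sub>R b"
    have "x = frame_map (lam \<circ> f) ?y"
      by (simp add: t(1) frame_map_def sum.reindex_bij_betw[OF f, symmetric])
    moreover have "?y \<in> cbox 0 One"
      using t(2) f by (auto simp: mem_box bij_betw_def)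
    ultimately show "x \<in> frame_map (lam \<circ> f) ` cbox 0 One" by blast
  next
    fix x assume "x \<in> frame_map (lam \<circ> f) ` cbox 0 One"
    then obtain y where y: "x = frame_map (lam \<circ> f) y" "y \<in> cbox 0 One" by auto
    define t where "t i = y \<bullet> inv_into Basis f i" for i
    have "inv_into Basis f (f b) = b" if "b \<in> Basis" for b
      using f that by (simp add: bij_betw_def)
    then have "x = (\<Sum>i\<in>I. t i *\<^sub>R lam i)"
      by (simp add: y(1) frame_map_def t_def sum.reindex_bij_betw[OF f, symmetric])
    moreover have "\<forall>i\<in>I. 0 \<le> t i \<and> t i \<le> 1"
      using y(2) f by (auto simp: t_def mem_box bij_betw_def inv_into_into)
    ultimately show "x \<in> ?L" by blast
  qed
  moreover have "compact (frame_map (lam \<circ> f) ` cbox 0 One)"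
    by (intro compact_continuous_image compact_cbox linear_continuous_on)
      (simp add: linear_frame_map flip: linear_conv_bounded_linear)
  then have "frame_map (lam \<circ> f) ` cbox 0 One \<in> sets borel"
    by (simp add: borel_compact)
  ultimately show ?thesis
    by (simp add: abs_det_def measure_frame_map_image)
qed

lemma exists_bij_Basis:
  fixes lam :: "'m \<Rightarrow> 'a::euclidean_space"
  assumes "basis_on lam I"
  obtains f where "bij_betw f (Basis :: 'a set) I"
  using finite_same_card_bij[of "Basis :: 'a set" I] assms basis_on_card[OF assms]
  by (auto simp: basis_on_def)

lemma frame_det_dual_vec:
  fixes lam :: "'m \<Rightarrow> 'a::euclidean_space"
  assumes "basis_on lam I" "bij_betw f Basis I"
  shows "frame_det (\<lambda>b. dvec lam I (f b)) * frame_det (lam \<circ> f) = 1"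
proof (rule frame_det_dual)
  fix b c :: 'a assume "b \<in> Basis" "c \<in> Basis"
  then show "dvec lam I (f b) \<bullet> (lam \<circ> f) c = (if b = c then 1 else 0)"
    using bij_betwE[OF assms(2)] bij_betw_imp_inj_on[OF assms(2)]
    by (simp add: inner_dual_vec[OF assms(1)] inj_on_eq_iff)
qed

lemma abs_det_pos:
  assumes "basis_on lam I"
  shows "abs_det lam I > 0"
proof -
  obtain f where f: "bij_betw f (Basis :: 'b set) I" using exists_bij_Basis[OF assms] .
  show ?thesis
    using frame_det_dual_vec[OF assms f] by (auto simp: abs_det_eq_frame_det[OF f])
qed

text \<open>The volume of the parallelepiped on \<open>x\<close> and the vectors of a wall. It is a
  function of the wall alone, as the cycle identity requires; \<open>abs_det lam I\<close> is
  not.\<close>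

definition abs_det_insert :: "('m \<Rightarrow> 'a::euclidean_space) \<Rightarrow> 'a \<Rightarrow> 'm set \<Rightarrow> real" where
  "abs_det_insert lam x M = measure lborel
     {s *\<^sub>R x + (\<Sum>j\<in>M. t j *\<^sub>R lam j) | s t. 0 \<le> s \<and> s \<le> 1 \<and> (\<forall>j\<in>M. 0 \<le> t j \<and> t j \<le> 1)}"

text \<open>Replacing \<open>lam k\<close> by \<open>x\<close> multiplies the determinant by the
  coordinate of \<open>x\<close> along \<open>lam k\<close>.\<close>

lemma abs_det_insert_eq:
  fixes lam :: "'m \<Rightarrow> 'a::euclidean_space"
  assumes I: "basis_on lam I" and k: "k \<in> I"
  shows "abs_det_insert lam x (I - {k}) = \<bar>dvec lam I k \<bullet> x\<bar> * abs_det lam I"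
proof -
  obtain f where f: "bij_betw f (Basis :: 'a set) I" using exists_bij_Basis[OF I] .
  then obtain b where b: "b \<in> Basis" "k = f b" using k by (auto simp: bij_betw_def)
  have fin: "finite I" using I by (simp add: basis_on_def)
  have sum: "(\<Sum>i\<in>I. t i *\<^sub>R (lam(k := x)) i) = t k *\<^sub>R x + (\<Sum>j\<in>I - {k}. t j *\<^sub>R lam j)" for t
    by (simp add: sum.remove[OF fin k])
  have "{s *\<^sub>R x + (\<Sum>j\<in>I - {k}. t j *\<^sub>R lam j) | s t. 0 \<le> s \<and> s \<le> 1 \<and> (\<forall>j\<in>I - {k}. 0 \<le> t j \<and> t j \<le> 1)} =
     {\<Sum>i\<in>I. t i *\<^sub>R (lam(k := x)) i | t. \<forall>i\<in>I. 0 \<le> t i \<and> t i \<le> 1}" (is "?L = ?R")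
  proof (intro equalityI subsetI)
    fix z assume "z \<in> ?L"
    then obtain s t where st: "z = s *\<^sub>R x + (\<Sum>j\<in>I - {k}. t j *\<^sub>R lam j)" "0 \<le> s" "s \<le> 1"
      "\<forall>j\<in>I - {k}. 0 \<le> t j \<and> t j \<le> 1" by auto
    have "z = (\<Sum>i\<in>I. (t(k := s)) i *\<^sub>R (lam(k := x)) i)"
      unfolding sum by (simp add: st(1))
    moreover have "\<forall>i\<in>I. 0 \<le> (t(k := s)) i \<and> (t(k := s)) i \<le> 1" using st by auto
    ultimately show "z \<in> ?R" by blast
  next
    fix z assume "z \<in> ?R"
    then show "z \<in> ?L" unfolding sum using k by blast
  qed
  then have "abs_det_insert lam x (I - {k}) = abs_det (lam(k := x)) I"
    by (simp only: abs_det_insert_def abs_det_def)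
  also have "\<dots> = \<bar>frame_det (lam(k := x) \<circ> f)\<bar>"
    by (rule abs_det_eq_frame_det[OF f])
  also have "frame_det (lam(k := x) \<circ> f) = frame_det ((lam \<circ> f)(b := x))"
    using f b by (intro frame_det_cong) (auto simp: bij_betw_def inj_on_def)
  also have "(lam \<circ> f)(b := x) = (lam \<circ> f)(b := \<Sum>c\<in>Basis. (dvec lam I (f c) \<bullet> x) *\<^sub>R (lam \<circ> f) c)"
    using sum_inner_dual_vec[OF I, of x] by (simp add: sum.reindex_bij_betw[OF f, symmetric])
  also have "frame_det \<dots> = (dvec lam I (f b) \<bullet> x) * frame_det (lam \<circ> f)"
    by (rule frame_det_replace[OF b(1)])
  finally show ?thesis
    by (simp add: abs_mult abs_det_eq_frame_det[OF f] b)
qed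

section \<open>The volume polynomial\<close>

text \<open>Both sides are the top coefficient of the Lagrange interpolation polynomial of
  \<open>N\<close> at the nodes \<open>T\<close>, which is \<open>N\<close> itself by the degree
  bound.\<close>

lemma sum_lagrange_coeff:
  fixes N :: "real poly"
  assumes T: "finite T" "T \<noteq> {}" and deg: "Polynomial.degree N < card T"
  shows "(\<Sum>x\<in>T. poly N x / (\<Prod>y\<in>T - {x}. x - y)) = Polynomial.coeff N (card T - 1)"
proof -
  let ?P = "\<lambda>x. \<Prod>y\<in>T - {x}. [:- y, 1:]"
  define L where "L = (\<Sum>x\<in>T. Polynomial.smult (poly N x / (\<Prod>y\<in>T - {x}. x - y)) (?P x))"
  have deg_P: "Polynomial.degree (?P x) = card T - 1" and lead_P: "Polynomial.coeff (?P x) (card T - 1) = 1" if "x \<in> T" for x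
  proof -
    show "Polynomial.degree (?P x) = card T - 1"
      using T that by (subst degree_prod_eq_sum_degree) auto
    then show "Polynomial.coeff (?P x) (card T - 1) = 1"
      using lead_coeff_prod[of "\<lambda>y. [:- y, 1:]" "T - {x}"] by simp
  qed
  have "poly L z = poly N z" if z: "z \<in> T" for z
  proof -
    have "poly L z = (\<Sum>x\<in>T. if x = z then poly N z else 0)"
      unfolding L_def poly_sum
    proof (rule sum.cong)
      fix x assume x: "x \<in> T"
      show "poly (Polynomial.smult (poly N x / (\<Prod>y\<in>T - {x}. x - y)) (?P x)) z = (if x = z then poly N z else 0)"
      proof (cases "x = z")
        case True
        have "(\<Prod>y\<in>T - {z}. z - y) \<noteq> 0" using T by auto
        then show ?thesis using True by (simp add: poly_prod)
      next
        case False
        then have "(\<Prod>y\<in>T - {x}. z - y) = 0" using z T(1) by (intro prod_zero) auto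
        then show ?thesis using False by (simp add: poly_prod)
      qed
    qed simp
    then show ?thesis using z T(1) by simp
  qed
  moreover have "Polynomial.degree L < card T"
  proof -
    have "Polynomial.degree L \<le> card T - 1"
      unfolding L_def using deg_P by (intro degree_sum_le T(1)) (metis degree_smult_le)
    moreover have "card T > 0" using T by (simp add: card_gt_0_iff)
    ultimately show ?thesis by linarith
  qed
  ultimately have "L = N"
    using deg by (intro poly_eqI_degree[of T]) auto
  moreover have "Polynomial.coeff L (card T - 1) = (\<Sum>x\<in>T. poly N x / (\<Prod>y\<in>T - {x}. x - y))"
    by (simp add: L_def coeff_sum lead_P del: One_nat_def)
  ultimately show ?thesis by simp
qed

lemma coeff_linear_power_top:
  "Polynomial.coeff ([:A, B:] ^ n) n = (B :: 'a :: comm_ring_1) ^ n"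
proof (induction n)
  case (Suc n)
  have "Polynomial.degree ([:A, B:] ^ n) \<le> n"
    by (rule order.trans[OF degree_power_le]) simp
  then have "Polynomial.coeff ([:A, B:] ^ n) (Suc n) = 0"
    by (intro coeff_eq_0) simp
  then show ?case using Suc.IH by simp
qed simp

text \<open>The partial fraction expansion of \<open>(A - t E)\<^sup>n / (t \<Prod>\<^sub>j (a\<^sub>j - t e\<^sub>j))\<close> compares its residues
  at \<open>0\<close>, at \<open>a\<^sub>k / e\<^sub>k\<close> and at infinity.\<close>

lemma partial_fraction_identity:
  fixes a e :: "'i \<Rightarrow> real" and A E :: real
  assumes I: "finite I" and a: "\<And>i. i \<in> I \<Longrightarrow> a i \<noteq> 0" and e: "\<And>i. i \<in> I \<Longrightarrow> e i \<noteq> 0"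
    and ae: "\<And>i j. i \<in> I \<Longrightarrow> j \<in> I \<Longrightarrow> i \<noteq> j \<Longrightarrow> a i * e j \<noteq> a j * e i"
  shows "A ^ card I / (\<Prod>i\<in>I. a i) = E ^ card I / (\<Prod>i\<in>I. e i) +
    (\<Sum>k\<in>I. (A - a k / e k * E) ^ card I / (a k / e k * e k * (\<Prod>j\<in>I - {k}. a j - a k / e k * e j)))"
proof -
  define t where "t k = a k / e k" for k
  let ?n = "card I" and ?N = "[:A, - E:] ^ card I"
  have inj: "inj_on t I"
    using ae e by (intro inj_onI) (auto simp: t_def frac_eq_eq)
  have t0: "t k \<noteq> 0" if "k \<in> I" for k using a e that by (simp add: t_def)
  have cardT: "card (insert 0 (t ` I)) = Suc ?n"
    using I t0 by (subst card_insert_disjoint) (auto simp: card_image[OF inj])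
  have pe: "(\<Prod>i\<in>I. e i) \<noteq> 0" using e I by auto
  have "Polynomial.degree ?N \<le> ?n"
    by (rule order.trans[OF degree_power_le]) (simp add: degree_pCons_eq_if)
  \<comment> \<open>The nodes are the poles 0 and \<open>a\<^sub>k / e\<^sub>k\<close>, one more
    than the degree bound of the numerator \<open>(A - t E) ^ n\<close>; its coefficient
    \<open>(- E) ^ n\<close> accounts for the residue at infinity.\<close>
  then have "(\<Sum>x\<in>insert 0 (t ` I). poly ?N x / (\<Prod>y\<in>insert 0 (t ` I) - {x}. x - y)) = Polynomial.coeff ?N ?n"
    using sum_lagrange_coeff[of "insert 0 (t ` I)" ?N] I by (simp add: cardT)
  also have "Polynomial.coeff ?N ?n = (- E) ^ ?n"
    by (rule coeff_linear_power_top)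
  also have "(\<Sum>x\<in>insert 0 (t ` I). poly ?N x / (\<Prod>y\<in>insert 0 (t ` I) - {x}. x - y)) =
      A ^ ?n / (\<Prod>k\<in>I. - t k) + (\<Sum>k\<in>I. (A - t k * E) ^ ?n / (t k * (\<Prod>j\<in>I - {k}. t k - t j)))"
  proof -
    let ?F = "\<lambda>x. poly ?N x / (\<Prod>y\<in>insert 0 (t ` I) - {x}. x - y)"
    have 0: "0 \<notin> t ` I" using t0 by auto
    then have "insert 0 (t ` I) - {0} = t ` I" by auto
    then have F0: "?F 0 = A ^ ?n / (\<Prod>k\<in>I. - t k)"
      by (simp add: prod.reindex[OF inj])
    have Ft: "?F (t k) = (A - t k * E) ^ ?n / (t k * (\<Prod>j\<in>I - {k}. t k - t j))" if "k \<in> I" for k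
    proof -
      have "insert 0 (t ` I) - {t k} = insert 0 (t ` (I - {k}))"
        using that t0[OF that] inj by (auto simp: inj_on_def)
      moreover have "0 \<notin> t ` (I - {k})" using t0 by auto
      moreover have "inj_on t (I - {k})" using inj by (rule inj_on_subset) auto
      ultimately show ?thesis using I by (simp add: prod.reindex)
    qed
    have "(\<Sum>x\<in>insert 0 (t ` I). ?F x) = ?F 0 + (\<Sum>k\<in>I. ?F (t k))"
      using sum.insert[of "t ` I" 0 ?F] sum.reindex[OF inj, of ?F] I 0 by (simp only: finite_imageI comp_def simp_thms)
    also have "\<dots> = A ^ ?n / (\<Prod>k\<in>I. - t k) + (\<Sum>k\<in>I. (A - t k * E) ^ ?n / (t k * (\<Prod>j\<in>I - {k}. t k - t j)))"
      unfolding F0 by (intro arg_cong[where f = "\<lambda>x. _ + x"] sum.cong refl Ft)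
    finally show ?thesis .
  qed
  finally have "A ^ ?n / (\<Prod>k\<in>I. - t k) + (\<Sum>k\<in>I. (A - t k * E) ^ ?n / (t k * (\<Prod>j\<in>I - {k}. t k - t j))) = (- E) ^ ?n" .
  moreover have "A ^ ?n / (\<Prod>k\<in>I. - t k) = (-1) ^ ?n * (\<Prod>i\<in>I. e i) * (A ^ ?n / (\<Prod>i\<in>I. a i))"
    by (simp add: prod_uminus t_def prod_dividef minus_one_power_iff mult.commute)
  moreover have "(A - t k * E) ^ ?n / (t k * (\<Prod>j\<in>I - {k}. t k - t j)) =
      - ((-1) ^ ?n * (\<Prod>i\<in>I. e i) * ((A - t k * E) ^ ?n / (t k * e k * (\<Prod>j\<in>I - {k}. a j - t k * e j))))"
    if k: "k \<in> I" for k
  proof -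
    have n: "?n = Suc (card (I - {k}))" using I k by (metis card_Suc_Diff1)
    have "(\<Prod>j\<in>I - {k}. a j - t k * e j) = (\<Prod>j\<in>I - {k}. - (e j * (t k - t j)))"
      by (rule prod.cong) (auto simp: t_def e field_simps)
    also have "\<dots> = (-1) ^ card (I - {k}) * ((\<Prod>j\<in>I - {k}. e j) * (\<Prod>j\<in>I - {k}. t k - t j))"
      by (simp add: prod_uminus prod.distrib)
    finally have p: "(\<Prod>j\<in>I - {k}. a j - t k * e j) = \<dots>" .
    have pe': "(\<Prod>j\<in>I - {k}. e j) \<noteq> 0" using e I by auto
    have cancel: "Y / (r * Q) = - ((- 1 * s) * (u * R) * (Y / (r * u * (s * (R * Q)))))"
      if "s = 1 \<or> s = -1" "u \<noteq> 0" "R \<noteq> 0" for Y r Q s u R :: real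
      using that by auto
    have s: "(-1::real) ^ card (I - {k}) = 1 \<or> (-1::real) ^ card (I - {k}) = - 1"
      by (simp add: minus_one_power_iff)
    have m: "(-1::real) ^ ?n = - 1 * (-1) ^ card (I - {k})"
      unfolding n by simp
    show ?thesis
      unfolding p prod.remove[OF I k] m by (rule cancel[OF s e[OF k] pe'])
  qed
  ultimately have "(-1) ^ ?n * (\<Prod>i\<in>I. e i) * (A ^ ?n / (\<Prod>i\<in>I. a i)) - (-1) ^ ?n * (\<Prod>i\<in>I. e i) *
      (\<Sum>k\<in>I. (A - t k * E) ^ ?n / (t k * e k * (\<Prod>j\<in>I - {k}. a j - t k * e j))) = (-1) ^ ?n * E ^ ?n"
    by (simp add: sum_distrib_left sum_negf power_minus[of E])
  then have "(-1) ^ ?n * ((\<Prod>i\<in>I. e i) * (A ^ ?n / (\<Prod>i\<in>I. a i) -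
      (\<Sum>k\<in>I. (A - t k * E) ^ ?n / (t k * e k * (\<Prod>j\<in>I - {k}. a j - t k * e j))))) = (-1) ^ ?n * E ^ ?n"
    by (simp only: right_diff_distrib mult.assoc)
  then have "(\<Prod>i\<in>I. e i) * (A ^ ?n / (\<Prod>i\<in>I. a i) -
      (\<Sum>k\<in>I. (A - t k * E) ^ ?n / (t k * e k * (\<Prod>j\<in>I - {k}. a j - t k * e j)))) = E ^ ?n"
    by simp
  then have "A ^ ?n / (\<Prod>i\<in>I. a i) -
      (\<Sum>k\<in>I. (A - t k * E) ^ ?n / (t k * e k * (\<Prod>j\<in>I - {k}. a j - t k * e j))) = E ^ ?n / (\<Prod>i\<in>I. e i)"
    using pe by (subst nonzero_eq_divide_eq) (simp_all only: mult.commute not_False_eq_True)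
  then show ?thesis by (simp add: t_def)
qed

section \<open>Independence of the generic vector\<close>

abbreviation dcoord :: "('m \<Rightarrow> 'a::euclidean_space) \<Rightarrow> 'm set \<Rightarrow> 'a \<Rightarrow> 'm \<Rightarrow> real" where
  "dcoord lam I v i \<equiv> dvec lam I i \<bullet> v"

text \<open>These are the coordinates of \<open>v\<close> after \<open>x\<close> has replaced
  \<open>lam k\<close> in the basis, and they are the quantities in the partial fraction residue at
  \<open>a\<^sub>k / e\<^sub>k\<close>. The equivalence includes uniqueness, so coordinates obtained
  by choice can be computed.\<close>

lemma exchange_coordinates:
  assumes I: "basis_on lam I" and k: "k \<in> I" and e: "dcoord lam I x k \<noteq> 0"
  shows "v = t *\<^sub>R x + (\<Sum>j\<in>I - {k}. b j *\<^sub>R lam j) \<longleftrightarrow>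
    t = dcoord lam I v k / dcoord lam I x k \<and> (\<forall>j\<in>I - {k}. b j = dcoord lam I v j - t * dcoord lam I x j)"
    (is "?L \<longleftrightarrow> ?R")
proof
  have fin: "finite I" using I by (simp add: basis_on_def)
  have s: "dvec lam I i \<bullet> (\<Sum>j\<in>I - {k}. b j *\<^sub>R lam j) = (if i = k then 0 else b i)" if "i \<in> I" for i
  proof -
    have "dvec lam I i \<bullet> (\<Sum>j\<in>I - {k}. b j *\<^sub>R lam j) = (\<Sum>j\<in>I - {k}. if j = i then b i else 0)"
      unfolding inner_sum_right by (rule sum.cong) (auto simp: inner_dual_vec[OF I that])
    then show ?thesis using that fin by auto
  qed
  {
    assume ?L
    then have "dcoord lam I v i = t * dcoord lam I x i + (if i = k then 0 else b i)" if "i \<in> I" for i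
      using s[OF that] by (simp add: inner_add_right)
    then show ?R using k e by auto
  }
  assume R: ?R
  have "v - t *\<^sub>R x = (\<Sum>j\<in>I. dcoord lam I (v - t *\<^sub>R x) j *\<^sub>R lam j)"
    by (rule sum_inner_dual_vec[OF I, symmetric])
  also have "\<dots> = dcoord lam I (v - t *\<^sub>R x) k *\<^sub>R lam k + (\<Sum>j\<in>I - {k}. dcoord lam I (v - t *\<^sub>R x) j *\<^sub>R lam j)"
    by (rule sum.remove[OF fin k])
  also have "\<dots> = (\<Sum>j\<in>I - {k}. b j *\<^sub>R lam j)"
    using R e by (simp add: inner_diff_right)
  finally show ?L by (simp add: algebra_simps)
qed

text \<open>The integrand of \<open>mf_integral\<close> at an n-th power of a linear form. Up to
  \<open>1 / n!\<close> it is an expression of the kind in Lawrence's volume formula for simple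
  polytopes, with the pairing of the vertex with \<open>v\<close> written in dual
  coordinates.\<close>

definition lawrence_sum ::
  "('m::finite set \<Rightarrow> real) \<Rightarrow> ('m \<Rightarrow> 'a::euclidean_space) \<Rightarrow> real ^ 'm \<Rightarrow> 'a \<Rightarrow> real" where
  "lawrence_sum w lam c v = (\<Sum>I\<in>tops w lam. w I * (\<Sum>i\<in>I. vec_nth c i * dcoord lam I v i) ^ DIM('a) /
     (abs_det lam I * (\<Prod>i\<in>I. dcoord lam I v i)))"

text \<open>By partial fractions the summands of \<open>I\<close> at \<open>v\<close> and at
  \<open>x\<close> differ by signed terms in which, apart from the weight, \<open>I\<close> occurs
  only through the walls \<open>I - {k}\<close>; \<open>cycle_sum_eq_0\<close> removes them. The
  hypothesis \<open>cross\<close> keeps the poles on the line \<open>v - t x\<close> apart.\<close>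

lemma lawrence_sum_eq_if_cross_generic:
  fixes lam :: "'m::{finite,linorder} \<Rightarrow> 'a::euclidean_space"
  assumes bs: "ordered_basis bs" and fan: "complete_multi_fan bs w lam"
    and gen: "generic w lam v" "generic w lam x"
    and cross: "\<And>I j k. I \<in> tops w lam \<Longrightarrow> j \<in> I \<Longrightarrow> k \<in> I \<Longrightarrow> j \<noteq> k \<Longrightarrow>
       dcoord lam I v j * dcoord lam I x k \<noteq> dcoord lam I v k * dcoord lam I x j"
  shows "lawrence_sum w lam c v = lawrence_sum w lam c x"
proof -
  define n where "n = DIM('a)"
  \<comment> \<open>The coordinates of \<open>v\<close> in the family formed by \<open>x\<close> and
    the wall are chosen from \<open>M\<close> alone, without reference to a simplex containing it;
    this makes \<open>G\<close> a function of walls.\<close>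
  define co where "co M = (SOME tb. v = fst tb *\<^sub>R x + (\<Sum>j\<in>M. snd tb j *\<^sub>R lam j))" for M
  define G where "G M = (\<Sum>j\<in>M. vec_nth c j * snd (co M) j) ^ n /
    (abs_det_insert lam x M * fst (co M) * (\<Prod>j\<in>M. snd (co M) j))" for M
  have G: "G (I - {k}) = (\<Sum>j\<in>I. vec_nth c j * (dcoord lam I v j - t * dcoord lam I x j)) ^ n /
      (\<bar>dcoord lam I x k\<bar> * abs_det lam I * t * (\<Prod>j\<in>I - {k}. dcoord lam I v j - t * dcoord lam I x j))"
    if I: "I \<in> tops w lam" and k: "k \<in> I" and t: "t = dcoord lam I v k / dcoord lam I x k" for I k t
  proof -
    note b = top_basis_on[OF fan I]
    have e: "dcoord lam I x k \<noteq> 0" using gen(2) I k by (simp add: mf_generic_def)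
    note ex = exchange_coordinates[OF b k e, of v]
    have "\<exists>tb. v = fst tb *\<^sub>R x + (\<Sum>j\<in>I - {k}. snd tb j *\<^sub>R lam j)"
      unfolding ex by (intro exI[of _ "(t, \<lambda>j. dcoord lam I v j - t * dcoord lam I x j)"]) (simp add: t)
    from someI_ex[OF this] have "v = fst (co (I - {k})) *\<^sub>R x + (\<Sum>j\<in>I - {k}. snd (co (I - {k})) j *\<^sub>R lam j)"
      unfolding co_def .
    then have tb: "fst (co (I - {k})) = t" "\<And>j. j \<in> I - {k} \<Longrightarrow> snd (co (I - {k})) j = dcoord lam I v j - t * dcoord lam I x j"
      unfolding ex t by simp_all
    have fin: "finite I" by simp
    \<comment> \<open>The term of \<open>k\<close> is 0 by the choice of \<open>t\<close>, so the
      sum runs over the wall.\<close>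
    have "(\<Sum>j\<in>I. vec_nth c j * (dcoord lam I v j - t * dcoord lam I x j)) =
        (\<Sum>j\<in>I - {k}. vec_nth c j * (dcoord lam I v j - t * dcoord lam I x j))"
      unfolding sum.remove[OF fin k] using e by (simp add: t)
    then show ?thesis
      unfolding G_def by (simp add: tb abs_det_insert_eq[OF b k])
  qed
  have "w I * (\<Sum>i\<in>I. vec_nth c i * dcoord lam I v i) ^ n / (abs_det lam I * (\<Prod>i\<in>I. dcoord lam I v i)) =
      w I * (\<Sum>i\<in>I. vec_nth c i * dcoord lam I x i) ^ n / (abs_det lam I * (\<Prod>i\<in>I. dcoord lam I x i)) +
      w I * (\<Sum>k\<in>I. sgn (dcoord lam I x k) * G (I - {k}))" if I: "I \<in> tops w lam" for I
  proof -
    note b = top_basis_on[OF fan I]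
    let ?a = "dcoord lam I v" and ?e = "dcoord lam I x"
    let ?A = "\<Sum>i\<in>I. vec_nth c i * ?a i" and ?E = "\<Sum>i\<in>I. vec_nth c i * ?e i"
    have n: "card I = n" using basis_on_card[OF b] by (simp add: n_def)
    have a: "?a i \<noteq> 0" and e: "?e i \<noteq> 0" if "i \<in> I" for i
      using gen I that by (simp_all add: mf_generic_def)
    have k: "(?A - ?a k / ?e k * ?E) ^ n / (?a k / ?e k * ?e k * (\<Prod>j\<in>I - {k}. ?a j - ?a k / ?e k * ?e j)) =
       abs_det lam I * (sgn (?e k) * G (I - {k}))" if k: "k \<in> I" for k
    proof -
      have A: "?A - ?a k / ?e k * ?E = (\<Sum>j\<in>I. vec_nth c j * (?a j - ?a k / ?e k * ?e j))"
        by (simp add: right_diff_distrib sum_subtractf sum_distrib_left mult.left_commute)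
      have cancel: "Y / (t * u * Q) = d * (sgn u * (Y / (\<bar>u\<bar> * d * t * Q)))" if "u \<noteq> 0" "d \<noteq> 0" for Y t u Q d :: real
        using that by (simp add: sgn_if)
      show ?thesis
        unfolding A G[OF I k refl] using e[OF k] abs_det_pos[OF b] by (intro cancel) auto
    qed
    have pf: "?A ^ n / (\<Prod>i\<in>I. ?a i) = ?E ^ n / (\<Prod>i\<in>I. ?e i) + abs_det lam I * (\<Sum>k\<in>I. sgn (?e k) * G (I - {k}))"
      using partial_fraction_identity[of I ?a ?e ?A ?E] a e cross[OF I] k
      by (simp add: n sum_distrib_left)
    have comb: "w I * Y / (d * P) = w I * Z / (d * Q) + w I * S"
      if "Y / P = Z / Q + d * S" "d \<noteq> 0" for Y P Z Q d S :: real
    proof -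
      have "w I * Y / (d * P) = w I * (Y / P) / d" by simp
      also have "\<dots> = w I * Z / (d * Q) + w I * S"
        unfolding that(1) using that(2) by (simp add: field_simps)
      finally show ?thesis .
    qed
    show ?thesis
      by (rule comb[OF pf]) (use abs_det_pos[OF b] in simp)
  qed
  then have "lawrence_sum w lam c v = lawrence_sum w lam c x +
      (\<Sum>I\<in>tops w lam. w I * (\<Sum>k\<in>I. sgn (dcoord lam I x k) * G (I - {k})))"
    by (simp add: lawrence_sum_def n_def sum.distrib)
  then show ?thesis
    using cycle_sum_eq_0[OF bs fan, of x G] by simp
qed

text \<open>With \<open>r\<close> and \<open>s\<close> the coordinates of \<open>v\<close>, this
  vector is the normal of the hyperplane of those \<open>x\<close> for which two poles collide;
  being nonzero, it can be avoided.\<close>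

lemma dual_vec_combination_nonzero:
  assumes I: "basis_on lam I" and jk: "j \<in> I" "k \<in> I" "j \<noteq> k" and r: "r \<noteq> 0"
  shows "r *\<^sub>R dvec lam I k - s *\<^sub>R dvec lam I j \<noteq> 0"
proof
  assume "r *\<^sub>R dvec lam I k - s *\<^sub>R dvec lam I j = 0"
  then have "(r *\<^sub>R dvec lam I k - s *\<^sub>R dvec lam I j) \<bullet> lam k = 0" by simp
  then show False
    using inner_dual_vec[OF I jk(2) jk(2)] inner_dual_vec[OF I jk(1) jk(2)] jk(3) r
    by (simp add: inner_diff_left)
qed

lemma exists_generic_avoiding:
  assumes fan: "complete_multi_fan bs w lam" and Q: "finite Q" "0 \<notin> Q"
  shows "\<exists>v. generic w lam v \<and> (\<forall>q\<in>Q. q \<bullet> v \<noteq> 0)"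
proof -
  let ?D = "(\<lambda>(I, i). dvec lam I i) ` Sigma (tops w lam) (\<lambda>I. I)"
  have "\<exists>v\<in>UNIV. \<forall>q\<in>?D \<union> Q. q \<bullet> v \<noteq> 0"
  proof (rule exists_nonorthogonal)
    fix q assume "q \<in> ?D \<union> Q"
    then have "q \<noteq> 0" using Q dual_vec_nonzero top_basis_on[OF fan] by fastforce
    then show "\<exists>s\<in>UNIV. q \<bullet> s \<noteq> 0" by (intro bexI[of _ q]) auto
  qed (use Q in auto)
  then show ?thesis by (fastforce simp: mf_generic_def)
qed

text \<open>The poles may collide for two given generic vectors. Both are therefore compared with a
  third one, chosen off the finitely many hyperplanes on which it would collide with either.\<close>

theorem lawrence_sum_const:
  assumes bs: "ordered_basis bs" and fan: "complete_multi_fan bs w lam"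
    and v: "generic w lam v" and x: "generic w lam x"
  shows "lawrence_sum w lam c v = lawrence_sum w lam c x"
proof -
  define Q where "Q y = (\<lambda>(I, j, k). dcoord lam I y j *\<^sub>R dvec lam I k - dcoord lam I y k *\<^sub>R dvec lam I j) `
     {(I, j, k). I \<in> tops w lam \<and> j \<in> I \<and> k \<in> I \<and> j \<noteq> k}" for y
  have Q0: "0 \<notin> Q y" if "generic w lam y" for y
  proof
    assume "0 \<in> Q y"
    then obtain I j k where *: "I \<in> tops w lam" "j \<in> I" "k \<in> I" "j \<noteq> k"
      "0 = dcoord lam I y j *\<^sub>R dvec lam I k - dcoord lam I y k *\<^sub>R dvec lam I j"
      by (auto simp: Q_def)
    moreover have "dcoord lam I y j \<noteq> 0" using that * by (simp add: mf_generic_def)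
    ultimately show False
      using dual_vec_combination_nonzero[OF top_basis_on[OF fan *(1)] *(2,3,4)] by metis
  qed
  have "finite (Q v \<union> Q x)" "0 \<notin> Q v \<union> Q x"
    using Q0[OF v] Q0[OF x] by (simp_all add: Q_def)
  from exists_generic_avoiding[OF fan this] obtain y where
    y: "generic w lam y" "\<forall>q\<in>Q v \<union> Q x. q \<bullet> y \<noteq> 0" by auto
  have cross: "dcoord lam I z j * dcoord lam I y k \<noteq> dcoord lam I z k * dcoord lam I y j"
    if "Q z \<subseteq> Q v \<union> Q x" "I \<in> tops w lam" "j \<in> I" "k \<in> I" "j \<noteq> k" for z I j k
  proof -
    have "dcoord lam I z j *\<^sub>R dvec lam I k - dcoord lam I z k *\<^sub>R dvec lam I j \<in> Q z"
      using that(2-) unfolding Q_def by (intro image_eqI[of _ _ "(I, j, k)"]) auto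
    then have "(dcoord lam I z j *\<^sub>R dvec lam I k - dcoord lam I z k *\<^sub>R dvec lam I j) \<bullet> y \<noteq> 0"
      using y(2) that(1) by blast
    then show ?thesis by (simp add: inner_diff_left)
  qed
  have "lawrence_sum w lam c v = lawrence_sum w lam c y"
    by (rule lawrence_sum_eq_if_cross_generic[OF bs fan v y(1) cross]) auto
  moreover have "lawrence_sum w lam c x = lawrence_sum w lam c y"
    by (rule lawrence_sum_eq_if_cross_generic[OF bs fan x y(1) cross]) auto
  ultimately show ?thesis by simp
qed

section \<open>Coefficients of the volume polynomial\<close>

definition coord_vec :: "('m::finite \<Rightarrow> 'a::euclidean_space) \<Rightarrow> 'm set \<Rightarrow> 'a \<Rightarrow> real ^ 'm" where
  "coord_vec lam I v = (\<chi> i. if i \<in> I then dcoord lam I v i else 0)"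

lemma sum_coord_vec: "(\<Sum>i\<in>UNIV. vec_nth (coord_vec lam I v) i * f i) = (\<Sum>i\<in>I. f i * dcoord lam I v i)"
proof -
  have "(\<Sum>i\<in>UNIV. vec_nth (coord_vec lam I v) i * f i) = (\<Sum>i\<in>UNIV. if i \<in> I then f i * dcoord lam I v i else 0)"
    by (rule sum.cong) (simp_all add: coord_vec_def)
  then show ?thesis
    using sum.inter_restrict[of UNIV "\<lambda>i. f i * dcoord lam I v i" I] by simp
qed

text \<open>The value is the pairing of the vertex with \<open>v\<close>, seen as a linear form in
  the support parameters.\<close>

lemma inner_coord_vec: "coord_vec lam I v \<bullet> c = (\<Sum>i\<in>I. vec_nth c i * dcoord lam I v i)"
  unfolding inner_vec_def inner_real_def by (rule sum_coord_vec)

lemma exists_generic: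
  assumes "complete_multi_fan bs w lam"
  shows "\<exists>v. generic w lam v"
  using exists_generic_avoiding[OF assms, of "{}"] by auto

lemma mf_integral_linear_form_power:
  fixes lam :: "'m::{finite,linorder} \<Rightarrow> 'a::euclidean_space"
  assumes bs: "ordered_basis bs" and fan: "complete_multi_fan bs w lam"
    and v: "generic w lam v"
  shows "mf_integral w lam (linear_form c ^ DIM('a)) = lawrence_sum w lam c v"
proof -
  have "mf_iota lam I (linear_form c ^ DIM('a)) x = (\<Sum>i\<in>I. vec_nth c i * dcoord lam I x i) ^ DIM('a)" for I x
    using sum_coord_vec[of lam I x "vec_nth c"]
    by (simp add: mf_iota_def mv_eval_power mv_eval_linear_form coord_vec_def mult.commute)
  then have "mf_integral w lam (linear_form c ^ DIM('a)) =
      (THE r. \<forall>x. generic w lam x \<longrightarrow> lawrence_sum w lam c x = r)"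
    by (simp add: mf_integral_def lawrence_sum_def)
  also have "\<dots> = lawrence_sum w lam c v"
  proof (rule the_equality)
    show "\<forall>x. generic w lam x \<longrightarrow> lawrence_sum w lam c x = lawrence_sum w lam c v"
      using lawrence_sum_const[OF bs fan _ v] by blast
  qed (use v in blast)
  finally show ?thesis .
qed

text \<open>The product omits \<open>i\<close>, so the expression still makes sense for vectors
  orthogonal to \<open>lam i\<close>, on which the dual vector of \<open>i\<close> may
  vanish.\<close>

definition facet_sum ::
  "('m::finite set \<Rightarrow> real) \<Rightarrow> ('m \<Rightarrow> 'a::euclidean_space) \<Rightarrow> real ^ 'm \<Rightarrow> 'm \<Rightarrow> 'a \<Rightarrow> real" where
  "facet_sum w lam c i v = (\<Sum>I\<in>star w lam i.
     w I * (\<Sum>j\<in>I. vec_nth c j * dcoord lam I v j) ^ (DIM('a) - 1) /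
     (abs_det lam I * (\<Prod>j\<in>I - {i}. dcoord lam I v j)))"

text \<open>For a fixed generic \<open>v\<close> the polynomial is an explicit combination of n-th
  powers of linear forms. The coefficients depend on \<open>v\<close>, the polynomial does not.
  \<open>mv_eval_inject\<close> gives the uniqueness that its definition by values requires.\<close>

lemma volume_poly_eq:
  fixes lam :: "'m::{finite,linorder} \<Rightarrow> 'a::euclidean_space"
  assumes bs: "ordered_basis bs" and fan: "complete_multi_fan bs w lam"
    and v: "generic w lam v"
  shows "volume_poly w lam = (\<Sum>I\<in>tops w lam.
     single 0 (w I / (fact (DIM('a)) * (abs_det lam I * (\<Prod>i\<in>I. dcoord lam I v i)))) *
     linear_form (coord_vec lam I v) ^ DIM('a))" (is "_ = ?p")
proof -
  have ev: "mv_eval (vec_nth c) ?p = 1 / fact (DIM('a)) * mf_integral w lam (linear_form c ^ DIM('a))"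
    for c :: "real ^ 'm::{finite,linorder}"
    unfolding mf_integral_linear_form_power[OF bs fan v] lawrence_sum_def sum_distrib_left mv_eval_sum
    by (rule sum.cong) (simp_all add: mv_eval_mult mv_eval_single mv_eval_power mv_eval_linear_form sum_coord_vec)
  show ?thesis
    unfolding volume_poly_def
  proof (rule the_equality)
    fix q assume "\<forall>c :: real ^ 'm::{finite,linorder}. mv_eval (vec_nth c) q = 1 / fact (DIM('a)) * mf_integral w lam (linear_form c ^ DIM('a))"
    then show "q = ?p" using ev by (intro mv_eval_inject) simp
  qed (use ev in blast)
qed

text \<open>Differentiating \<open>n - 1\<close> times along \<open>c\<close> turns the n-th power
  of a linear form \<open>L\<close> into \<open>n! L(c)\<^sup>n\<^sup>-\<^sup>1 L\<close>. The i-th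
  coefficient of \<open>L\<close> cancels one factor of the denominator and is 0 unless
  \<open>i \<in> I\<close>. Since the left-hand side does not mention \<open>v\<close>,
  \<open>facet_sum\<close> is the same for all generic vectors.\<close>

theorem eta_eq_facet_sum:
  fixes lam :: "'m::{finite,linorder} \<Rightarrow> 'a::euclidean_space"
  assumes bs: "ordered_basis bs" and fan: "complete_multi_fan bs w lam"
    and v: "generic w lam v"
  shows "eta w lam (partial_P w lam c [^]\<^bsub>mf_algebra w lam\<^esub> (DIM('a) - 1)) = (\<chi> i. facet_sum w lam c i v)"
proof (rule eta_partial_P_power)
  define n where "n = DIM('a)"
  have n: "n = (n - 1) + 1" by (simp add: n_def Suc_le_eq)
  define \<kappa> where "\<kappa> I = w I / (fact n * (abs_det lam I * (\<Prod>i\<in>I. dcoord lam I v i)))" for I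
  let ?\<mu> = "\<lambda>I. \<kappa> I * (fact n * (coord_vec lam I v \<bullet> c) ^ (n - 1))"
  have "diff_op (linear_form c ^ (n - 1)) (volume_poly w lam) =
      (\<Sum>I\<in>tops w lam. single 0 (\<kappa> I) *
        diff_op (linear_form c ^ (n - 1)) (linear_form (coord_vec lam I v) ^ n))"
    by (simp add: volume_poly_eq[OF bs fan v] diff_op_sum_right diff_op_const_right \<kappa>_def n_def)
  also have "\<dots> = (\<Sum>I\<in>tops w lam.
      linear_form (?\<mu> I *\<^sub>R coord_vec lam I v))"
  proof (rule sum.cong)
    fix I
    have "diff_op (linear_form c ^ (n - 1)) (linear_form (coord_vec lam I v) ^ n) =
        single 0 (fact n * (coord_vec lam I v \<bullet> c) ^ (n - 1)) * linear_form (coord_vec lam I v)"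
      using diff_op_power_linear_form_power[of c "n - 1" "coord_vec lam I v" 1] n by simp
    then show "single 0 (\<kappa> I) *
        diff_op (linear_form c ^ (n - 1)) (linear_form (coord_vec lam I v) ^ n) =
      linear_form (?\<mu> I *\<^sub>R coord_vec lam I v)"
      by (simp add: linear_form_scaleR mult_single flip: mult.assoc)
  qed simp
  also have "\<dots> = linear_form (\<Sum>I\<in>tops w lam.
      ?\<mu> I *\<^sub>R coord_vec lam I v)"
    by (rule linear_form_sum[symmetric])
  also have "(\<Sum>I\<in>tops w lam. ?\<mu> I *\<^sub>R coord_vec lam I v) =
      (\<chi> i. facet_sum w lam c i v)"
  proof (unfold vec_eq_iff, rule allI)
    fix i
    have "(\<Sum>I\<in>tops w lam. ?\<mu> I * vec_nth (coord_vec lam I v) i) =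
        (\<Sum>I\<in>tops w lam. if i \<in> I then w I * (\<Sum>j\<in>I. vec_nth c j * dcoord lam I v j) ^ (n - 1) /
          (abs_det lam I * (\<Prod>j\<in>I - {i}. dcoord lam I v j)) else 0)"
    proof (rule sum.cong)
      fix I assume I: "I \<in> tops w lam"
      show "?\<mu> I * vec_nth (coord_vec lam I v) i =
         (if i \<in> I then w I * (\<Sum>j\<in>I. vec_nth c j * dcoord lam I v j) ^ (n - 1) /
          (abs_det lam I * (\<Prod>j\<in>I - {i}. dcoord lam I v j)) else 0)"
      proof (cases "i \<in> I")
        case True
        have "dcoord lam I v i \<noteq> 0" using v I True by (simp add: mf_generic_def)
        moreover have "vec_nth (coord_vec lam I v) i = dcoord lam I v i"
          using True by (simp add: coord_vec_def)
        ultimately show ?thesis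
          using True by (simp add: \<kappa>_def inner_coord_vec prod.remove[of I i])
      qed (simp add: coord_vec_def)
    qed simp
    also have "\<dots> = facet_sum w lam c i v"
      unfolding facet_sum_def by (subst sum.inter_filter[symmetric]) (simp_all add: n_def)
    finally show "vec_nth (\<Sum>I\<in>tops w lam. ?\<mu> I *\<^sub>R coord_vec lam I v) i =
        vec_nth (\<chi> i. facet_sum w lam c i v) i"
      by simp
  qed
  finally show "diff_op (linear_form c ^ (DIM('a) - 1)) (volume_poly w lam) = linear_form (\<chi> i. facet_sum w lam c i v)"
    by (simp add: n_def)
qed

section \<open>Facets of multi-polytopes\<close>

definition mf_vertex :: "('m::finite \<Rightarrow> 'a::euclidean_space) \<Rightarrow> real ^ 'm \<Rightarrow> 'm set \<Rightarrow> 'a" where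
  "mf_vertex lam c I = (\<Sum>j\<in>I. vec_nth c j *\<^sub>R dvec lam I j)"

lemma inner_mf_vertex:
  assumes I: "basis_on lam I" and k: "k \<in> I"
  shows "mf_vertex lam c I \<bullet> lam k = vec_nth c k"
proof -
  have "mf_vertex lam c I \<bullet> lam k = (\<Sum>j\<in>I. if j = k then vec_nth c k else 0)"
    unfolding mf_vertex_def inner_sum_left by (rule sum.cong) (auto simp: inner_dual_vec[OF I _ k])
  then show ?thesis using k by simp
qed

lemma mf_vertex_inner: "mf_vertex lam c I \<bullet> v = (\<Sum>j\<in>I. vec_nth c j * dcoord lam I v j)"
  by (simp add: mf_vertex_def inner_sum_left)

lemma direction_support_hyperplane:
  assumes "lam i \<noteq> 0"
  shows "direction (support_hyperplane lam c i) = {x. x \<bullet> lam i = 0}"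
proof (intro equalityI subsetI)
  fix x assume "x \<in> direction (support_hyperplane lam c i)"
  then show "x \<in> {x. x \<bullet> lam i = 0}"
    by (auto simp: direction_def support_hyperplane_def inner_diff_left)
next
  fix x assume x: "x \<in> {x. x \<bullet> lam i = 0}"
  \<comment> \<open>The foot of the perpendicular from the origin.\<close>
  let ?p = "(vec_nth c i / (lam i \<bullet> lam i)) *\<^sub>R lam i"
  have "?p \<in> support_hyperplane lam c i" "x + ?p \<in> support_hyperplane lam c i"
    using x assms by (auto simp: support_hyperplane_def inner_add_left)
  then show "x \<in> direction (support_hyperplane lam c i)"
    unfolding direction_def by (intro CollectI exI[of _ "x + ?p"] exI[of _ ?p]) simp
qed

lemma inner_orth_proj: "x \<bullet> l = 0 \<Longrightarrow> x \<bullet> orth_proj l y = x \<bullet> y"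
  by (simp add: orth_proj_def inner_diff_right)

abbreviation facet_lam :: "('m \<Rightarrow> 'a::euclidean_space) \<Rightarrow> 'm \<Rightarrow> 'm \<Rightarrow> 'a" where
  "facet_lam lam i \<equiv> \<lambda>j. orth_proj (lam i) (lam j)"

abbreviation facet_hyperplanes :: "('m::finite \<Rightarrow> 'a::euclidean_space) \<Rightarrow> real ^ 'm \<Rightarrow> 'm \<Rightarrow> 'm \<Rightarrow> 'a set" where
  "facet_hyperplanes lam c i \<equiv> \<lambda>j. support_hyperplane lam c i \<inter> support_hyperplane lam c j"

abbreviation facet_vertices :: "('m set \<Rightarrow> real) \<Rightarrow> ('m \<Rightarrow> 'a::euclidean_space) \<Rightarrow> 'm \<Rightarrow> 'm set" where
  "facet_vertices w lam i \<equiv> {j. j \<noteq> i \<and> {i, j} \<in> mf_complex TYPE('a) w}"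

lemma facet_tops:
  fixes lam :: "'m::finite \<Rightarrow> 'a::euclidean_space"
  assumes "lam i \<noteq> 0"
  shows "mf_tops {x. x \<bullet> lam i = 0} (facet_vertices w lam i) (\<lambda>J. w (insert i J)) =
    (\<lambda>I. I - {i}) ` star w lam i"
proof -
  have dim: "dim {x. x \<bullet> lam i = 0} = DIM('a) - 1"
    using dim_hyperplane[OF assms] by (simp add: inner_commute)
  show ?thesis
  proof (intro equalityI subsetI)
    fix J assume J: "J \<in> mf_tops {x. x \<bullet> lam i = 0} (facet_vertices w lam i) (\<lambda>J. w (insert i J))"
    then have "i \<notin> J" "card J = DIM('a) - 1" "w (insert i J) \<noteq> 0" by (auto simp: mf_tops_def dim)
    then have "insert i J \<in> tops w lam" by (simp add: mf_tops_def Suc_le_eq)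
    then show "J \<in> (\<lambda>I. I - {i}) ` star w lam i"
      using \<open>i \<notin> J\<close> by (intro image_eqI[of _ _ "insert i J"]) auto
  next
    fix J assume "J \<in> (\<lambda>I. I - {i}) ` star w lam i"
    then obtain I where I: "I \<in> tops w lam" "i \<in> I" "J = I - {i}" by auto
    then have "card J = DIM('a) - 1" "insert i J = I" "w I \<noteq> 0" by (auto simp: mf_tops_def)
    moreover have "J \<subseteq> facet_vertices w lam i"
      using I by (auto simp: mf_complex_def)
    ultimately show "J \<in> mf_tops {x. x \<bullet> lam i = 0} (facet_vertices w lam i) (\<lambda>J. w (insert i J))"
      by (simp add: mf_tops_def dim)
  qed
qed

text \<open>For \<open>j \<noteq> i\<close> the dual vector is orthogonal to \<open>lam i\<close>.
  Hence it lies in the direction of the facet, and its pairings do not change under the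
  projection.\<close>

lemma facet_dual_vec:
  assumes I: "basis_on lam I" and ij: "i \<in> I" "j \<in> I - {i}"
  shows "dual_vec {x. x \<bullet> lam i = 0} (facet_lam lam i) (I - {i}) j = dvec lam I j"
    (is "dual_vec ?E ?lam ?J j = _")
  unfolding dual_vec_def[of ?E]
proof (rule the_equality)
  have "dvec lam I j \<bullet> lam i = 0"
    using ij by (subst inner_dual_vec[OF I]) auto
  then show "dvec lam I j \<in> ?E \<and> (\<forall>k\<in>?J. dvec lam I j \<bullet> ?lam k = (if k = j then 1 else 0))"
    using ij by (simp add: inner_orth_proj inner_dual_vec[OF I])
next
  fix u assume u: "u \<in> ?E \<and> (\<forall>k\<in>?J. u \<bullet> ?lam k = (if k = j then 1 else 0))"
  show "u = dvec lam I j"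
  proof (rule eq_if_inner_basis_on[OF I])
    fix k assume "k \<in> I"
    then show "u \<bullet> lam k = dvec lam I j \<bullet> lam k"
      using u ij by (cases "k = i") (auto simp: inner_orth_proj inner_dual_vec[OF I])
  qed
qed

lemma facet_mp_vertex:
  assumes I: "basis_on lam I" and i: "i \<in> I"
  shows "mp_vertex (support_hyperplane lam c i) (facet_hyperplanes lam c i) (I - {i})
    = mf_vertex lam c I"
  unfolding mp_vertex_def
proof (rule the_equality)
  show "mf_vertex lam c I \<in> support_hyperplane lam c i \<and>
    (\<forall>j\<in>I - {i}. mf_vertex lam c I \<in> support_hyperplane lam c i \<inter> support_hyperplane lam c j)"
    using i by (simp add: support_hyperplane_def inner_mf_vertex[OF I])
next
  fix p assume p: "p \<in> support_hyperplane lam c i \<and>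
    (\<forall>j\<in>I - {i}. p \<in> support_hyperplane lam c i \<inter> support_hyperplane lam c j)"
  show "p = mf_vertex lam c I"
  proof (rule eq_if_inner_basis_on[OF I])
    fix k assume "k \<in> I"
    then show "p \<bullet> lam k = mf_vertex lam c I \<bullet> lam k"
      using p by (cases "k = i") (auto simp: support_hyperplane_def inner_mf_vertex[OF I])
  qed
qed

lemma convex_cone_hull_finite_image:
  fixes g :: "'i \<Rightarrow> 'a::euclidean_space"
  assumes "finite J"
  shows "convex_cone hull (g ` J) = {\<Sum>j\<in>J. t j *\<^sub>R g j | t. \<forall>j\<in>J. 0 \<le> t j}" (is "_ = ?R")
proof
  have sumI: "(\<Sum>j\<in>J. t j *\<^sub>R g j) \<in> ?R" if "\<forall>j\<in>J. 0 \<le> t j" for t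
    using that by blast
  have "convex_cone ?R"
    unfolding convex_cone_iff
  proof (intro conjI ballI allI impI)
    show "0 \<in> ?R" using sumI[of "\<lambda>_. 0"] by simp
    fix x assume "x \<in> ?R"
    then obtain t where t: "x = (\<Sum>j\<in>J. t j *\<^sub>R g j)" "\<forall>j\<in>J. 0 \<le> t j" by auto
    show "x + y \<in> ?R" if y: "y \<in> ?R" for y
    proof -
      obtain s where s: "y = (\<Sum>j\<in>J. s j *\<^sub>R g j)" "\<forall>j\<in>J. 0 \<le> s j" using y by auto
      show ?thesis
        using sumI[of "\<lambda>j. t j + s j"] t s by (simp add: scaleR_left_distrib sum.distrib)
    qed
    show "r *\<^sub>R x \<in> ?R" if "0 \<le> r" for r
      using sumI[of "\<lambda>j. r * t j"] t that by (simp add: scaleR_right.sum)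
  qed
  moreover have "g ` J \<subseteq> ?R"
  proof
    fix x assume "x \<in> g ` J"
    then obtain k where k: "k \<in> J" "x = g k" by auto
    have "(\<Sum>j\<in>J. (if j = k then 1 else 0) *\<^sub>R g j) = x"
      using k assms by (simp add: if_distrib[of "\<lambda>r. r *\<^sub>R _"] cong: if_cong)
    then show "x \<in> ?R" using sumI[of "\<lambda>j. if j = k then 1 else 0"] by simp
  qed
  ultimately show "convex_cone hull (g ` J) \<subseteq> ?R"
    by (intro hull_minimal)
  show "?R \<subseteq> convex_cone hull (g ` J)"
  proof
    fix x assume "x \<in> ?R"
    then obtain t where t: "x = (\<Sum>j\<in>J. t j *\<^sub>R g j)" "\<forall>j\<in>J. 0 \<le> t j" by auto
    have "(\<Sum>j\<in>S. t j *\<^sub>R g j) \<in> convex_cone hull (g ` J)" if "S \<subseteq> J" for S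
      using finite_subset[OF that assms] that
    proof (induction S)
      case empty
      then show ?case by (simp add: convex_cone_hull_contains_0)
    next
      case (insert k S)
      then show ?case
        using t(2) convex_cone_hull_add[of "t k *\<^sub>R g k" "g ` J"] convex_cone_hull_mul[of "g k" "g ` J" "t k"]
        by (simp add: hull_inc)
    qed
    then show "x \<in> convex_cone hull (g ` J)" using t(1) by blast
  qed
qed

text \<open>The dual vectors of \<open>j \<noteq> i\<close> are the edge directions at the vertex,
  and the coordinate of \<open>u\<close> along the j-th edge, measured from the vertex, is
  \<open>u \<bullet> lam j - c\<^sub>j\<close>. The product condition says that it is 0 or has the
  sign of the edge's pairing with \<open>v\<close>.\<close>

lemma mem_facet_mp_cone:
  assumes I: "basis_on lam I" and i: "i \<in> I" and v: "\<And>j. j \<in> I - {i} \<Longrightarrow> dcoord lam I v j \<noteq> 0"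
    and l: "lam i \<noteq> 0"
  shows "u \<in> mp_cone (support_hyperplane lam c i) (facet_lam lam i)
      (facet_hyperplanes lam c i) v (I - {i}) \<longleftrightarrow>
    u \<bullet> lam i = vec_nth c i \<and> (\<forall>j\<in>I - {i}. 0 \<le> dcoord lam I v j * (u \<bullet> lam j - vec_nth c j))"
    (is "_ \<longleftrightarrow> ?R")
proof -
  let ?J = "I - {i}" and ?p = "mf_vertex lam c I"
  define g where "g j = sgn (dcoord lam I v j) *\<^sub>R dvec lam I j" for j
  have img: "(\<lambda>j. sgn (dual_vec {x. x \<bullet> lam i = 0} (facet_lam lam i) ?J j \<bullet> v) *\<^sub>R
      dual_vec {x. x \<bullet> lam i = 0} (facet_lam lam i) ?J j) ` ?J = g ` ?J"
    by (rule image_cong) (simp_all add: facet_dual_vec[OF I i] g_def)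
  have "u \<in> mp_cone (support_hyperplane lam c i) (facet_lam lam i)
      (facet_hyperplanes lam c i) v ?J \<longleftrightarrow>
    u - ?p \<in> convex_cone hull (g ` ?J)"
    unfolding mp_cone_def facet_mp_vertex[OF I i] direction_support_hyperplane[of lam i c, OF l] img
    by (auto intro: image_eqI[of _ _ "u - ?p"])
  also have "\<dots> \<longleftrightarrow> ?R"
  proof
    assume "u - ?p \<in> convex_cone hull (g ` ?J)"
    then obtain t where t: "u - ?p = (\<Sum>j\<in>?J. t j *\<^sub>R g j)" "\<forall>j\<in>?J. 0 \<le> t j"
      by (auto simp: convex_cone_hull_finite_image)
    have k: "u \<bullet> lam k - vec_nth c k = (if k = i then 0 else t k * sgn (dcoord lam I v k))" if "k \<in> I" for k
    proof -
      have "u \<bullet> lam k - vec_nth c k = (u - ?p) \<bullet> lam k"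
        by (simp add: inner_diff_left inner_mf_vertex[OF I that])
      also have "\<dots> = (\<Sum>j\<in>?J. if j = k then t k * sgn (dcoord lam I v k) else 0)"
        unfolding t(1) inner_sum_left by (rule sum.cong) (auto simp: g_def inner_dual_vec[OF I _ that])
      finally show ?thesis using that by auto
    qed
    have "0 \<le> dcoord lam I v j * (t j * sgn (dcoord lam I v j))" if "j \<in> ?J" for j
      using t(2) that by (auto simp: sgn_if mult_nonpos_nonneg)
    then show ?R using k k[OF i] by auto
  next
    assume R: ?R
    have "u - ?p = (\<Sum>j\<in>I. (lam j \<bullet> (u - ?p)) *\<^sub>R dvec lam I j)"
      by (rule sum_inner_scaleR_dual_vec[OF I, symmetric])
    also have "\<dots> = (\<Sum>j\<in>?J. (lam j \<bullet> (u - ?p)) *\<^sub>R dvec lam I j)"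
      using R inner_mf_vertex[OF I i, of c] i
      by (intro sum.mono_neutral_right) (auto simp: inner_diff_right inner_commute)
    also have "\<dots> = (\<Sum>j\<in>?J. \<bar>u \<bullet> lam j - vec_nth c j\<bar> *\<^sub>R g j)"
    proof (rule sum.cong)
      fix j assume j: "j \<in> ?J"
      let ?r = "u \<bullet> lam j - vec_nth c j"
      have "lam j \<bullet> (u - ?p) = ?r"
        using inner_mf_vertex[OF I, of j c] j by (simp add: inner_diff_right inner_commute)
      moreover have "\<bar>?r\<bar> * sgn (dcoord lam I v j) = ?r"
        using R j v[OF j] by (auto simp: zero_le_mult_iff sgn_if abs_if dest: bspec[of _ _ j])
      ultimately show "(lam j \<bullet> (u - ?p)) *\<^sub>R dvec lam I j = \<bar>?r\<bar> *\<^sub>R g j"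
        by (simp add: g_def)
    qed simp
    finally show "u - ?p \<in> convex_cone hull (g ` ?J)"
      by (subst convex_cone_hull_finite_image) auto
  qed
  finally show ?thesis .
qed

text \<open>The segment \<open>{t > 0. \<forall>j. t e\<^sub>j < a\<^sub>j}\<close> is empty or has exactly one upper end, at some
  \<open>a\<^sub>k / e\<^sub>k\<close> with \<open>e\<^sub>k > 0\<close>, and exactly one lower end, at \<open>0\<close> or at some \<open>a\<^sub>k / e\<^sub>k\<close> with \<open>e\<^sub>k < 0\<close>.\<close>

lemma signed_count_segment_ends:
  fixes a e :: "'i \<Rightarrow> real"
  assumes J: "finite J" and a: "\<And>j. j \<in> J \<Longrightarrow> a j \<noteq> 0" and e: "\<And>j. j \<in> J \<Longrightarrow> e j \<noteq> 0"
    and ae: "\<And>j k. j \<in> J \<Longrightarrow> k \<in> J \<Longrightarrow> j \<noteq> k \<Longrightarrow> a j * e k \<noteq> a k * e j"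
    and ex: "\<exists>j\<in>J. e j > 0"
  shows "(\<Sum>k\<in>J. sgn (e k) * of_bool (a k / e k > 0 \<and> (\<forall>j\<in>J - {k}. a j - a k / e k * e j > 0))) =
    of_bool (\<forall>j\<in>J. a j > 0)"
proof -
  define t where "t k = a k / e k" for k
  have t_ne: "t j \<noteq> t k" if "j \<in> J" "k \<in> J" "j \<noteq> k" for j k
    using ae[OF that] e that by (auto simp: t_def frac_eq_eq)
  have t0: "t k \<noteq> 0" if "k \<in> J" for k using a e that by (simp add: t_def)
  let ?P = "{j \<in> J. e j > 0}" and ?N = "{j \<in> J. e j < 0}"
  have pos: "a j - s * e j > 0 \<longleftrightarrow> s < t j" if "j \<in> ?P" for j s
    using that by (auto simp: t_def pos_less_divide_eq)
  have neg: "a j - s * e j > 0 \<longleftrightarrow> t j < s" if "j \<in> ?N" for j s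
    using that by (auto simp: t_def neg_divide_less_eq)
  have split: "j \<in> ?P \<or> j \<in> ?N" if "j \<in> J" for j using e[OF that] that by auto
  define C where "C k \<longleftrightarrow> t k > 0 \<and> (\<forall>j\<in>J - {k}. a j - t k * e j > 0)" for k
  have C: "C k \<longleftrightarrow> t k > 0 \<and> (\<forall>j\<in>?P - {k}. t k < t j) \<and> (\<forall>j\<in>?N - {k}. t j < t k)" if "k \<in> J" for k
    unfolding C_def using pos neg split by blast
  have "finite ?P" "?P \<noteq> {}" using J ex by auto
  then obtain p where p: "p \<in> ?P" "\<forall>j\<in>?P. t p \<le> t j"
    using ex_is_arg_min_if_finite[of ?P t] by (force simp: is_arg_min_linorder)
  have p': "t p < t j" if "j \<in> ?P" "j \<noteq> p" for j
    using p that t_ne[of p j] by fastforce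
  have pos0: "a j > 0 \<longleftrightarrow> 0 < t j" if "j \<in> ?P" for j using pos[OF that, of 0] by simp
  have neg0: "a j > 0 \<longleftrightarrow> t j < 0" if "j \<in> ?N" for j using neg[OF that, of 0] by simp
  have allpos: "(\<forall>j\<in>J. a j > 0) \<longleftrightarrow> 0 < t p \<and> (\<forall>j\<in>?N. t j < 0)"
  proof
    assume "\<forall>j\<in>J. a j > 0"
    then show "0 < t p \<and> (\<forall>j\<in>?N. t j < 0)" using p(1) pos0 neg0 by blast
  next
    assume R: "0 < t p \<and> (\<forall>j\<in>?N. t j < 0)"
    show "\<forall>j\<in>J. a j > 0"
    proof
      fix j assume "j \<in> J"
      then consider "j \<in> ?P" | "j \<in> ?N" using split by blast
      then show "a j > 0"
      proof cases
        case 1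
        then have "0 < t j" using R p(2) by force
        then show ?thesis using pos0[OF 1] by simp
      next
        case 2
        then show ?thesis using neg0[OF 2] R by blast
      qed
    qed
  qed
  have Cp: "C k \<longleftrightarrow> k = p \<and> 0 < t p \<and> (\<forall>j\<in>?N. t j < t p)" if k: "k \<in> ?P" for k
  proof (cases "k = p")
    case True
    have "?N - {p} = ?N" using p(1) by auto
    then show ?thesis using C[of p] p(1) p' True by auto
  next
    case False
    then have "p \<in> ?P - {k}" "\<not> t k < t p" using p k by (auto simp: not_less)
    then show ?thesis using C[of k] k False by blast
  qed
  have "(\<Sum>k\<in>J. sgn (e k) * of_bool (C k)) = (\<Sum>k\<in>?P \<union> ?N. sgn (e k) * of_bool (C k))"
    using split by (intro sum.cong) auto
  also have "\<dots> = (\<Sum>k\<in>?P. sgn (e k) * of_bool (C k)) + (\<Sum>k\<in>?N. sgn (e k) * of_bool (C k))"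
    using J by (intro sum.union_disjoint) auto
  also have "(\<Sum>k\<in>?P. sgn (e k) * of_bool (C k)) = (\<Sum>k\<in>?P. if k = p then of_bool (0 < t p \<and> (\<forall>j\<in>?N. t j < t p)) else 0)"
    using Cp by (intro sum.cong) auto
  also have "\<dots> = of_bool (0 < t p \<and> (\<forall>j\<in>?N. t j < t p))"
    using p(1) \<open>finite ?P\<close> by simp
  also have "of_bool (0 < t p \<and> (\<forall>j\<in>?N. t j < t p)) + (\<Sum>k\<in>?N. sgn (e k) * of_bool (C k)) =
      (of_bool (\<forall>j\<in>J. a j > 0) :: real)"
  proof (cases "?N = {}")
    case True
    then show ?thesis unfolding allpos True by simp
  next
    case False
    have "finite ?N" using J by simp
    then obtain q where q: "q \<in> ?N" "\<forall>j\<in>?N. t j \<le> t q"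
      using ex_is_arg_min_if_finite[of ?N "\<lambda>j. - t j"] False by (force simp: is_arg_min_linorder)
    have q': "t j < t q" if "j \<in> ?N" "j \<noteq> q" for j
      using q that t_ne[of q j] by fastforce
    have Cq: "C k \<longleftrightarrow> k = q \<and> 0 < t q \<and> t q < t p" if k: "k \<in> ?N" for k
    proof (cases "k = q")
      case True
      have "?P - {q} = ?P" using q(1) by auto
      moreover have "(\<forall>j\<in>?P. t q < t j) \<longleftrightarrow> t q < t p" using p by force
      ultimately show ?thesis using C[of q] q(1) q' True by auto
    next
      case False
      then have "q \<in> ?N - {k}" "\<not> t q < t k" using q k by (auto simp: not_less)
      then show ?thesis using C[of k] k False by blast
    qed
    have "(\<Sum>k\<in>?N. sgn (e k) * of_bool (C k)) = (\<Sum>k\<in>?N. if k = q then - of_bool (0 < t q \<and> t q < t p) else 0)"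
      using Cq by (intro sum.cong) auto
    also have "\<dots> = - of_bool (0 < t q \<and> t q < t p)"
      using q(1) \<open>finite ?N\<close> by simp
    finally have s: "(\<Sum>k\<in>?N. sgn (e k) * of_bool (C k)) = - of_bool (0 < t q \<and> t q < t p)" .
    \<comment> \<open>What is left is the indicator of \<open>0 < t p \<and> t q < t p\<close> minus
      that of \<open>0 < t q \<and> t q < t p\<close>; as \<open>t q \<noteq> 0\<close>, this is 1
      if \<open>t q < 0 < t p\<close> and 0 otherwise.\<close>
    have "(\<forall>j\<in>?N. t j < r) \<longleftrightarrow> t q < r" for r using q by fastforce
    then show ?thesis
      unfolding s allpos using t0[of q] q(1) by auto
  qed
  finally show ?thesis by (simp add: C_def t_def)
qed

section \<open>The function DH of a facet\<close>

definition facet_cone ::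
  "('m::finite \<Rightarrow> 'a::euclidean_space) \<Rightarrow> real ^ 'm \<Rightarrow> 'm \<Rightarrow> 'a \<Rightarrow> 'm set \<Rightarrow> 'a set" where
  "facet_cone lam c i v I =
     {u. u \<bullet> lam i = vec_nth c i \<and> (\<forall>j\<in>I - {i}. 0 \<le> dcoord lam I v j * (u \<bullet> lam j - vec_nth c j))}"

text \<open>\<open>DH\<close> of the facet, with the sum reindexed by the maximal simplices that
  contain \<open>i\<close>; see \<open>DH_facet\<close>.\<close>

definition facet_density ::
  "('m::finite set \<Rightarrow> real) \<Rightarrow> ('m \<Rightarrow> 'a::euclidean_space) \<Rightarrow> real ^ 'm \<Rightarrow> 'm \<Rightarrow> 'a \<Rightarrow> 'a \<Rightarrow> real" where
  "facet_density w lam c i v u = (\<Sum>I\<in>star w lam i.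
     (-1) ^ card {j \<in> I - {i}. dcoord lam I v j > 0} * w I * indicator (facet_cone lam c i v I) u)"

definition facet_generic ::
  "('m::finite set \<Rightarrow> real) \<Rightarrow> ('m \<Rightarrow> 'a::euclidean_space) \<Rightarrow> 'm \<Rightarrow> 'a \<Rightarrow> bool" where
  "facet_generic w lam i v \<longleftrightarrow>
     v \<bullet> lam i = 0 \<and> (\<forall>I\<in>tops w lam. i \<in> I \<longrightarrow> (\<forall>j\<in>I - {i}. dcoord lam I v j \<noteq> 0))"

text \<open>An equivalence, because \<open>mp_volume\<close> picks its vector by \<open>SOME\<close>
  from the left-hand predicate, which is rewritten inside the choice.\<close>

lemma mf_generic_facet_iff:
  assumes fan: "complete_multi_fan bs w lam" and l: "lam i \<noteq> 0"
  shows "mf_generic {x. x \<bullet> lam i = 0} (facet_vertices w lam i) (\<lambda>J. w (insert i J))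
     (facet_lam lam i) v \<longleftrightarrow> facet_generic w lam i v"
  unfolding mf_generic_def facet_generic_def facet_tops[of lam i, OF l]
  using facet_dual_vec[OF top_basis_on[OF fan]] by (auto simp: ball_simps)

lemma DH_facet:
  assumes fan: "complete_multi_fan bs w lam" and l: "lam i \<noteq> 0" and v: "facet_generic w lam i v"
  shows "DH (support_hyperplane lam c i) (facet_vertices w lam i) (\<lambda>J. w (insert i J))
     (facet_lam lam i) (facet_hyperplanes lam c i) v u =
    facet_density w lam c i v u"
proof -
  have inj: "inj_on (\<lambda>I. I - {i}) (star w lam i)"
    by (rule inj_onI) (auto dest: arg_cong[of _ _ "insert i"] simp: insert_absorb)
  show ?thesis
    unfolding DH_def direction_support_hyperplane[of lam i c, OF l] facet_tops[of lam i, OF l]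
      sum.reindex[OF inj] facet_density_def comp_def
  proof (rule sum.cong)
    fix I assume "I \<in> star w lam i"
    then have I: "I \<in> tops w lam" "i \<in> I" by auto
    note b = top_basis_on[OF fan I(1)]
    have "{j \<in> I - {i}. dual_vec {x. x \<bullet> lam i = 0} (facet_lam lam i) (I - {i}) j \<bullet> v > 0}
       = {j \<in> I - {i}. dcoord lam I v j > 0}"
      using facet_dual_vec[OF b I(2)] by auto
    moreover have "u \<in> mp_cone (support_hyperplane lam c i) (facet_lam lam i)
      (facet_hyperplanes lam c i) v (I - {i}) \<longleftrightarrow> u \<in> facet_cone lam c i v I"
      using v I by (subst mem_facet_mp_cone[OF b I(2) _ l]) (auto simp: facet_generic_def facet_cone_def)
    moreover have "insert i (I - {i}) = I" using I by auto
    ultimately show "(- 1) ^ card {j \<in> I - {i}. 0 < dual_vec {x. x \<bullet> lam i = 0} (facet_lam lam i) (I - {i}) j \<bullet> v} *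
        w (insert i (I - {i})) *
        indicator (mp_cone (support_hyperplane lam c i) (facet_lam lam i)
          (facet_hyperplanes lam c i) v (I - {i})) u =
        (- 1) ^ card {j \<in> I - {i}. 0 < dcoord lam I v j} * w I * indicator (facet_cone lam c i v I) u"
      by (simp add: indicator_def)
  qed simp
qed

lemma neg_one_power_card_filter:
  "finite J \<Longrightarrow> (-1) ^ card {j \<in> J. P j} = (\<Prod>j\<in>J. if P j then -1 else 1 :: real)"
  by (subst prod.inter_filter[symmetric]) (simp_all add: prod_constant)

text \<open>Consider \<open>v - t u\<close>. The cone of \<open>I\<close> contains \<open>u\<close>
  exactly if at \<open>t = 0\<close> every coordinate \<open>j \<noteq> i\<close> has the sign
  \<open>s\<^sub>j\<close> of \<open>u \<bullet> lam j - c\<^sub>j\<close>. The segment of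
  \<open>t > 0\<close> with these signs is counted by its ends: an end at 0 corresponds to the
  indicator of the cone, the others belong to walls and cancel by \<open>cycle_sum_eq_0\<close> with
  apex \<open>u\<close>. That the segment is bounded above comes from \<open>far\<close>.\<close>

lemma facet_density_eq_0:
  fixes lam :: "'m::{finite,linorder} \<Rightarrow> 'a::euclidean_space"
  assumes bs: "ordered_basis bs" and fan: "complete_multi_fan bs w lam"
    and v: "facet_generic w lam i v" and u: "u \<bullet> lam i = vec_nth c i"
    and far: "\<And>I. I \<in> tops w lam \<Longrightarrow> i \<in> I \<Longrightarrow> norm u > norm (mf_vertex lam c I)"
    and h: "\<And>I j. I \<in> tops w lam \<Longrightarrow> i \<in> I \<Longrightarrow> j \<in> I - {i} \<Longrightarrow> u \<bullet> lam j \<noteq> vec_nth c j"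
    and e: "\<And>I j. I \<in> tops w lam \<Longrightarrow> i \<in> I \<Longrightarrow> j \<in> I - {i} \<Longrightarrow> dcoord lam I u j \<noteq> 0"
    and cross: "\<And>I j k. I \<in> tops w lam \<Longrightarrow> i \<in> I \<Longrightarrow> j \<in> I - {i} \<Longrightarrow> k \<in> I - {i} \<Longrightarrow> j \<noteq> k \<Longrightarrow>
       dcoord lam I v j * dcoord lam I u k \<noteq> dcoord lam I v k * dcoord lam I u j"
  shows "facet_density w lam c i v u = 0"
proof -
  define s where "s j = sgn (u \<bullet> lam j - vec_nth c j)" for j
  \<comment> \<open>\<open>v\<close> lies in the open cone on \<open>u\<close> and the vectors
    \<open>s\<^sub>j lam j\<close>, with free coordinate along \<open>lam i\<close>. For
    \<open>M = I - {k}\<close> this says that the segment of \<open>I\<close> has an end at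
    \<open>k\<close>, without mentioning \<open>I\<close>.\<close>
  define Q where "Q M \<longleftrightarrow> (\<exists>t b. v = t *\<^sub>R u + (\<Sum>j\<in>M. b j *\<^sub>R lam j) \<and> t > 0 \<and> (\<forall>j\<in>M - {i}. b j * s j > 0))" for M
  \<comment> \<open>The factor for \<open>i \<in> M\<close> removes the terms \<open>k = i\<close>
    and all simplices without \<open>i\<close>, so that the cycle identity over all maximal
    simplices can be used.\<close>
  define G where "G M = of_bool (i \<in> M) * ((\<Prod>j\<in>M - {i}. s j) * of_bool (Q M))" for M
  have summand: "(-1) ^ card {j \<in> I - {i}. dcoord lam I v j > 0} * w I * indicator (facet_cone lam c i v I) u =
      (-1) ^ (DIM('a) - 1) * (w I * (\<Sum>k\<in>I. sgn (dcoord lam I u k) * G (I - {k})))"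
    if I: "I \<in> tops w lam" and i: "i \<in> I" for I
  proof -
    note b = top_basis_on[OF fan I]
    let ?J = "I - {i}" and ?a = "dcoord lam I v" and ?e = "dcoord lam I u"
    have s: "s j = 1 \<or> s j = -1" if "j \<in> ?J" for j
      using h[OF I i that] by (auto simp: s_def sgn_if)
    have s0: "s j \<noteq> 0" if "j \<in> ?J" for j using s[OF that] by auto
    have a0: "?a j \<noteq> 0" if "j \<in> ?J" for j using v I i that by (simp add: facet_generic_def)
    \<comment> \<open>Otherwise all products
      \<open>e\<^sub>j (u \<bullet> lam j - c\<^sub>j)\<close> are at most 0. They sum up to the
      pairing of \<open>u\<close> with its difference from the vertex, so \<open>norm u\<close>
      could not exceed the norm of the vertex.\<close>
    have exp: "\<exists>j\<in>?J. ?e j * s j > 0"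
    proof (rule ccontr)
      let ?p = "mf_vertex lam c I"
      assume "\<not> (\<exists>j\<in>?J. ?e j * s j > 0)"
      then have le': "?e j * s j \<le> 0" if "j \<in> ?J" for j using that by force
      have le: "?e j * (u \<bullet> lam j - vec_nth c j) \<le> 0" if j: "j \<in> ?J" for j
      proof -
        have "?e j * (u \<bullet> lam j - vec_nth c j) = (?e j * s j) * \<bar>u \<bullet> lam j - vec_nth c j\<bar>"
          unfolding s_def mult.assoc sgn_mult_abs ..
        then show ?thesis using mult_nonpos_nonneg[OF le'[OF j] abs_ge_zero] by (simp only:)
      qed
      have "u - ?p = (\<Sum>j\<in>I. (lam j \<bullet> (u - ?p)) *\<^sub>R dvec lam I j)"
        by (rule sum_inner_scaleR_dual_vec[OF b, symmetric])
      also have "\<dots> = (\<Sum>j\<in>I. (u \<bullet> lam j - vec_nth c j) *\<^sub>R dvec lam I j)"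
        by (rule sum.cong) (simp_all add: inner_commute[of "lam _"] inner_diff_left inner_mf_vertex[OF b])
      finally have "u \<bullet> (u - ?p) = u \<bullet> (\<Sum>j\<in>I. (u \<bullet> lam j - vec_nth c j) *\<^sub>R dvec lam I j)"
        by simp
      also have "\<dots> = (\<Sum>j\<in>I. ?e j * (u \<bullet> lam j - vec_nth c j))"
        by (simp add: inner_sum_right inner_commute mult.commute)
      also have "\<dots> \<le> 0"
      proof (rule sum_nonpos)
        fix j assume "j \<in> I"
        then show "?e j * (u \<bullet> lam j - vec_nth c j) \<le> 0"
          using le u by (cases "j = i") auto
      qed
      finally have "u \<bullet> u \<le> u \<bullet> ?p" by (simp add: inner_diff_right)
      also have "\<dots> \<le> norm u * norm ?p" by (rule norm_cauchy_schwarz)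
      finally have "norm u * norm u \<le> norm u * norm ?p" by (simp add: dot_square_norm power2_eq_square)
      moreover have "norm u > norm ?p" using far[OF I i] .
      moreover have "norm u > 0" using \<open>norm u > norm ?p\<close> norm_ge_zero[of ?p] by linarith
      ultimately show False by simp
    qed
    let ?B = "\<lambda>k. (?a k * s k) / (?e k * s k) > 0 \<and>
        (\<forall>j\<in>?J - {k}. ?a j * s j - (?a k * s k) / (?e k * s k) * (?e j * s j) > 0)"
    have QJ: "Q (I - {k}) \<longleftrightarrow> ?B k" if k: "k \<in> ?J" for k
    proof -
      have kI: "k \<in> I" using k by simp
      note exch = exchange_coordinates[OF b kI e[OF I i k], of v]
      let ?t = "?a k / ?e k"
      have t: "(?a k * s k) / (?e k * s k) = ?t" using s0[OF k] by simp
      have "Q (I - {k}) \<longleftrightarrow> ?t > 0 \<and> (\<forall>j\<in>?J - {k}. (?a j - ?t * ?e j) * s j > 0)"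
      proof
        assume "Q (I - {k})"
        then obtain t b where "t = ?t" "\<forall>j\<in>I - {k}. b j = ?a j - t * ?e j" "t > 0" "\<forall>j\<in>I - {k} - {i}. b j * s j > 0"
          unfolding Q_def exch by auto
        then show "?t > 0 \<and> (\<forall>j\<in>?J - {k}. (?a j - ?t * ?e j) * s j > 0)" by auto
      next
        assume R: "?t > 0 \<and> (\<forall>j\<in>?J - {k}. (?a j - ?t * ?e j) * s j > 0)"
        show "Q (I - {k})" unfolding Q_def exch
          by (rule exI[of _ ?t], rule exI[of _ "\<lambda>j. ?a j - ?t * ?e j"]) (use R in auto)
      qed
      then show ?thesis unfolding t by (simp add: algebra_simps)
    qed
    have "(\<Sum>k\<in>I. sgn (?e k) * G (I - {k})) = (\<Sum>k\<in>?J. sgn (?e k) * G (I - {k}))"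
      using i by (simp add: sum.remove[of I i] G_def)
    also have "\<dots> = (\<Sum>k\<in>?J. (\<Prod>j\<in>?J. s j) * (sgn (?e k * s k) * of_bool (?B k)))"
    proof (rule sum.cong)
      fix k assume k: "k \<in> ?J"
      have alg: "x * (1 * (P * B)) = (r * P) * ((x * q) * B)" if "q * r = 1" for x P B r q :: real
      proof -
        have "x * (1 * (P * B)) = (q * r) * (x * (P * B))" unfolding that by (simp only: mult_1)
        also have "\<dots> = (r * P) * ((x * q) * B)" by (simp only: mult_ac)
        finally show ?thesis .
      qed
      have ik: "of_bool (i \<in> I - {k}) = (1 :: real)" using i k by auto
      have set: "I - {k} - {i} = ?J - {k}" by auto
      have prod: "(\<Prod>j\<in>?J. s j) = s k * (\<Prod>j\<in>?J - {k}. s j)" using k by (intro prod.remove) auto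
      have s1: "sgn (s k) * s k = 1" using s[OF k] by auto
      show "sgn (?e k) * G (I - {k}) = (\<Prod>j\<in>?J. s j) * (sgn (?e k * s k) * of_bool (?B k))"
        unfolding G_def QJ[OF k] ik set prod sgn_mult by (rule alg[OF s1])
    qed simp
    also have "\<dots> = (\<Prod>j\<in>?J. s j) * of_bool (\<forall>j\<in>?J. ?a j * s j > 0)"
      unfolding sum_distrib_left[symmetric]
    proof (subst signed_count_segment_ends)
      fix j k assume "j \<in> ?J" "k \<in> ?J" "j \<noteq> k"
      then show "?a j * s j * (?e k * s k) \<noteq> ?a k * s k * (?e j * s j)"
        using cross[OF I i, of j k] s0 by (simp add: mult_ac)
    qed (use a0 s0 e[OF I i] exp in auto)
    finally have sum: "(\<Sum>k\<in>I. sgn (?e k) * G (I - {k})) = (\<Prod>j\<in>?J. s j) * of_bool (\<forall>j\<in>?J. ?a j * s j > 0)" .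
    have cone: "u \<in> facet_cone lam c i v I \<longleftrightarrow> (\<forall>j\<in>?J. ?a j * s j > 0)"
    proof -
      have "0 \<le> ?a j * (u \<bullet> lam j - vec_nth c j) \<longleftrightarrow> ?a j * s j > 0" if "j \<in> ?J" for j
        using a0[OF that] h[OF I i that]
        by (auto simp: s_def sgn_if zero_le_mult_iff)
      then show ?thesis using u by (auto simp: facet_cone_def)
    qed
    \<comment> \<open>On the cone \<open>a\<^sub>j\<close> has the sign \<open>s\<^sub>j\<close>, so
      the sign of the cone in \<open>DH\<close> is the product of the \<open>s\<^sub>j\<close> up to
      a factor depending only on the dimension.\<close>
    have "(-1) ^ card {j \<in> ?J. ?a j > 0} = (-1) ^ card ?J * (\<Prod>j\<in>?J. s j)" if "\<forall>j\<in>?J. ?a j * s j > 0"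
    proof -
      have "(-1) ^ card {j \<in> ?J. ?a j > 0} = (\<Prod>j\<in>?J. if ?a j > 0 then -1 else 1 :: real)"
        by (rule neg_one_power_card_filter) simp
      also have "\<dots> = (\<Prod>j\<in>?J. - s j)"
      proof (rule prod.cong)
        fix j assume j: "j \<in> ?J"
        then have "?a j * s j > 0" using that by blast
        then show "(if ?a j > 0 then -1 else 1) = - s j"
          using s[OF j] by auto
      qed simp
      finally show ?thesis by (simp add: prod_uminus)
    qed
    moreover have "card ?J = DIM('a) - 1" using i basis_on_card[OF b] by simp
    ultimately show ?thesis
      unfolding sum by (auto simp: cone indicator_def)
  qed
  have "facet_density w lam c i v u = (\<Sum>I\<in>star w lam i.
      (-1) ^ (DIM('a) - 1) * (w I * (\<Sum>k\<in>I. sgn (dcoord lam I u k) * G (I - {k}))))"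
    unfolding facet_density_def by (rule sum.cong) (use summand in auto)
  also have "\<dots> = (\<Sum>I\<in>tops w lam. (-1) ^ (DIM('a) - 1) * (w I * (\<Sum>k\<in>I. sgn (dcoord lam I u k) * G (I - {k}))))"
    by (rule sum.mono_neutral_left) (auto simp: G_def)
  also have "\<dots> = 0"
    unfolding sum_distrib_left[symmetric] cycle_sum_eq_0[OF bs fan] by simp
  finally show ?thesis .
qed

section \<open>Lebesgue measure on a hyperplane\<close>

lemma inner_orthonormal_sum:
  assumes "finite B" "pairwise Linear_Algebra.orthogonal B" "\<And>b. b \<in> B \<Longrightarrow> norm b = 1" "c \<in> B"
  shows "(\<Sum>b\<in>B. t b *\<^sub>R b) \<bullet> c = t c"
proof -
  have "(\<Sum>b\<in>B. t b *\<^sub>R b) \<bullet> c = (\<Sum>b\<in>B. if b = c then t c else 0)"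
    unfolding inner_sum_left
    by (rule sum.cong) (use assms in \<open>auto simp: pairwise_def Linear_Algebra.orthogonal_def dot_square_norm\<close>)
  then show ?thesis using assms by simp
qed

text \<open>An orthonormal basis is its own dual, so its frame determinant is 1 or -1 and passing to
  its coordinates preserves volume.\<close>

lemma PiM_lborel_orthonormal_basis:
  fixes C :: "'a::euclidean_space set"
  assumes C: "finite C" "pairwise Linear_Algebra.orthogonal C" "\<And>b. b \<in> C \<Longrightarrow> norm b = 1" "span C = UNIV"
  shows "(\<Pi>\<^sub>M b\<in>C. (lborel :: real measure)) = distr lborel (\<Pi>\<^sub>M b\<in>C. lborel) (\<lambda>x. \<lambda>b\<in>C. x \<bullet> b)"
    (is "_ = ?D")
proof -
  interpret product_sigma_finite "\<lambda>_ :: 'a. lborel :: real measure"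
    by standard
  have "0 \<notin> C" using C(3) by fastforce
  then have "basis_on id C"
    using C pairwise_orthogonal_independent[OF C(2)] by (simp add: basis_on_def)
  then obtain f where f: "bij_betw f (Basis :: 'a set) C" by (rule exists_bij_Basis)
  have inn: "b \<bullet> c = (if b = c then 1 else 0)" if "b \<in> C" "c \<in> C" for b c
    using C that by (auto simp: pairwise_def Linear_Algebra.orthogonal_def dot_square_norm)
  have dual: "f b \<bullet> f c = (if b = c then 1 else 0)" if "b \<in> Basis" "c \<in> Basis" for b c
    using f that by (auto simp: inn bij_betw_def inj_on_eq_iff)
  have "frame_det f * frame_det f = 1" by (rule frame_det_dual[OF dual])
  then have det: "\<bar>frame_det f\<bar> = 1" by (metis abs_mult_self_eq abs_one abs_square_eq_1 power2_eq_square)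
  have frame: "frame_map f y \<bullet> f b = y \<bullet> b" if "b \<in> Basis" for y b
    using that by (simp add: frame_map_def inner_sum_left dual if_distrib[of "(*) _"] cong: if_cong)
  have m[measurable]: "(\<lambda>x. \<lambda>b\<in>C. x \<bullet> b) \<in> lborel \<rightarrow>\<^sub>M (\<Pi>\<^sub>M b\<in>C. lborel)"
    by (rule measurable_restrict) simp
  show ?thesis
  proof (rule PiM_eqI[symmetric])
    fix Z :: "'a \<Rightarrow> real set"
    assume Z: "\<And>b. b \<in> C \<Longrightarrow> Z b \<in> sets lborel"
    have Zf[measurable]: "Z (f b) \<in> sets borel" if "b \<in> Basis" for b
      using Z bij_betwE[OF f] that by simp
    let ?S = "{x. \<forall>b\<in>C. x \<bullet> b \<in> Z b}"
    have vim: "(\<lambda>x. \<lambda>b\<in>C. x \<bullet> b) -` Pi\<^sub>E C Z = ?S"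
      by (auto simp: PiE_def Pi_def)
    have Pi: "Pi\<^sub>E C Z \<in> sets (\<Pi>\<^sub>M b\<in>C. lborel)"
      using C(1) Z by (intro sets_PiM_I_finite) auto
    have S: "?S \<in> sets borel"
      using measurable_sets[OF m Pi] by (simp add: vim)
    have ind: "indicator ?S (frame_map f y) = (\<Prod>b\<in>Basis. indicator (Z (f b)) (y \<bullet> b) :: ennreal)" for y
    proof -
      have "frame_map f y \<in> ?S \<longleftrightarrow> (\<forall>b\<in>Basis. y \<bullet> b \<in> Z (f b))"
        unfolding bij_betw_imp_surj_on[OF f, symmetric] by (simp add: frame)
      then show ?thesis by (auto simp: indicator_def prod_zero_iff)
    qed
    have "emeasure ?D (Pi\<^sub>E C Z) = emeasure lborel ?S"
      using Pi by (simp add: emeasure_distr vim)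
    also have "\<dots> = (\<integral>\<^sup>+x. indicator ?S x \<partial>lborel)"
      using S by simp
    also have "\<dots> = (\<integral>\<^sup>+y. indicator ?S (frame_map f y) \<partial>lborel)"
      by (subst nn_integral_frame_map[OF dual]) (use S det in auto)
    also have "\<dots> = (\<integral>\<^sup>+y. (\<Prod>b\<in>Basis. indicator (Z (f b)) (y \<bullet> b)) \<partial>lborel)"
      by (simp only: ind)
    also have "\<dots> =
        (\<Prod>b\<in>Basis. \<integral>\<^sup>+y. indicator (Z (f b)) y \<partial>lborel)"
      by (rule nn_integral_lborel_prod) auto
    also have "\<dots> = (\<Prod>b\<in>Basis. emeasure lborel (Z (f b)))"
      by (intro prod.cong) (simp_all add: Zf)
    also have "\<dots> = (\<Prod>b\<in>C. emeasure lborel (Z b))"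
      by (rule prod.reindex_bij_betw[OF f])
    finally show "emeasure ?D (Pi\<^sub>E C Z) =
      (\<Prod>b\<in>C. emeasure lborel (Z b))" .
  qed (use C in auto)
qed

text \<open>Integrals over the hyperplane \<open>x \<bullet> l = r\<close> become integrals over the whole space, by spreading them
  along \<open>l\<close> with the probability density \<open>exp (- s)\<close>, \<open>s \<ge> 0\<close>.\<close>

definition hyperplane_weight :: "'a::euclidean_space \<Rightarrow> real \<Rightarrow> 'a \<Rightarrow> ennreal" where
  "hyperplane_weight l r x = indicator {0..} (x \<bullet> l - r) * ennreal (exp (- (x \<bullet> l - r)))"

definition hyperplane_proj :: "'a::euclidean_space \<Rightarrow> real \<Rightarrow> 'a \<Rightarrow> 'a" where
  "hyperplane_proj l r x = x - (x \<bullet> l - r) *\<^sub>R l"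

lemma measurable_hyperplane_weight [measurable]: "hyperplane_weight l r \<in> borel_measurable borel"
  unfolding hyperplane_weight_def by measurable

lemma measurable_hyperplane_proj [measurable]: "hyperplane_proj l r \<in> borel_measurable borel"
  unfolding hyperplane_proj_def by measurable

lemma sets_affine_lborel [measurable_cong]: "sets (affine_lborel A) = sets borel"
  by (simp add: affine_lborel_def Let_def case_prod_beta)

lemma space_affine_lborel [simp]: "space (affine_lborel A) = UNIV"
  by (simp add: affine_lborel_def Let_def case_prod_beta)

text \<open>\<open>affine_lborel\<close> picks an origin and an orthonormal basis \<open>B\<close>
  of the direction by \<open>SOME\<close>. Whatever the choice, \<open>l\<close> completes
  \<open>B\<close> to an orthonormal basis of the whole space, and Tonelli splits off the coordinate
  along \<open>l\<close>, whose density integrates to 1. The right-hand side is free of the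
  choice.\<close>

theorem nn_integral_affine_lborel_hyperplane:
  fixes l :: "'a::euclidean_space"
  assumes l: "norm l = 1" and F[measurable]: "F \<in> borel_measurable borel"
  shows "(\<integral>\<^sup>+u. F u \<partial>affine_lborel {u. u \<bullet> l = r}) =
    (\<integral>\<^sup>+x. F (hyperplane_proj l r x) * hyperplane_weight l r x \<partial>lborel)"
proof -
  let ?A = "{u. u \<bullet> l = r}"
  let ?ok = "\<lambda>(a, B). pairwise Linear_Algebra.orthogonal B \<and> (\<forall>b\<in>B. norm b = 1) \<and> ?A = (\<lambda>x. a + x) ` span B"
  have ll: "l \<bullet> l = 1" using l by (simp add: dot_square_norm)
  define aB where "aB = (SOME aB. ?ok aB)"
  define a where "a = fst aB"
  define B where "B = snd aB"
  have "\<exists>aB. ?ok aB"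
  proof -
    have "subspace {x. x \<bullet> l = 0}"
      using subspace_hyperplane[of l] by (simp add: inner_commute)
    then obtain B where B: "pairwise Linear_Algebra.orthogonal B" "\<forall>b\<in>B. norm b = 1" "span B = {x. x \<bullet> l = 0}"
      by (rule orthonormal_basis_subspace) auto
    have "?A = (\<lambda>x. r *\<^sub>R l + x) ` span B"
    proof (intro equalityI subsetI)
      fix x assume "x \<in> ?A"
      then show "x \<in> (\<lambda>x. r *\<^sub>R l + x) ` span B"
        by (intro image_eqI[of _ _ "x - r *\<^sub>R l"]) (auto simp: B(3) inner_diff_left ll)
    qed (auto simp: B(3) inner_add_left ll)
    then show ?thesis using B by (intro exI[of _ "(r *\<^sub>R l, B)"]) auto
  qed
  then have ok: "?ok aB" unfolding aB_def by (rule someI_ex)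
  then have B: "pairwise Linear_Algebra.orthogonal B" "\<And>b. b \<in> B \<Longrightarrow> norm b = 1" "?A = (\<lambda>x. a + x) ` span B"
    by (auto simp: a_def B_def case_prod_beta)
  have aff: "affine_lborel ?A = distr (\<Pi>\<^sub>M b\<in>B. lborel) borel (\<lambda>t. a + (\<Sum>b\<in>B. t b *\<^sub>R b))"
    by (simp add: affine_lborel_def aB_def[symmetric] a_def B_def case_prod_beta)
  have "0 \<notin> B" using B(2) by fastforce
  then have "independent B" by (rule pairwise_orthogonal_independent[OF B(1)])
  then have fin: "finite B" by (rule independent_imp_finite)
  have a: "a \<bullet> l = r"
  proof -
    have "a \<in> ?A" unfolding B(3) by (intro image_eqI[of _ _ 0]) (auto simp: span_zero)
    then show ?thesis by simp
  qed
  have spB: "x \<in> span B \<longleftrightarrow> x \<bullet> l = 0" for x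
  proof -
    have "x \<in> span B \<longleftrightarrow> a + x \<in> ?A" unfolding B(3) by auto
    then show ?thesis by (simp add: inner_add_left a)
  qed
  have bl: "b \<bullet> l = 0" if "b \<in> B" for b using span_base[OF that] by (simp add: spB)
  then have "l \<notin> B" using ll by auto
  define C where "C = insert l B"
  have C: "finite C" "pairwise Linear_Algebra.orthogonal C" "\<And>b. b \<in> C \<Longrightarrow> norm b = 1" "span C = UNIV"
  proof -
    show "finite C" using fin by (simp add: C_def)
    show "pairwise Linear_Algebra.orthogonal C"
      using B(1) bl by (auto simp: C_def pairwise_insert Linear_Algebra.orthogonal_def inner_commute)
    show "norm b = 1" if "b \<in> C" for b using that B(2) l by (auto simp: C_def)
    show "span C = UNIV"
    proof -
      have "x \<in> span C" for x
      proof -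
        have "x - (x \<bullet> l) *\<^sub>R l \<in> span B" by (simp add: spB inner_diff_left ll)
        then have "x - (x \<bullet> l) *\<^sub>R l \<in> span C" using span_mono[of B C] by (auto simp: C_def)
        moreover have "(x \<bullet> l) *\<^sub>R l \<in> span C" by (intro span_mul span_base) (simp add: C_def)
        ultimately show ?thesis by (metis diff_add_cancel span_add)
      qed
      then show ?thesis by auto
    qed
  qed
  interpret product_sigma_finite "\<lambda>_ :: 'a. lborel :: real measure"
    by standard
  define \<rho> where "\<rho> s = (indicator {0..} s * ennreal (exp (- s)))" for s :: real
  have \<rho>[measurable]: "\<rho> \<in> borel_measurable borel" unfolding \<rho>_def by measurable
  have \<rho>1: "(\<integral>\<^sup>+s. \<rho> s \<partial>lborel) = 1"
    using nn_integral_exp_half_line[of 1] by (simp add: \<rho>_def atLeast_def)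
  define H where "H t = F (a + (\<Sum>b\<in>B. t b *\<^sub>R b)) * \<rho> (t l)" for t :: "'a \<Rightarrow> real"
  have mB[measurable]: "(\<lambda>t. a + (\<Sum>b\<in>B. t b *\<^sub>R b)) \<in> (\<Pi>\<^sub>M b\<in>D. lborel) \<rightarrow>\<^sub>M borel" if "B \<subseteq> D" for D
    using that by (intro borel_measurable_add borel_measurable_sum borel_measurable_scaleR) (auto intro!: measurable_component_singleton)
  have H: "H \<in> borel_measurable (\<Pi>\<^sub>M b\<in>C. lborel)"
  proof -
    have "(\<lambda>t. t l) \<in> (\<Pi>\<^sub>M b\<in>C. lborel) \<rightarrow>\<^sub>M (borel :: real measure)"
      using measurable_component_singleton[of l C "\<lambda>_. lborel :: real measure"] by (simp add: C_def)
    then show ?thesis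
      unfolding H_def using mB[of C] by (intro borel_measurable_times_ennreal measurable_compose[OF _ F] measurable_compose[OF _ \<rho>]) (auto simp: C_def)
  qed
  have "(\<integral>\<^sup>+u. F u \<partial>affine_lborel ?A) = (\<integral>\<^sup>+t. F (a + (\<Sum>b\<in>B. t b *\<^sub>R b)) \<partial>(\<Pi>\<^sub>M b\<in>B. lborel))"
    unfolding aff by (rule nn_integral_distr) (use mB in auto)
  also have "\<dots> = (\<integral>\<^sup>+t. (\<integral>\<^sup>+s. H (t(l := s)) \<partial>lborel) \<partial>(\<Pi>\<^sub>M b\<in>B. lborel))"
  proof (rule nn_integral_cong)
    fix t :: "'a \<Rightarrow> real"
    have "(\<Sum>b\<in>B. (t(l := s)) b *\<^sub>R b) = (\<Sum>b\<in>B. t b *\<^sub>R b)" for s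
      using \<open>l \<notin> B\<close> by (intro sum.cong) auto
    then have "(\<integral>\<^sup>+s. H (t(l := s)) \<partial>lborel) = (\<integral>\<^sup>+s. F (a + (\<Sum>b\<in>B. t b *\<^sub>R b)) * \<rho> s \<partial>lborel)"
      by (simp add: H_def)
    also have "\<dots> = F (a + (\<Sum>b\<in>B. t b *\<^sub>R b))"
      by (subst nn_integral_cmult) (simp_all add: \<rho>1)
    finally show "F (a + (\<Sum>b\<in>B. t b *\<^sub>R b)) = (\<integral>\<^sup>+s. H (t(l := s)) \<partial>lborel)" by simp
  qed
  also have "\<dots> = (\<integral>\<^sup>+t. H t \<partial>(\<Pi>\<^sub>M b\<in>C. lborel))"
    using H fin \<open>l \<notin> B\<close> unfolding C_def by (subst product_nn_integral_insert) auto
  also have "\<dots> = (\<integral>\<^sup>+z. H (\<lambda>b\<in>C. z \<bullet> b) \<partial>lborel)"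
    by (subst PiM_lborel_orthonormal_basis[OF C]) (use H in \<open>auto intro!: nn_integral_distr measurable_restrict\<close>)
  also have "\<dots> = (\<integral>\<^sup>+z. F (hyperplane_proj l r (a + z)) * hyperplane_weight l r (a + z) \<partial>lborel)"
  proof (rule nn_integral_cong)
    fix z
    have "z - (z \<bullet> l) *\<^sub>R l = (\<Sum>b\<in>B. (z \<bullet> b) *\<^sub>R b)"
    proof -
      have d: "(\<Sum>b\<in>B. (z \<bullet> b) *\<^sub>R b) \<bullet> c = z \<bullet> c" if "c \<in> B" for c
        by (rule inner_orthonormal_sum[OF fin B(1,2) that])
      let ?d = "z - (z \<bullet> l) *\<^sub>R l - (\<Sum>b\<in>B. (z \<bullet> b) *\<^sub>R b)"
      have dl: "?d \<bullet> l = 0" by (simp add: inner_diff_left ll inner_sum_left bl)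
      then have "?d \<in> span B" by (simp add: spB)
      moreover have "Linear_Algebra.orthogonal ?d b" if "b \<in> B" for b
        using d[OF that] bl[OF that] by (simp add: Linear_Algebra.orthogonal_def inner_diff_left inner_commute[of l])
      ultimately have "Linear_Algebra.orthogonal ?d ?d"
        by (meson orthogonal_commute orthogonal_to_span)
      then show ?thesis by (simp add: Linear_Algebra.orthogonal_def)
    qed
    then have "hyperplane_proj l r (a + z) = a + (\<Sum>b\<in>B. (z \<bullet> b) *\<^sub>R b)"
      by (simp add: hyperplane_proj_def inner_add_left a algebra_simps)
    moreover have "(\<Sum>b\<in>B. (\<lambda>b\<in>C. z \<bullet> b) b *\<^sub>R b) = (\<Sum>b\<in>B. (z \<bullet> b) *\<^sub>R b)"
      by (rule sum.cong) (auto simp: C_def)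
    ultimately show "H (\<lambda>b\<in>C. z \<bullet> b) = F (hyperplane_proj l r (a + z)) * hyperplane_weight l r (a + z)"
      by (simp add: H_def \<rho>_def hyperplane_weight_def inner_add_left a) (simp add: C_def)
  qed
  \<comment> \<open>Translation invariance absorbs the chosen origin \<open>a\<close>.\<close>
  also have "\<dots> = (\<integral>\<^sup>+x. F (hyperplane_proj l r x) * hyperplane_weight l r x \<partial>distr lborel borel ((+) a))"
    by (subst nn_integral_distr) simp_all
  finally show ?thesis by (simp add: lborel_distr_plus)
qed

section \<open>Damped integrals over facet cones\<close>

lemma sets_facet_cone [measurable]: "facet_cone lam c i v I \<in> sets borel"
  unfolding facet_cone_def by measurable

lemma support_hyperplane_eq: "support_hyperplane lam c i = {u. u \<bullet> lam i = vec_nth c i}"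
  by (simp add: support_hyperplane_def)

abbreviation facet_lborel :: "('m::finite \<Rightarrow> 'a::euclidean_space) \<Rightarrow> real ^ 'm \<Rightarrow> 'm \<Rightarrow> 'a measure" where
  "facet_lborel lam c i \<equiv> affine_lborel (support_hyperplane lam c i)"

text \<open>Spreading along \<open>lam i\<close> produces a full-dimensional cone with edges along
  \<open>lam i\<close> and, up to sign, along the dual vectors of \<open>j \<noteq> i\<close>, to
  which \<open>nn_integral_exp_cone\<close> applies. The unit length of \<open>lam i\<close> enters
  the determinant: exchanging the dual vector of \<open>i\<close> for \<open>lam i\<close>
  multiplies it by \<open>lam i \<bullet> lam i = 1\<close>.\<close>

lemma nn_integral_exp_facet_cone:
  fixes lam :: "'m::finite \<Rightarrow> 'a::euclidean_space"
  assumes I: "basis_on lam I" and i: "i \<in> I" and l: "norm (lam i) = 1" and vl: "v \<bullet> lam i = 0"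
    and a: "\<And>j. j \<in> I - {i} \<Longrightarrow> dcoord lam I v j \<noteq> 0" and \<tau>: "\<tau> > 0"
  shows "(\<integral>\<^sup>+u. indicator (facet_cone lam c i v I) u * ennreal (exp (- (\<tau> * (u \<bullet> v))))
            \<partial>facet_lborel lam c i) =
    ennreal (exp (- (\<tau> * (mf_vertex lam c I \<bullet> v))) / (abs_det lam I * \<tau> ^ (DIM('a) - 1) * (\<Prod>j\<in>I - {i}. \<bar>dcoord lam I v j\<bar>)))"
proof -
  let ?l = "lam i" and ?r = "vec_nth c i" and ?p = "mf_vertex lam c I" and ?u = "dvec lam I"
    and ?A = "\<Prod>j\<in>I - {i}. \<bar>dcoord lam I v j\<bar>"
  have ll: "?l \<bullet> ?l = 1" using l by (simp add: dot_square_norm)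
  obtain f where f: "bij_betw f (Basis :: 'a set) I" using exists_bij_Basis[OF I] .
  have fI: "f b \<in> I" if "b \<in> Basis" for b using bij_betwE[OF f] that by simp
  have finj: "f b = f b' \<longleftrightarrow> b = b'" if "b \<in> Basis" "b' \<in> Basis" for b b'
    using bij_betw_imp_inj_on[OF f] that by (simp add: inj_on_eq_iff)
  obtain b0 where b0: "b0 \<in> Basis" "f b0 = i" using f i by (auto simp: bij_betw_def)
  \<comment> \<open>The edge vectors of the spread cone; the next family, \<open>h\<close>, is dual
    to them and consists of \<open>lam i\<close> and the projections of the other
    \<open>lam j\<close>.\<close>
  define G where "G j = (if j = i then ?l else ?u j)" for j
  define h where "h j = (if j = i then ?l else lam j - (lam j \<bullet> ?l) *\<^sub>R ?l)" for j
  \<comment> \<open>Its pairing with \<open>lam i\<close> is 1, which reproduces the weight of the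
    spreading; with the other edges it is \<open>\<tau> * dcoord lam I v j\<close>.\<close>
  define \<phi> where "\<phi> = \<tau> *\<^sub>R v + ?l"
  have ul: "?u j \<bullet> ?l = (if j = i then 1 else 0)" if "j \<in> I" for j
    using inner_dual_vec[OF I that i] by auto
  have lv: "?l \<bullet> v = 0" using vl by (simp add: inner_commute)
  have lh: "?l \<bullet> h j = (if j = i then 1 else 0)" for j
    by (simp add: h_def inner_diff_right ll inner_commute[of "lam i" "lam j"])
  have uh: "?u j \<bullet> h k = (if j = k then 1 else 0)" if "j \<in> I" "k \<in> I" "j \<noteq> i" for j k
    using that by (auto simp: h_def inner_diff_right ul inner_dual_vec[OF I])
  have dual: "(G \<circ> f) b \<bullet> (h \<circ> f) b' = (if b = b' then 1 else 0)" if "b \<in> Basis" "b' \<in> Basis" for b b'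
    unfolding finj[OF that, symmetric] using fI[OF that(1)] fI[OF that(2)]
    by (auto simp: G_def lh uh)
  have G\<phi>: "G j \<bullet> \<phi> = (if j = i then 1 else \<tau> * dcoord lam I v j)" if "j \<in> I" for j
    using that lv by (simp add: G_def \<phi>_def inner_add_right ll ul)
  have G\<phi>0: "G j \<bullet> \<phi> \<noteq> 0" if "j \<in> I" for j
    using G\<phi>[OF that] a that \<tau> by auto
  have det: "\<bar>frame_det (G \<circ> f)\<bar> = 1 / abs_det lam I"
  proof -
    have "frame_det (G \<circ> f) = frame_det ((?u \<circ> f)(b0 := \<Sum>b\<in>Basis. (lam (f b) \<bullet> ?l) *\<^sub>R (?u \<circ> f) b))"
    proof (rule frame_det_cong)
      fix b :: 'a assume b: "b \<in> Basis"
      have "(\<Sum>b\<in>Basis. (lam (f b) \<bullet> ?l) *\<^sub>R (?u \<circ> f) b) = ?l"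
        using sum_inner_scaleR_dual_vec[OF I, of ?l] by (simp add: sum.reindex_bij_betw[OF f, symmetric])
      then show "(G \<circ> f) b = ((?u \<circ> f)(b0 := \<Sum>b\<in>Basis. (lam (f b) \<bullet> ?l) *\<^sub>R (?u \<circ> f) b)) b"
        using b0 finj[OF b b0(1)] by (auto simp: G_def)
    qed
    also have "\<dots> = frame_det (?u \<circ> f)"
      by (subst frame_det_replace[OF b0(1)]) (simp add: b0 ll)
    finally have "frame_det (G \<circ> f) * frame_det (lam \<circ> f) = 1"
      using frame_det_dual_vec[OF I f] by (simp add: comp_def)
    then have "\<bar>frame_det (G \<circ> f)\<bar> * abs_det lam I = 1"
      unfolding abs_det_eq_frame_det[OF f] by (metis abs_mult abs_one)
    then show ?thesis using abs_det_pos[OF I] by (simp add: field_simps)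
  qed
  have prod: "(\<Prod>b\<in>Basis. \<bar>(G \<circ> f) b \<bullet> \<phi>\<bar>) = \<tau> ^ (DIM('a) - 1) * ?A"
  proof -
    have "(\<Prod>b\<in>Basis. \<bar>(G \<circ> f) b \<bullet> \<phi>\<bar>) = (\<Prod>j\<in>I. \<bar>G j \<bullet> \<phi>\<bar>)"
      using prod.reindex_bij_betw[OF f, of "\<lambda>j. \<bar>G j \<bullet> \<phi>\<bar>"] by simp
    also have "\<dots> = (\<Prod>j\<in>I - {i}. \<bar>G j \<bullet> \<phi>\<bar>)"
      using i by (simp add: prod.remove[of I i] G\<phi>)
    also have "\<dots> = (\<Prod>j\<in>I - {i}. \<tau> * \<bar>dcoord lam I v j\<bar>)"
      using \<tau> by (intro prod.cong refl) (simp add: G\<phi> abs_mult)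
    also have "\<dots> = \<tau> ^ card (I - {i}) * ?A"
      by (simp add: prod.distrib)
    also have "card (I - {i}) = DIM('a) - 1" using i basis_on_card[OF I] by simp
    finally show ?thesis .
  qed
  let ?z = "ennreal (exp (- (\<tau> * (?p \<bullet> v))))" and ?e = "\<lambda>x. ennreal (exp (- ((x - ?p) \<bullet> \<phi>)))"
  let ?K = "\<lambda>x. \<Prod>b\<in>Basis. indicator {r. 0 \<le> ((G \<circ> f) b \<bullet> \<phi>) * r} ((x - ?p) \<bullet> (h \<circ> f) b) :: ennreal"
  have int: "indicator (facet_cone lam c i v I) (hyperplane_proj ?l ?r x) *
      ennreal (exp (- (\<tau> * (hyperplane_proj ?l ?r x \<bullet> v)))) * hyperplane_weight ?l ?r x =
    ?z * (?K x *
            ?e x)" for x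
  proof -
    let ?y = "hyperplane_proj ?l ?r x"
    have yv: "?y \<bullet> v = x \<bullet> v"
      using lv by (simp add: hyperplane_proj_def inner_diff_left)
    have pl: "?p \<bullet> ?l = ?r" by (rule inner_mf_vertex[OF I i])
    have yl: "?y \<bullet> ?l = ?r" by (simp add: hyperplane_proj_def inner_diff_left ll)
    have xh: "(x - ?p) \<bullet> h j = (if j = i then x \<bullet> ?l - ?r else ?y \<bullet> lam j - vec_nth c j)" if "j \<in> I" for j
      using that pl inner_mf_vertex[OF I that, of c]
      by (simp add: h_def hyperplane_proj_def inner_diff_left inner_diff_right inner_commute[of "lam i" "lam j"] ring_distribs)
    have "?K x =
        (\<Prod>j\<in>I. indicator {r. 0 \<le> (G j \<bullet> \<phi>) * r} ((x - ?p) \<bullet> h j) :: ennreal)"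
      using prod.reindex_bij_betw[OF f, of "\<lambda>j. indicator {r. 0 \<le> (G j \<bullet> \<phi>) * r} ((x - ?p) \<bullet> h j) :: ennreal"] by simp
    also have "\<dots> = indicator {0..} (x \<bullet> ?l - ?r) *
        (\<Prod>j\<in>I - {i}. indicator {r. 0 \<le> (G j \<bullet> \<phi>) * r} ((x - ?p) \<bullet> h j))"
      using i by (simp add: prod.remove[of I i] G\<phi> xh indicator_def)
    also have "(\<Prod>j\<in>I - {i}. indicator {r. 0 \<le> (G j \<bullet> \<phi>) * r} ((x - ?p) \<bullet> h j)) =
        (indicator (facet_cone lam c i v I) ?y :: ennreal)"
    proof -
      have "0 \<le> (G j \<bullet> \<phi>) * ((x - ?p) \<bullet> h j) \<longleftrightarrow> 0 \<le> dcoord lam I v j * (?y \<bullet> lam j - vec_nth c j)" if "j \<in> I - {i}" for j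
        using that \<tau> by (simp add: G\<phi> xh mult.assoc zero_le_mult_iff[of \<tau>])
      then show ?thesis by (auto simp: indicator_def facet_cone_def yl prod_zero_iff)
    qed
    finally have ind: "?K x =
       indicator {0..} (x \<bullet> ?l - ?r) * (indicator (facet_cone lam c i v I) ?y :: ennreal)" .
    have "(x - ?p) \<bullet> \<phi> = \<tau> * (x \<bullet> v) - \<tau> * (?p \<bullet> v) + (x \<bullet> ?l - ?r)"
      by (simp add: \<phi>_def inner_add_right inner_diff_left pl algebra_simps)
    then have "exp (- (\<tau> * (x \<bullet> v))) * exp (- (x \<bullet> ?l - ?r)) = exp (- (\<tau> * (?p \<bullet> v))) * exp (- ((x - ?p) \<bullet> \<phi>))"
      by (simp flip: exp_add)
    then have e: "ennreal (exp (- (\<tau> * (x \<bullet> v)))) * ennreal (exp (- (x \<bullet> ?l - ?r))) =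
        ?z * ?e x"
      by (simp flip: ennreal_mult)
    have rearrange: "K * A * (J * B) = C * (J * K * D)" if "A * B = C * D" for A B C D J K :: ennreal
    proof -
      have "K * A * (J * B) = J * K * (A * B)" by (simp only: mult_ac)
      also have "\<dots> = C * (J * K * D)" unfolding that by (simp only: mult_ac)
      finally show ?thesis .
    qed
    show ?thesis
      unfolding ind yv hyperplane_weight_def by (rule rearrange[OF e])
  qed
  define F where "F u = indicator (facet_cone lam c i v I) u * ennreal (exp (- (\<tau> * (u \<bullet> v))))" for u
  have "(\<lambda>u. ennreal (exp (- (\<tau> * (u \<bullet> v))))) \<in> borel_measurable borel" by measurable
  then have F: "F \<in> borel_measurable borel"
    unfolding F_def by (intro borel_measurable_times_ennreal borel_measurable_indicator sets_facet_cone)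
  have "(\<integral>\<^sup>+u. F u \<partial>facet_lborel lam c i) =
     (\<integral>\<^sup>+x. F (hyperplane_proj ?l ?r x) * hyperplane_weight ?l ?r x \<partial>lborel)"
    unfolding support_hyperplane_eq by (rule nn_integral_affine_lborel_hyperplane[OF l F])
  also have "\<dots> = (\<integral>\<^sup>+x. ?z * (?K x *
            ?e x) \<partial>lborel)"
    unfolding F_def int ..
  also have "\<dots> = ?z * (\<integral>\<^sup>+x. ?K x *
            ?e x \<partial>lborel)"
  proof (rule nn_integral_cmult)
    have [measurable]: "{r. 0 \<le> ((G \<circ> f) b \<bullet> \<phi>) * r} \<in> sets borel" for b by measurable
    show "(\<lambda>x. ?K x *
            ?e x) \<in> borel_measurable lborel"
      by measurable
  qed
  also have "\<dots> = ?z * ennreal (\<bar>frame_det (G \<circ> f)\<bar> / (\<Prod>b\<in>Basis. \<bar>(G \<circ> f) b \<bullet> \<phi>\<bar>))"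
    by (subst nn_integral_exp_cone[OF dual]) (use G\<phi>0 fI in auto)
  also have "\<dots> = ennreal (exp (- (\<tau> * (?p \<bullet> v))) / (abs_det lam I * \<tau> ^ (DIM('a) - 1) * ?A))"
    unfolding det prod using \<tau> abs_det_pos[OF I]
    by (subst ennreal_mult[symmetric]) (simp_all add: prod_nonneg mult.assoc)
  finally show ?thesis by (simp only: F_def)
qed

text \<open>The part of \<open>q\<close> along \<open>l\<close> is constant on the hyperplane, so
  only the projection of \<open>q\<close> matters; after spreading, the equation describes a
  hyperplane of the whole space, which is a null set.\<close>

lemma AE_affine_lborel_hyperplane_neq:
  fixes l :: "'a::euclidean_space"
  assumes l: "norm l = 1" and q: "q - (q \<bullet> l) *\<^sub>R l \<noteq> 0"
  shows "AE u in affine_lborel {u. u \<bullet> l = r}. q \<bullet> u \<noteq> \<rho>"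
proof -
  let ?q = "q - (q \<bullet> l) *\<^sub>R l"
  have m: "{u. q \<bullet> u = \<rho>} \<in> sets borel" by measurable
  have "AE x in lborel. ?q \<bullet> x \<noteq> \<rho> - r * (q \<bullet> l)"
  proof -
    have "negligible {x. ?q \<bullet> x = \<rho> - r * (q \<bullet> l)}"
      by (rule negligible_hyperplane) (use q in simp)
    then have "AE x in lebesgue. ?q \<bullet> x \<noteq> \<rho> - r * (q \<bullet> l)"
      unfolding negligible_iff_null_sets by (auto dest: AE_not_in)
    then show ?thesis by (simp add: AE_completion_iff)
  qed
  then have "AE x in lborel. indicator {u. q \<bullet> u = \<rho>} (hyperplane_proj l r x) * hyperplane_weight l r x = 0"
  proof eventually_elim
    case (elim x)
    have "q \<bullet> hyperplane_proj l r x = ?q \<bullet> x + r * (q \<bullet> l)"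
      by (simp add: hyperplane_proj_def inner_diff_right inner_diff_left inner_commute[of l x] algebra_simps)
    then show ?case using elim by (auto simp: indicator_def)
  qed
  then have "(\<integral>\<^sup>+x. indicator {u. q \<bullet> u = \<rho>} (hyperplane_proj l r x) * hyperplane_weight l r x \<partial>lborel) = 0"
    by (subst nn_integral_cong_AE[of _ "\<lambda>_. 0"]) auto
  then have "(\<integral>\<^sup>+u. indicator {u. q \<bullet> u = \<rho>} u \<partial>affine_lborel {u. u \<bullet> l = r}) = 0"
    by (subst nn_integral_affine_lborel_hyperplane[OF l]) (use m in auto)
  then have "{u. q \<bullet> u = \<rho>} \<in> null_sets (affine_lborel {u. u \<bullet> l = r})"
    using m by (simp add: null_sets_def sets_affine_lborel)
  then show ?thesis by (auto dest: AE_not_in)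
qed

text \<open>Multiplying the convergent quotient by \<open>\<tau> ^ d\<close> shows that the constant
  coefficient is 0; one factor \<open>\<tau>\<close> is divided out and the degree drops.
  Convergence alone makes the poles cancel.\<close>

lemma polynomial_quotient_limit:
  fixes b :: "nat \<Rightarrow> real" and \<tau> :: "nat \<Rightarrow> real"
  assumes \<tau>: "\<And>k. \<tau> k > 0" "\<tau> \<longlonglongrightarrow> 0"
    and lim: "(\<lambda>k. (\<Sum>m\<le>d. b m * \<tau> k ^ m) / \<tau> k ^ d) \<longlonglongrightarrow> L"
  shows "L = b d"
  using lim
proof (induction d arbitrary: b)
  case 0
  then show ?case by (simp add: LIMSEQ_const_iff)
next
  case (Suc d)
  have nz: "\<tau> k \<noteq> 0" for k using \<tau>(1)[of k] by simp
  have lim0: "(\<lambda>k. (\<Sum>m\<le>Suc d. b m * \<tau> k ^ m) / \<tau> k ^ Suc d * \<tau> k ^ Suc d) \<longlonglongrightarrow> L * 0 ^ Suc d"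
    by (intro tendsto_mult Suc.prems tendsto_power \<tau>(2))
  have "(\<lambda>k. \<Sum>m\<le>Suc d. b m * \<tau> k ^ m) \<longlonglongrightarrow> 0"
  proof -
    have "x / \<tau> k ^ Suc d * \<tau> k ^ Suc d = x" for x k using nz[of k] by (simp del: power_Suc)
    moreover have "L * 0 ^ Suc d = 0" by simp
    ultimately show ?thesis using lim0 by (simp only:)
  qed
  moreover have "(\<lambda>k. \<Sum>m\<le>Suc d. b m * \<tau> k ^ m) \<longlonglongrightarrow> (\<Sum>m\<le>Suc d. b m * 0 ^ m)"
    by (intro tendsto_sum tendsto_mult tendsto_const tendsto_power \<tau>(2))
  ultimately have "(\<Sum>m\<le>Suc d. b m * 0 ^ m) = 0"
    by (rule LIMSEQ_unique[rotated])
  then have b0: "b 0 = 0"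
    by (simp add: power_0_left if_distrib[of "(*) _"] cong: if_cong)
  have "(\<Sum>m\<le>Suc d. b m * \<tau> k ^ m) / \<tau> k ^ Suc d = (\<Sum>m\<le>d. b (Suc m) * \<tau> k ^ m) / \<tau> k ^ d" for k
  proof -
    have "(\<Sum>m\<le>Suc d. b m * \<tau> k ^ m) = \<tau> k * (\<Sum>m\<le>d. b (Suc m) * \<tau> k ^ m)"
      by (subst sum.atMost_Suc_shift) (simp add: b0 sum_distrib_left mult.left_commute)
    then show ?thesis using nz[of k] by simp
  qed
  then show ?case
    using Suc.IH[of "\<lambda>m. b (Suc m)"] Suc.prems by simp
qed

lemma exp_remainder_bound:
  fixes x :: real
  shows "\<bar>exp x - (\<Sum>m\<le>d. x ^ m / fact m)\<bar> \<le> exp \<bar>x\<bar> * \<bar>x\<bar> ^ Suc d"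
proof -
  obtain t where t: "\<bar>t\<bar> \<le> \<bar>x\<bar>" "exp x = (\<Sum>m<Suc d. x ^ m / fact m) + exp t / fact (Suc d) * x ^ Suc d"
    using Maclaurin_exp_le[of x "Suc d"] by auto
  have "exp t / fact (Suc d) \<le> exp t"
    using mult_left_mono[of 1 "fact (Suc d)" "exp t"] fact_ge_1[of "Suc d"] by (simp add: divide_le_eq del: fact_Suc)
  then have "exp t / fact (Suc d) * \<bar>x\<bar> ^ Suc d \<le> exp t * \<bar>x\<bar> ^ Suc d"
    by (rule mult_right_mono) simp
  also have "exp t / fact (Suc d) * \<bar>x\<bar> ^ Suc d = \<bar>exp t / fact (Suc d) * x ^ Suc d\<bar>"
    by (simp add: abs_mult power_abs del: fact_Suc power_Suc)
  also have "exp t * \<bar>x\<bar> ^ Suc d \<le> exp \<bar>x\<bar> * \<bar>x\<bar> ^ Suc d"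
    using t(1) by (intro mult_right_mono) auto
  finally show ?thesis
    unfolding t(2) by (simp add: lessThan_Suc_atMost)
qed

text \<open>Taylor expansion up to order \<open>d\<close> leaves remainders of order
  \<open>\<tau> ^ (d + 1)\<close>. The existence of the limit is supplied by the integral side and
  forces the negative powers of \<open>\<tau>\<close> to cancel across the sum.\<close>

lemma exponential_sum_quotient_limit:
  fixes C q :: "'i \<Rightarrow> real" and \<tau> :: "nat \<Rightarrow> real"
  assumes \<tau>: "\<And>k. \<tau> k > 0" "\<tau> \<longlonglongrightarrow> 0"
    and lim: "(\<lambda>k. (\<Sum>i\<in>S. C i * exp (- (\<tau> k * q i))) / \<tau> k ^ d) \<longlonglongrightarrow> L"
  shows "L = (\<Sum>i\<in>S. C i * (- q i) ^ d / fact d)"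
proof -
  define R where "R i k = exp (- (\<tau> k * q i)) - (\<Sum>m\<le>d. (- (\<tau> k * q i)) ^ m / fact m)" for i k
  have R: "(\<lambda>k. R i k / \<tau> k ^ d) \<longlonglongrightarrow> 0" for i
  proof (rule Lim_null_comparison)
    show "\<forall>\<^sub>F k in sequentially. norm (R i k / \<tau> k ^ d) \<le> exp \<bar>\<tau> k * q i\<bar> * \<bar>q i\<bar> ^ Suc d * \<tau> k"
    proof (rule always_eventually, rule allI)
      fix k
      have "\<bar>R i k\<bar> \<le> exp \<bar>\<tau> k * q i\<bar> * \<bar>\<tau> k * q i\<bar> ^ Suc d"
        using exp_remainder_bound[of "- (\<tau> k * q i)" d] by (simp add: R_def)
      also have "\<dots> = exp \<bar>\<tau> k * q i\<bar> * \<bar>q i\<bar> ^ Suc d * \<tau> k * \<tau> k ^ d"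
        using \<tau>(1)[of k] by (simp add: abs_mult power_mult_distrib mult_ac)
      finally show "norm (R i k / \<tau> k ^ d) \<le> exp \<bar>\<tau> k * q i\<bar> * \<bar>q i\<bar> ^ Suc d * \<tau> k"
        using \<tau>(1)[of k] by (simp add: divide_le_eq)
    qed
    have "(\<lambda>k. exp \<bar>\<tau> k * q i\<bar> * \<bar>q i\<bar> ^ Suc d * \<tau> k) \<longlonglongrightarrow> exp \<bar>0 * q i\<bar> * \<bar>q i\<bar> ^ Suc d * 0"
      by (intro tendsto_intros \<tau>(2))
    then show "(\<lambda>k. exp \<bar>\<tau> k * q i\<bar> * \<bar>q i\<bar> ^ Suc d * \<tau> k) \<longlonglongrightarrow> 0" by simp
  qed
  define b where "b m = (\<Sum>i\<in>S. C i * (- q i) ^ m / fact m)" for m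
  have "(\<lambda>k. (\<Sum>i\<in>S. C i * exp (- (\<tau> k * q i))) / \<tau> k ^ d - (\<Sum>i\<in>S. C i * (R i k / \<tau> k ^ d))) \<longlonglongrightarrow> L - (\<Sum>i\<in>S. C i * 0)"
    by (intro tendsto_diff lim tendsto_sum tendsto_mult tendsto_const R)
  moreover have "(\<Sum>i\<in>S. C i * exp (- (\<tau> k * q i))) / \<tau> k ^ d - (\<Sum>i\<in>S. C i * (R i k / \<tau> k ^ d)) =
      (\<Sum>m\<le>d. b m * \<tau> k ^ m) / \<tau> k ^ d" for k
  proof -
    have "(\<Sum>i\<in>S. C i * exp (- (\<tau> k * q i))) / \<tau> k ^ d - (\<Sum>i\<in>S. C i * (R i k / \<tau> k ^ d)) =
        (\<Sum>i\<in>S. C i * (exp (- (\<tau> k * q i)) - R i k)) / \<tau> k ^ d"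
      by (simp add: sum_divide_distrib right_diff_distrib sum_subtractf diff_divide_distrib)
    also have "(\<Sum>i\<in>S. C i * (exp (- (\<tau> k * q i)) - R i k)) = (\<Sum>i\<in>S. \<Sum>m\<le>d. C i * (- q i) ^ m / fact m * \<tau> k ^ m)"
    proof (rule sum.cong)
      fix i
      have "(- (\<tau> k * q i)) ^ m = (- q i) ^ m * \<tau> k ^ m" for m
        by (simp add: mult.commute flip: power_mult_distrib)
      then show "C i * (exp (- (\<tau> k * q i)) - R i k) = (\<Sum>m\<le>d. C i * (- q i) ^ m / fact m * \<tau> k ^ m)"
        by (simp add: R_def sum_distrib_left mult.assoc)
    qed simp
    also have "\<dots> = (\<Sum>m\<le>d. b m * \<tau> k ^ m)"
      unfolding b_def sum_distrib_right by (rule sum.swap)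
    finally show ?thesis .
  qed
  ultimately have "(\<lambda>k. (\<Sum>m\<le>d. b m * \<tau> k ^ m) / \<tau> k ^ d) \<longlonglongrightarrow> L" by simp
  then show ?thesis
    using polynomial_quotient_limit[OF \<tau>] by (simp add: b_def)
qed

lemma has_bochner_integral_exp_facet_cone:
  fixes lam :: "'m::finite \<Rightarrow> 'a::euclidean_space"
  assumes I: "basis_on lam I" and i: "i \<in> I" and l: "norm (lam i) = 1" and vl: "v \<bullet> lam i = 0"
    and a: "\<And>j. j \<in> I - {i} \<Longrightarrow> dcoord lam I v j \<noteq> 0" and \<tau>: "\<tau> > 0"
  shows "has_bochner_integral (facet_lborel lam c i)
     (\<lambda>u. indicator (facet_cone lam c i v I) u * exp (- (\<tau> * (u \<bullet> v))))
     (exp (- (\<tau> * (mf_vertex lam c I \<bullet> v))) / (abs_det lam I * \<tau> ^ (DIM('a) - 1) * (\<Prod>j\<in>I - {i}. \<bar>dcoord lam I v j\<bar>)))"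
    (is "has_bochner_integral ?M ?f ?r")
proof (rule has_bochner_integral_nn_integral)
  have "?f \<in> borel_measurable borel" by measurable
  then show "?f \<in> borel_measurable ?M"
    by (simp add: measurable_cong_sets[OF sets_affine_lborel refl])
  have "(\<integral>\<^sup>+u. ennreal (?f u) \<partial>?M) =
      (\<integral>\<^sup>+u. indicator (facet_cone lam c i v I) u * ennreal (exp (- (\<tau> * (u \<bullet> v)))) \<partial>?M)"
    by (rule nn_integral_cong) (simp add: indicator_def)
  then show "(\<integral>\<^sup>+u. ennreal (?f u) \<partial>?M) = ennreal ?r"
    using nn_integral_exp_facet_cone[OF I i l vl a \<tau>] by simp
qed (use abs_det_pos[OF I] \<tau> in \<open>auto intro!: prod_nonneg divide_nonneg_nonneg mult_nonneg_nonneg\<close>)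

text \<open>Each position condition of \<open>facet_density_eq_0\<close> fails only on finitely many
  hyperplanes whose normals have a nonzero component orthogonal to \<open>lam i\<close>, so it holds
  almost everywhere on the facet hyperplane.\<close>

lemma AE_facet_density_eq_0:
  assumes bs: "ordered_basis bs" and fan: "complete_multi_fan bs w lam"
    and l: "norm (lam i) = 1" and v: "facet_generic w lam i v"
    and far: "\<And>I. I \<in> tops w lam \<Longrightarrow> i \<in> I \<Longrightarrow> norm (mf_vertex lam c I) \<le> R"
  shows "AE u in facet_lborel lam c i. R < norm u \<longrightarrow> facet_density w lam c i v u = 0"
proof -
  let ?M = "facet_lborel lam c i"
  have neq: "AE u in ?M. q \<bullet> u \<noteq> \<rho>" if "q - (q \<bullet> lam i) *\<^sub>R lam i \<noteq> 0" for q \<rho>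
    unfolding support_hyperplane_eq by (rule AE_affine_lborel_hyperplane_neq[OF l that])
  have ul: "dvec lam I j \<bullet> lam i = 0" if "I \<in> tops w lam" "i \<in> I" "j \<in> I - {i}" for I j
    using that by (subst inner_dual_vec[OF top_basis_on[OF fan that(1)]]) auto
  have 1: "AE u in ?M. \<forall>I\<in>star w lam i. \<forall>j\<in>I - {i}. lam j \<bullet> u \<noteq> vec_nth c j"
  proof (intro AE_finite_allI neq)
    fix I j assume I: "I \<in> star w lam i" and j: "j \<in> I - {i}"
    then have "dvec lam I j \<bullet> (lam j - (lam j \<bullet> lam i) *\<^sub>R lam i) = 1"
      using ul[of I j] inner_dual_vec[OF top_basis_on[OF fan], of I j j]
      by (simp add: inner_diff_right)
    then show "lam j - (lam j \<bullet> lam i) *\<^sub>R lam i \<noteq> 0" by auto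
  qed auto
  have 2: "AE u in ?M. \<forall>I\<in>star w lam i. \<forall>j\<in>I - {i}. dcoord lam I u j \<noteq> 0"
  proof (intro AE_finite_allI neq)
    fix I j assume I: "I \<in> star w lam i" and j: "j \<in> I - {i}"
    then show "dvec lam I j - (dvec lam I j \<bullet> lam i) *\<^sub>R lam i \<noteq> 0"
      using ul[of I j] dual_vec_nonzero[OF top_basis_on[OF fan], of I j] by simp
  qed auto
  have 3: "AE u in ?M. \<forall>I\<in>star w lam i. \<forall>j\<in>I - {i}. \<forall>k\<in>I - {i} - {j}.
      (dcoord lam I v j *\<^sub>R dvec lam I k - dcoord lam I v k *\<^sub>R dvec lam I j) \<bullet> u \<noteq> 0"
  proof (intro AE_finite_allI neq)
    fix I j k assume I: "I \<in> star w lam i" and j: "j \<in> I - {i}" and k: "k \<in> I - {i} - {j}"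
    let ?q = "dcoord lam I v j *\<^sub>R dvec lam I k - dcoord lam I v k *\<^sub>R dvec lam I j"
    have "?q \<bullet> lam i = 0" using I j k by (simp add: inner_diff_left ul)
    moreover have "?q \<noteq> 0"
      using I j k v top_basis_on[OF fan]
      by (intro dual_vec_combination_nonzero) (auto simp: facet_generic_def)
    ultimately show "?q - (?q \<bullet> lam i) *\<^sub>R lam i \<noteq> 0" by simp
  qed auto
  have 4: "AE u in ?M. u \<bullet> lam i = vec_nth c i"
  proof -
    have "(\<integral>\<^sup>+u. indicator {u. u \<bullet> lam i \<noteq> vec_nth c i} u \<partial>?M) = 0"
    proof -
      have "hyperplane_proj (lam i) (vec_nth c i) x \<bullet> lam i = vec_nth c i" for x
        using l by (simp add: hyperplane_proj_def inner_diff_left dot_square_norm)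
      moreover have "{u. u \<bullet> lam i \<noteq> vec_nth c i} \<in> sets borel" by measurable
      ultimately show ?thesis
        unfolding support_hyperplane_eq by (subst nn_integral_affine_lborel_hyperplane[OF l]) auto
    qed
    moreover have "{u. u \<bullet> lam i \<noteq> vec_nth c i} \<in> sets ?M"
      unfolding sets_affine_lborel by measurable
    ultimately have "{u. u \<bullet> lam i \<noteq> vec_nth c i} \<in> null_sets ?M" by (simp add: null_sets_def)
    then show ?thesis by (auto dest: AE_not_in)
  qed
  show ?thesis
    using 1 2 3 4
  proof eventually_elim
    case (elim u)
    show ?case
    proof
      assume "R < norm u"
      show "facet_density w lam c i v u = 0"
      proof (rule facet_density_eq_0[OF bs fan v])
        show "norm (mf_vertex lam c I) < norm u" if "I \<in> tops w lam" "i \<in> I" for I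
          using far[OF that] \<open>R < norm u\<close> by simp
        show "dcoord lam I v j * dcoord lam I u k \<noteq> dcoord lam I v k * dcoord lam I u j"
          if "I \<in> tops w lam" "i \<in> I" "j \<in> I - {i}" "k \<in> I - {i}" "j \<noteq> k" for I j k
        proof -
          have "(dcoord lam I v j *\<^sub>R dvec lam I k - dcoord lam I v k *\<^sub>R dvec lam I j) \<bullet> u \<noteq> 0"
            using elim(3) that by blast
          then show ?thesis by (simp add: inner_diff_left)
        qed
      qed (use elim in \<open>auto simp: inner_commute\<close>)
    qed
  qed
qed

section \<open>Volumes of facets\<close>

text \<open>The sign of a cone in \<open>DH\<close> and the sign from \<open>(- q) ^ (n - 1)\<close>
  turn the absolute values produced by integration into signed factors.\<close>

lemma sign_over_prod_abs:
  fixes a :: "'i \<Rightarrow> real"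
  assumes "finite J" "\<And>j. j \<in> J \<Longrightarrow> a j \<noteq> 0"
  shows "(-1) ^ card {j \<in> J. a j > 0} * (-1) ^ card J / (\<Prod>j\<in>J. \<bar>a j\<bar>) = 1 / (\<Prod>j\<in>J. a j)"
proof -
  have "(-1) ^ card {j \<in> J. a j > 0} * (-1) ^ card J / (\<Prod>j\<in>J. \<bar>a j\<bar>) =
      (\<Prod>j\<in>J. (if a j > 0 then -1 else 1) * -1 / \<bar>a j\<bar>)"
    by (simp only: neg_one_power_card_filter[OF assms(1)] prod_dividef prod.distrib prod_constant)
  also have "\<dots> = (\<Prod>j\<in>J. 1 / a j)"
    using assms(2) by (intro prod.cong) (auto simp: abs_if)
  finally show ?thesis by (simp add: prod_dividef)
qed

lemma exists_facet_generic:
  assumes fan: "complete_multi_fan bs w lam"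
  shows "\<exists>v. facet_generic w lam i v"
proof -
  let ?S = "{x. x \<bullet> lam i = 0}"
  let ?Q = "\<Union>I\<in>star w lam i. dvec lam I ` (I - {i})"
  have "\<exists>v\<in>?S. \<forall>q\<in>?Q. q \<bullet> v \<noteq> 0"
  proof (rule exists_nonorthogonal)
    show "subspace ?S" using subspace_hyperplane[of "lam i"] by (simp add: inner_commute)
    fix q assume "q \<in> ?Q"
    then obtain I j where I: "I \<in> tops w lam" "i \<in> I" "j \<in> I - {i}" "q = dvec lam I j" by auto
    note b = top_basis_on[OF fan I(1)]
    have "q \<in> ?S" using inner_dual_vec[OF b _ I(2), of j] I by auto
    moreover have "q \<noteq> 0" using dual_vec_nonzero[OF b] I by auto
    ultimately show "\<exists>s\<in>?S. q \<bullet> s \<noteq> 0" by (intro bexI[of _ q]) simp_all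
  qed auto
  then show ?thesis by (force simp: facet_generic_def)
qed

lemma integral_facet_density:
  fixes lam :: "'m::{finite,linorder} \<Rightarrow> 'a::euclidean_space"
  assumes bs: "ordered_basis bs" and fan: "complete_multi_fan bs w lam"
    and l: "norm (lam i) = 1" and v: "facet_generic w lam i v"
  shows "(\<integral>u. facet_density w lam c i v u \<partial>facet_lborel lam c i) =
    facet_sum w lam c i v / fact (DIM('a) - 1)"
proof -
  let ?M = "facet_lborel lam c i"
  define d where "d = DIM('a) - 1"
  define S where "S = star w lam i"
  have basis: "basis_on lam I" and iI: "i \<in> I" if "I \<in> S" for I
    using that top_basis_on[OF fan] by (auto simp: S_def)
  have vl: "v \<bullet> lam i = 0" and a: "\<And>I j. I \<in> S \<Longrightarrow> j \<in> I - {i} \<Longrightarrow> dcoord lam I v j \<noteq> 0"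
    using v by (auto simp: facet_generic_def S_def)
  define sg where "sg I = (-1 :: real) ^ card {j \<in> I - {i}. dcoord lam I v j > 0}" for I
  have abs_sg: "\<bar>sg I\<bar> = 1" for I by (simp add: sg_def power_abs)
  define R where "R = (\<Sum>I\<in>S. norm (mf_vertex lam c I))"
  have far: "norm (mf_vertex lam c I) \<le> R" if "I \<in> tops w lam" "i \<in> I" for I
    unfolding R_def using that by (intro member_le_sum[of I S]) (auto simp: S_def)
  define P where "P I = abs_det lam I * (\<Prod>j\<in>I - {i}. \<bar>dcoord lam I v j\<bar>)" for I
  have hb: "has_bochner_integral ?M (\<lambda>u. indicator (facet_cone lam c i v I) u * exp (- (t * (u \<bullet> v))))
     (exp (- (t * (mf_vertex lam c I \<bullet> v))) / (abs_det lam I * t ^ d * (\<Prod>j\<in>I - {i}. \<bar>dcoord lam I v j\<bar>)))"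
    if "I \<in> S" "t > 0" for I t
    unfolding d_def by (rule has_bochner_integral_exp_facet_cone[OF basis iI l vl a]) (use that in auto)
  define \<tau> where "\<tau> k = inverse (real (Suc k))" for k
  have \<tau>: "\<tau> k > 0" "\<tau> k \<le> 1" for k by (simp_all add: \<tau>_def field_simps)
  have \<tau>0: "\<tau> \<longlonglongrightarrow> 0" unfolding \<tau>_def by (rule LIMSEQ_inverse_real_of_nat)
  define \<phi> where "\<phi> = facet_density w lam c i v"
  have \<phi>: "\<phi> u = (\<Sum>I\<in>S. sg I * w I * indicator (facet_cone lam c i v I) u)" for u
    by (simp add: \<phi>_def facet_density_def S_def sg_def)
  have \<phi>_abs: "\<bar>\<phi> u\<bar> \<le> (\<Sum>I\<in>S. \<bar>w I\<bar> * indicator (facet_cone lam c i v I) u)" for u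
    unfolding \<phi> by (rule order.trans[OF sum_abs]) (simp add: abs_mult abs_sg)
  have \<phi>_meas[measurable]: "\<phi> \<in> borel_measurable borel"
    unfolding \<phi>[abs_def] by measurable
  have int: "(\<integral>u. \<phi> u * exp (- (\<tau> k * (u \<bullet> v))) \<partial>?M) =
     (\<Sum>I\<in>S. sg I * w I / P I * exp (- (\<tau> k * (mf_vertex lam c I \<bullet> v)))) / \<tau> k ^ d" for k
  proof -
    let ?r = "\<Sum>I\<in>S. sg I * w I * (exp (- (\<tau> k * (mf_vertex lam c I \<bullet> v))) / (abs_det lam I * \<tau> k ^ d * (\<Prod>j\<in>I - {i}. \<bar>dcoord lam I v j\<bar>)))"
    let ?f = "\<lambda>u. \<Sum>I\<in>S. sg I * w I * (indicator (facet_cone lam c i v I) u * exp (- (\<tau> k * (u \<bullet> v))))"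
    have "has_bochner_integral ?M ?f ?r"
      by (intro has_bochner_integral_sum has_bochner_integral_mult_right hb \<tau>(1))
    moreover have "\<phi> u * exp (- (\<tau> k * (u \<bullet> v))) = ?f u" for u
      by (simp add: \<phi> sum_distrib_right mult.assoc)
    ultimately have "(\<integral>u. \<phi> u * exp (- (\<tau> k * (u \<bullet> v))) \<partial>?M) = ?r"
      by (simp only: has_bochner_integral_integral_eq)
    also have "\<dots> = (\<Sum>I\<in>S. sg I * w I / P I * exp (- (\<tau> k * (mf_vertex lam c I \<bullet> v)))) / \<tau> k ^ d"
      by (simp add: P_def sum_divide_distrib mult_ac)
    finally show ?thesis .
  qed
  have "(\<lambda>k. \<integral>u. \<phi> u * exp (- (\<tau> k * (u \<bullet> v))) \<partial>?M) \<longlonglongrightarrow> (\<integral>u. \<phi> u \<partial>?M)"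
  proof (rule integral_dominated_convergence)
    \<comment> \<open>The integrable case \<open>\<tau> = 1\<close> dominates: within radius
      \<open>R\<close> the exponent \<open>- \<tau> (u \<bullet> v)\<close> exceeds
      \<open>- (u \<bullet> v)\<close> by at most \<open>R * norm v\<close>, and beyond it the
      density is 0 almost everywhere.\<close>
    let ?w = "\<lambda>u. exp (R * norm v) * (\<Sum>I\<in>S. \<bar>w I\<bar> * (indicator (facet_cone lam c i v I) u * exp (- (1 * (u \<bullet> v)))))"
    have "integrable ?M (\<lambda>u. indicator (facet_cone lam c i v I) u * exp (- (1 * (u \<bullet> v))))" if "I \<in> S" for I
      using hb[OF that, of 1] by (simp add: has_bochner_integral_iff)
    then show "integrable ?M ?w"
      by (intro integrable_mult_right Bochner_Integration.integrable_sum)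
    show "\<phi> \<in> borel_measurable ?M" "(\<lambda>u. \<phi> u * exp (- (\<tau> k * (u \<bullet> v)))) \<in> borel_measurable ?M" for k
      by (simp_all add: measurable_cong_sets[OF sets_affine_lborel refl])
    show "AE u in ?M. (\<lambda>k. \<phi> u * exp (- (\<tau> k * (u \<bullet> v)))) \<longlonglongrightarrow> \<phi> u"
    proof (rule AE_I2)
      fix u
      have "(\<lambda>k. \<phi> u * exp (- (\<tau> k * (u \<bullet> v)))) \<longlonglongrightarrow> \<phi> u * exp (- (0 * (u \<bullet> v)))"
        by (intro tendsto_intros \<tau>0)
      then show "(\<lambda>k. \<phi> u * exp (- (\<tau> k * (u \<bullet> v)))) \<longlonglongrightarrow> \<phi> u" by simp
    qed
    have "AE u in ?M. R < norm u \<longrightarrow> facet_density w lam c i v u = 0"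
      by (rule AE_facet_density_eq_0[OF bs fan l v far])
    then show "AE u in ?M. norm (\<phi> u * exp (- (\<tau> k * (u \<bullet> v)))) \<le> ?w u" for k
    proof eventually_elim
      case (elim u)
      have w0: "0 \<le> ?w u" by (intro mult_nonneg_nonneg sum_nonneg) auto
      show ?case
      proof (cases "R < norm u")
        case True
        then show ?thesis using elim w0 by (simp add: \<phi>_def)
      next
        case False
        have "(1 - \<tau> k) * (u \<bullet> v) \<le> (1 - \<tau> k) * (norm u * norm v)"
          using \<tau>(2)[of k] norm_cauchy_schwarz[of u v] by (intro mult_left_mono) auto
        also have "\<dots> \<le> 1 * (norm u * norm v)"
          using \<tau>(1)[of k] by (intro mult_right_mono) auto
        also have "\<dots> \<le> R * norm v" using False by (simp add: mult_right_mono)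
        finally have "- (\<tau> k * (u \<bullet> v)) \<le> R * norm v + - (1 * (u \<bullet> v))" by (simp add: algebra_simps)
        then have "exp (- (\<tau> k * (u \<bullet> v))) \<le> exp (R * norm v) * exp (- (1 * (u \<bullet> v)))"
          unfolding exp_add[symmetric] by simp
        then have "\<bar>\<phi> u\<bar> * exp (- (\<tau> k * (u \<bullet> v))) \<le>
            (\<Sum>I\<in>S. \<bar>w I\<bar> * indicator (facet_cone lam c i v I) u) * (exp (R * norm v) * exp (- (1 * (u \<bullet> v))))"
          using \<phi>_abs[of u] by (intro mult_mono) (auto intro!: sum_nonneg)
        also have "\<dots> = ?w u" by (simp only: sum_distrib_right sum_distrib_left mult_ac)
        finally show ?thesis by (simp only: real_norm_def abs_mult abs_exp_cancel)
      qed
    qed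
  qed
  \<comment> \<open>The order \<open>d = n - 1\<close> of the pole is also the order of the Taylor
    coefficient that survives; this is the origin of \<open>fact d\<close>.\<close>
  then have "(\<integral>u. \<phi> u \<partial>?M) = (\<Sum>I\<in>S. sg I * w I / P I * (- (mf_vertex lam c I \<bullet> v)) ^ d / fact d)"
    unfolding int by (rule exponential_sum_quotient_limit[OF \<tau>(1) \<tau>0])
  also have "\<dots> = (\<Sum>I\<in>S. w I * (\<Sum>j\<in>I. vec_nth c j * dcoord lam I v j) ^ d /
     (abs_det lam I * (\<Prod>j\<in>I - {i}. dcoord lam I v j)) / fact d)"
  proof (rule sum.cong)
    fix I assume I: "I \<in> S"
    let ?q = "mf_vertex lam c I \<bullet> v" and ?A = "\<Prod>j\<in>I - {i}. \<bar>dcoord lam I v j\<bar>"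
    have d: "card (I - {i}) = d" using iI[OF I] basis_on_card[OF basis[OF I]] by (simp add: d_def)
    have sign: "sg I * (-1) ^ d / ?A = 1 / (\<Prod>j\<in>I - {i}. dcoord lam I v j)"
      unfolding sg_def d[symmetric] by (rule sign_over_prod_abs) (use a I in auto)
    have "sg I * w I / P I * (- ?q) ^ d = (sg I * (-1) ^ d / ?A) * (w I * ?q ^ d / abs_det lam I)"
      by (simp add: P_def power_minus[of ?q] mult_ac)
    also have "\<dots> = w I * ?q ^ d / (abs_det lam I * (\<Prod>j\<in>I - {i}. dcoord lam I v j))"
      unfolding sign by (simp add: mult_ac)
    finally show "sg I * w I / P I * (- ?q) ^ d / fact d = w I * (\<Sum>j\<in>I. vec_nth c j * dcoord lam I v j) ^ d /
     (abs_det lam I * (\<Prod>j\<in>I - {i}. dcoord lam I v j)) / fact d"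
      by (simp add: mf_vertex_inner)
  qed simp
  also have "\<dots> = facet_sum w lam c i v / fact d"
    by (simp add: facet_sum_def S_def d_def sum_divide_distrib)
  finally show ?thesis by (simp add: \<phi>_def d_def)
qed

text \<open>A vector orthogonal to \<open>lam i\<close> may fail to be generic for the whole
  multi-fan. A small shift along \<open>z\<close> makes it generic, and there the sum is constant by
  \<open>eta_eq_facet_sum\<close>; no denominator of the sum vanishes at \<open>v\<close>, so the
  value persists in the limit.\<close>

lemma facet_sum_facet_generic:
  assumes bs: "ordered_basis bs" and fan: "complete_multi_fan bs w lam"
    and v: "facet_generic w lam i v" and z: "generic w lam z"
  shows "facet_sum w lam c i v = facet_sum w lam c i z"
proof -
  let ?f = "\<lambda>e. facet_sum w lam c i (v + e *\<^sub>R z)"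
  have "(?f \<longlongrightarrow> ?f 0) (at_right (0 :: real))"
    unfolding facet_sum_def
  proof (intro tendsto_intros)
    fix I assume I: "I \<in> star w lam i"
    have "(\<Prod>j\<in>I - {i}. dcoord lam I v j) \<noteq> 0"
      using v I by (auto simp: facet_generic_def)
    then show "abs_det lam I * (\<Prod>j\<in>I - {i}. dvec lam I j \<bullet> (v + 0 *\<^sub>R z)) \<noteq> 0"
      using abs_det_pos[OF top_basis_on[OF fan], of I] I by auto
  qed
  moreover have "\<forall>\<^sub>F e in at_right (0 :: real). ?f e = facet_sum w lam c i z"
  proof -
    have "\<forall>\<^sub>F e in at_right (0 :: real). \<forall>I\<in>tops w lam. \<forall>j\<in>I. e \<noteq> - dcoord lam I v j / dcoord lam I z j"
      by (intro eventually_ball_finite ballI eventually_neq_at_within) auto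
    then show ?thesis
    proof eventually_elim
      case (elim e)
      have "dcoord lam I (v + e *\<^sub>R z) j \<noteq> 0" if "I \<in> tops w lam" "j \<in> I" for I j
      proof
        assume "dcoord lam I (v + e *\<^sub>R z) j = 0"
        then have "e * dcoord lam I z j = - dcoord lam I v j" by (simp add: inner_add_right)
        moreover have "dcoord lam I z j \<noteq> 0" using z that by (simp add: mf_generic_def)
        ultimately have "e = - dcoord lam I v j / dcoord lam I z j"
          by (metis nonzero_mult_div_cancel_right)
        then show False using elim that by blast
      qed
      then have "generic w lam (v + e *\<^sub>R z)" by (simp add: mf_generic_def)
      then have "(\<chi> i. facet_sum w lam c i (v + e *\<^sub>R z)) = (\<chi> i. facet_sum w lam c i z)"
        using eta_eq_facet_sum[OF bs fan, of _ c] z by metis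
      then show ?case by (simp add: vec_eq_iff)
    qed
  qed
  then have "(?f \<longlongrightarrow> facet_sum w lam c i z) (at_right (0 :: real))"
    by (rule tendsto_eventually)
  ultimately have "?f 0 = facet_sum w lam c i z"
    by (rule tendsto_unique[rotated]) simp
  then show ?thesis by simp
qed

text \<open>In dimension one a unit vector is its own dual, so the determinant is its own
  inverse.\<close>

lemma abs_det_singleton:
  fixes lam :: "'m \<Rightarrow> 'a::euclidean_space"
  assumes I: "basis_on lam {i}" and l: "norm (lam i) = 1"
  shows "abs_det lam {i} = 1"
proof -
  obtain f where f: "bij_betw f (Basis :: 'a set) {i}" using exists_bij_Basis[OF I] .
  have "dvec lam {i} i = lam i"
    by (rule eq_if_inner_basis_on[OF I]) (use l inner_dual_vec[OF I] in \<open>auto simp: dot_square_norm\<close>)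
  then have "frame_det (\<lambda>b. dvec lam {i} (f b)) = frame_det (lam \<circ> f)"
    using bij_betwE[OF f] by (intro frame_det_cong) auto
  then have "frame_det (lam \<circ> f) * frame_det (lam \<circ> f) = 1"
    using frame_det_dual_vec[OF I f] by simp
  then have "\<bar>frame_det (lam \<circ> f)\<bar> = 1"
    by (auto simp: square_eq_1_iff)
  then show ?thesis by (simp add: abs_det_eq_frame_det[OF f])
qed

theorem facet_volume_eq_facet_sum:
  fixes lam :: "'m::{finite,linorder} \<Rightarrow> 'a::euclidean_space"
  assumes bs: "ordered_basis bs" and fan: "complete_multi_fan bs w lam"
    and l: "norm (lam i) = 1" and z: "generic w lam z"
  shows "facet_volume w lam c i = facet_sum w lam c i z / fact (DIM('a) - 1)"
proof -
  have l0: "lam i \<noteq> 0" using l by auto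
  consider "{i} \<notin> mf_complex TYPE('a) w" | "{i} \<in> mf_complex TYPE('a) w" "DIM('a) = 1"
    | "{i} \<in> mf_complex TYPE('a) w" "DIM('a) \<noteq> 1" by blast
  then show ?thesis
  proof cases
    case 1
    then have "star w lam i = {}" by (auto simp: mf_complex_def)
    then have "facet_sum w lam c i z = 0" unfolding facet_sum_def by (simp only: sum.empty)
    then show ?thesis using 1 by (simp add: facet_volume_def)
  next
    case 2
    have single: "I = {i}" if "I \<in> tops w lam" "i \<in> I" for I
      using that 2(2) by (auto simp: mf_tops_def card_1_singleton_iff)
    obtain I where "I \<in> tops w lam" "i \<in> I" using 2(1) by (auto simp: mf_complex_def)
    then have top: "{i} \<in> tops w lam" using single by metis
    then have sing: "star w lam i = {{i}}"
      by (intro equalityI subsetI) (use single in blast)+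
    \<comment> \<open>The exponent \<open>DIM('a) - 1\<close> is 0, the product is empty and the
      determinant is 1, so only the weight is left.\<close>
    have "facet_sum w lam c i z = w {i}"
      unfolding facet_sum_def sing 2(2)
      using abs_det_singleton[OF top_basis_on[OF fan top] l] by simp
    moreover have "facet_volume w lam c i = w {i}"
      unfolding facet_volume_def using 2 by (simp only: simp_thms if_False if_True)
    ultimately show ?thesis by (simp add: 2(2))
  next
    case 3
    let ?A = "support_hyperplane lam c i"
    define v where "v = (SOME v. mf_generic (direction ?A) (facet_vertices w lam i) (\<lambda>J. w (insert i J))
      (facet_lam lam i) v)"
    have "v = (SOME v. facet_generic w lam i v)"
      unfolding v_def direction_support_hyperplane[of lam i c, OF l0] mf_generic_facet_iff[OF fan, of i, OF l0] ..
    then have v: "facet_generic w lam i v"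
      using someI_ex[OF exists_facet_generic[OF fan]] by simp
    have DH: "DH ?A (facet_vertices w lam i) (\<lambda>J. w (insert i J)) (facet_lam lam i)
        (facet_hyperplanes lam c i) v = facet_density w lam c i v"
      by (rule ext) (rule DH_facet[OF fan l0 v])
    have "facet_volume w lam c i = (\<integral>u. facet_density w lam c i v u \<partial>affine_lborel ?A)"
      using 3 by (simp add: facet_volume_def mp_volume_def Let_def v_def[symmetric] DH)
    then show ?thesis
      by (simp add: integral_facet_density[of bs w lam i, OF bs fan l v] facet_sum_facet_generic[OF bs fan v z])
  qed
qed

theorem theorem9p9:
  fixes bs :: "'a::euclidean_space list"
    and w :: "'m::{finite,linorder} set \<Rightarrow> real"
    and lam :: "'m \<Rightarrow> 'a"
    and c V :: "real ^ 'm::{finite,linorder}"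
  assumes "ordered_basis bs"
    and "complete_multi_fan bs w lam"
    and "\<forall>i. norm (lam i) = 1"
    and "V \<in> mink lam"
  shows "(\<forall>i. facet_volume w lam c i = vec_nth V i) \<longleftrightarrow>
         eta w lam (partial_P w lam c [^]\<^bsub>mf_algebra w lam\<^esub> (DIM('a) - 1)) = fact (DIM('a) - 1) *\<^sub>R V"
proof -
  \<comment> \<open>One generic \<open>z\<close> serves all facets and the algebraic side: both
    statements become equations for the same numbers \<open>facet_sum w lam c i z\<close>, divided
    by \<open>(n - 1)!\<close> on the side of the volumes.\<close>
  obtain z where z: "generic w lam z"
    using exists_generic[OF assms(2)] by blast
  have "facet_volume w lam c i = facet_sum w lam c i z / fact (DIM('a) - 1)" for i
    using facet_volume_eq_facet_sum[OF assms(1,2) _ z] assms(3) by blast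
  then show ?thesis
    unfolding eta_eq_facet_sum[OF assms(1,2) z]
    by (simp add: vec_eq_iff divide_eq_eq mult.commute)
qed

end
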